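(* Let $X$ be a HLOTS. (a) If $\alpha$ is a countable tail-like ordinal, then $X_{\alpha}$ is a HLOTS and its completion $\widehat{X_{\alpha}}$ is a CHLOTS. In particular, if $X$ is a CHLOTS, then $X_{\alpha}$ is a CHLOTS for each countable tail-like ordinal $\alpha$. (b) Assume $X$ is a CHLOTS. If $\alpha$ and $\beta$ are positive ordinals with $\alpha > \beta$, then $X_{\alpha}$ is bigger than $X_{\beta}$; that is, there is an order injection from $X_{\beta}$ into $X_{\alpha}$ but no order injection from $X_\alpha$ into $X_\beta$. In addition, $X_{\alpha}$ is not homeomorphic to $X_{\beta}$. (c) Assume $X$ is an $\mathbb{R}$-bounded IHLOTS. If $\alpha$ and $\beta$ are sufficiently large countable tail-like ordinals with $\alpha > \beta$ (i.e. there is a countable ordinal $\theta$ such that this holds for all countable tail-like $\alpha>\beta\geq\theta$), then $\widehat{X_{\alpha}}$ is bigger than $\widehat{X_{\beta}}$.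
   Context: A LOTS is a totally ordered set with the order topology. A subset of a LOTS is bounded if it is contained in some $[a,b]$. A LOTS is complete if every nonempty bounded subset has a supremum and an infimum; order dense if between any two distinct points there is another point. An order map is a map $f$ with $a\le b\Rightarrow f(a)\le f(b)$ (not assumed continuous); an order injection is an injective order map; an order isomorphism is a bijective order map. A HLOTS is a LOTS with at least three points which is order isomorphic to every nonempty open convex subset of itself. A CHLOTS is a complete HLOTS; an IHLOTS is a HLOTS which is not complete. Every HLOTS is order dense and has neither max nor min. The completion $\hat Y$ of an order dense LOTS $Y$ is the (essentially unique) complete order dense LOTS containing $Y$ as a dense subset and having a max (resp. min) iff $Y$ does. For LOTS $Y, Y_1$: $Y$ injects into $Y_1$ if there is an order injection $Y\to Y_1$; $Y_1$ is bigger than $Y$ if $Y$ injects into $Y_1$ but $Y_1$ does not inject into $Y$. An ordinal $\alpha$ is tail-like if $\alpha>0$ and $\beta+\alpha=\alpha$ for all $\beta<\alpha$ (equivalently $\alpha=\omega^\gamma$ for some ordinal $\gamma$). For a positive ordinal $\alpha$, $X^\alpha$ is the set of functions $\alpha\to X$ with the lexicographic order ($x<y$ iff $x_\beta<y_\beta$ at the least $\beta$ with $x_\beta\neq y_\beta$). For $X$ a HLOTS fix a closed bounded interval $J=[-1,+1]\subset X$ with endpoints labelled $-1<+1$; then $X_\alpha=\{x\in X^\alpha: x_i\in J \text{ for all } 0<i<\alpha\}$ with the induced order. (Up to order isomorphism this does not depend on the choice of $J$.) A LOTS is $\mathbb{R}$-bounded if it admits an order injection into $\mathbb{R}_\delta$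 for some countable ordinal $\delta>0$. *)

theory Defs
  imports "HOL-Analysis.Analysis"
begin

unbundle cardinal_syntax

text \<open>
  A LOTS is a reflexive linear order relation r with carrier \<^term>\<open>Field r\<close>; a subset
  A of it with the induced order is \<^term>\<open>Restr r A\<close>. Order maps between LOTS are the
  functions satisfying \<^const>\<open>compat\<close>; these need not be continuous.
\<close>

abbreviation lots :: "'a rel \<Rightarrow> bool" where
  "lots r \<equiv> Linear_order r"

definition lots_topology :: "'a rel \<Rightarrow> 'a topology" where
  "lots_topology r =
     topology_generated_by ({Field r} \<union> underS r ` Field r \<union> aboveS r ` Field r)"

definition lots_interval :: "'a rel \<Rightarrow> 'a \<Rightarrow> 'a \<Rightarrow> 'a set" where
  "lots_interval r a b = {x. (a, x) \<in> r \<and> (x, b) \<in> r}"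

definition lots_bounded :: "'a rel \<Rightarrow> 'a set \<Rightarrow> bool" where
  "lots_bounded r A \<longleftrightarrow> (\<exists>a\<in>Field r. \<exists>b\<in>Field r. A \<subseteq> lots_interval r a b)"

definition lots_convex :: "'a rel \<Rightarrow> 'a set \<Rightarrow> bool" where
  "lots_convex r C \<longleftrightarrow> C \<subseteq> Field r \<and> (\<forall>a\<in>C. \<forall>b\<in>C. lots_interval r a b \<subseteq> C)"

definition is_sup :: "'a rel \<Rightarrow> 'a set \<Rightarrow> 'a \<Rightarrow> bool" where
  "is_sup r A s \<longleftrightarrow> s \<in> Above r A \<and> (\<forall>u\<in>Above r A. (s, u) \<in> r)"

definition is_inf :: "'a rel \<Rightarrow> 'a set \<Rightarrow> 'a \<Rightarrow> bool" where
  "is_inf r A s \<longleftrightarrow> s \<in> Under r A \<and> (\<forall>l\<in>Under r A. (l, s) \<in> r)"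

definition has_max :: "'a rel \<Rightarrow> bool" where
  "has_max r \<longleftrightarrow> Above r (Field r) \<noteq> {}"

definition has_min :: "'a rel \<Rightarrow> bool" where
  "has_min r \<longleftrightarrow> Under r (Field r) \<noteq> {}"

definition lots_complete :: "'a rel \<Rightarrow> bool" where
  "lots_complete r \<longleftrightarrow>
     (\<forall>A \<subseteq> Field r. A \<noteq> {} \<and> lots_bounded r A \<longrightarrow> (\<exists>s. is_sup r A s) \<and> (\<exists>i. is_inf r A i))"

definition order_dense :: "'a rel \<Rightarrow> bool" where
  "order_dense r \<longleftrightarrow>
     (\<forall>a b. (a, b) \<in> r \<and> a \<noteq> b \<longrightarrow> (\<exists>c. (a, c) \<in> r \<and> (c, b) \<in> r \<and> c \<noteq> a \<and> c \<noteq> b))"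

definition order_injection :: "'a rel \<Rightarrow> 'b rel \<Rightarrow> ('a \<Rightarrow> 'b) \<Rightarrow> bool" where
  "order_injection r s f \<longleftrightarrow> compat r s f \<and> inj_on f (Field r)"

definition injects_into :: "'a rel \<Rightarrow> 'b rel \<Rightarrow> bool" where
  "injects_into r s \<longleftrightarrow> (\<exists>f. order_injection r s f)"

definition order_isomorphic :: "'a rel \<Rightarrow> 'b rel \<Rightarrow> bool" where
  "order_isomorphic r s \<longleftrightarrow> (\<exists>f. compat r s f \<and> bij_betw f (Field r) (Field s))"

definition bigger :: "'b rel \<Rightarrow> 'a rel \<Rightarrow> bool" where
  "bigger s r \<longleftrightarrow> injects_into r s \<and> \<not> injects_into s r"

definition HLOTS :: "'a rel \<Rightarrow> bool" where
  "HLOTS r \<longleftrightarrow> lots r \<and>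
     (\<exists>a\<in>Field r. \<exists>b\<in>Field r. \<exists>c\<in>Field r. a \<noteq> b \<and> a \<noteq> c \<and> b \<noteq> c) \<and>
     (\<forall>C. openin (lots_topology r) C \<and> lots_convex r C \<and> C \<noteq> {}
        \<longrightarrow> order_isomorphic r (Restr r C))"

definition CHLOTS :: "'a rel \<Rightarrow> bool" where
  "CHLOTS r \<longleftrightarrow> HLOTS r \<and> lots_complete r"

definition IHLOTS :: "'a rel \<Rightarrow> bool" where
  "IHLOTS r \<longleftrightarrow> HLOTS r \<and> \<not> lots_complete r"

text \<open>
  The completion of r is realised by cuts: nonempty lower sets that are bounded above and
  contain their supremum whenever it exists in r. A point a of r corresponds to the cut
  \<^term>\<open>under r a\<close>. The lemma \<open>is_completion_lots_completion\<close> below shows that, for an order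
  dense LOTS, this has the properties characterising the completion up to order isomorphism.
\<close>

definition cuts :: "'a rel \<Rightarrow> 'a set set" where
  "cuts r = {A. A \<subseteq> Field r \<and> A \<noteq> {} \<and> (\<forall>x\<in>A. under r x \<subseteq> A) \<and> Above r A \<noteq> {} \<and>
                (\<forall>s. is_sup r A s \<longrightarrow> s \<in> A)}"

definition lots_completion :: "'a rel \<Rightarrow> 'a set rel" where
  "lots_completion r = {(A, B). A \<in> cuts r \<and> B \<in> cuts r \<and> A \<subseteq> B}"

definition is_completion :: "'a rel \<Rightarrow> 'b rel \<Rightarrow> ('a \<Rightarrow> 'b) \<Rightarrow> bool" where
  "is_completion r s e \<longleftrightarrow> lots s \<and> lots_complete s \<and> order_dense s \<and>
     order_injection r s e \<and>
     lots_topology s closure_of (e ` Field r) = topspace (lots_topology s) \<and>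
     (has_max s \<longleftrightarrow> has_max r) \<and> (has_min s \<longleftrightarrow> has_min r)"

text \<open>
  Ordinals are represented by well-orders, compared by \<open><o\<close>, \<open>\<le>o\<close> and \<^const>\<open>ordIso\<close>. An ordinal
  is positive if its field is nonempty, and an element of the field is positive if it has
  strict predecessors.
\<close>

definition ord_sum :: "'a rel \<Rightarrow> 'b rel \<Rightarrow> ('a + 'b) rel" where
  "ord_sum r s = map_prod Inl Inl ` r \<union> map_prod Inr Inr ` s \<union> (Inl ` Field r) \<times> (Inr ` Field s)"

text \<open>
  Every ordinal below that of the well-order r is represented by an initial segment of r, so
  in the following definition it suffices that s ranges over relations on the same type.
\<close>

definition tail_like :: "'i rel \<Rightarrow> bool" where
  "tail_like r \<longleftrightarrow> Well_order r \<and> Field r \<noteq> {} \<and> (\<forall>s :: 'i rel. s <o r \<longrightarrow> (ord_sum s r, r) \<in> ordIso)"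

definition lex_power :: "'a rel \<Rightarrow> 'i rel \<Rightarrow> ('i \<Rightarrow> 'a) rel" where
  "lex_power X r = {(x, y). x \<in> Field r \<rightarrow>\<^sub>E Field X \<and> y \<in> Field r \<rightarrow>\<^sub>E Field X \<and>
     (x = y \<or> (\<exists>i\<in>Field r. x i \<noteq> y i \<and> (\<forall>j\<in>underS r i. x j = y j) \<and> (x i, y i) \<in> X))}"

text \<open>\<open>tower X p q r\<close> consists of the points of the lexicographic power whose coordinates,
  except the initial one, lie in the closed interval from p to q.\<close>

definition tower :: "'a rel \<Rightarrow> 'a \<Rightarrow> 'a \<Rightarrow> 'i rel \<Rightarrow> ('i \<Rightarrow> 'a) rel" where
  "tower X p q r = Restr (lex_power X r)
     {x. \<forall>i\<in>Field r. underS r i \<noteq> {} \<longrightarrow> x i \<in> lots_interval X p q}"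

definition real_lots :: "real rel" where
  "real_lots = {(x, y). x \<le> y}"

text \<open>Every countable ordinal is represented by a well-order on a subset of \<^typ>\<open>nat\<close>.\<close>

definition R_bounded :: "'a rel \<Rightarrow> bool" where
  "R_bounded r \<longleftrightarrow>
     (\<exists>d :: nat rel. Well_order d \<and> Field d \<noteq> {} \<and> injects_into r (tower real_lots (-1) 1 d))"

lemma topspace_lots_topology: "topspace (lots_topology r) = Field r"
  unfolding lots_topology_def topology_generated_by_topspace
  by (auto simp: underS_def aboveS_def Field_def)

lemma lots_topology_nbhd:
  assumes "lots r" "openin (lots_topology r) U" "x \<in> U"
  shows "\<exists>L R. (L = Field r \<or> (\<exists>a. L = aboveS r a)) \<and> (R = Field r \<or> (\<exists>b. R = underS r b)) \<and>
           x \<in> L \<and> x \<in> R \<and> L \<inter> R \<subseteq> U"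
proof -
  have tr: "trans r" and an: "antisym r" and tot: "Total r" and re: "Refl r"
    using assms(1) by (auto simp: order_on_defs)
  have sub: "aboveS r a \<subseteq> Field r" "underS r a \<subseteq> Field r" for a
    by (auto simp: underS_def aboveS_def Field_def)
  have trans: "(a, c) \<in> r" if "(a, b) \<in> r" "(b, c) \<in> r" for a b c
    using tr that by (rule transD)
  have anti: "a = b" if "(a, b) \<in> r" "(b, a) \<in> r" for a b
    using an that by (rule antisymD)
  have compare: "(a, b) \<in> r \<or> (b, a) \<in> r" if "a \<in> Field r" "b \<in> Field r" for a b
    using that tot re by (cases "a = b") (auto simp: total_on_def refl_on_def)
  have A: "aboveS r a \<inter> aboveS r b \<in> {aboveS r a, aboveS r b}" for a b
  proof (cases "a \<in> Field r \<and> b \<in> Field r")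
    case True
    have "aboveS r b \<subseteq> aboveS r a" if "(a, b) \<in> r" for a b
      using that trans anti unfolding aboveS_def by blast
    then show ?thesis using True compare[of a b] by blast
  next
    case False
    then have "aboveS r a = {} \<or> aboveS r b = {}" by (auto simp: aboveS_def Field_def)
    then show ?thesis by auto
  qed
  have B: "underS r a \<inter> underS r b \<in> {underS r a, underS r b}" for a b
  proof (cases "a \<in> Field r \<and> b \<in> Field r")
    case True
    have "underS r a \<subseteq> underS r b" if "(a, b) \<in> r" for a b
      using that trans anti unfolding underS_def by blast
    then show ?thesis using True compare[of a b] by blast
  next
    case False
    then have "underS r a = {} \<or> underS r b = {}" by (auto simp: underS_def Field_def)
    then show ?thesis by auto
  qed
  define LL where "LL = insert (Field r) (range (aboveS r))"
  define RR where "RR = insert (Field r) (range (underS r))"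
  have LI: "L \<inter> L' \<in> LL" if L: "L \<in> LL" "L' \<in> LL" for L L'
  proof -
    have "L \<subseteq> Field r" "L' \<subseteq> Field r" using L sub unfolding LL_def by auto
    then have "L \<inter> L' = L \<or> L \<inter> L' = L'" using L A unfolding LL_def by blast
    then show ?thesis using L by metis
  qed
  have RI: "L \<inter> L' \<in> RR" if L: "L \<in> RR" "L' \<in> RR" for L L'
  proof -
    have "L \<subseteq> Field r" "L' \<subseteq> Field r" using L sub unfolding RR_def by auto
    then have "L \<inter> L' = L \<or> L \<inter> L' = L'" using L B unfolding RR_def by blast
    then show ?thesis using L by metis
  qed
  have "generate_topology_on ({Field r} \<union> underS r ` Field r \<union> aboveS r ` Field r) U"
    using assms(2) unfolding lots_topology_def openin_topology_generated_by_iff .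
  then have "\<forall>x\<in>U. \<exists>L\<in>LL. \<exists>R\<in>RR. x \<in> L \<and> x \<in> R \<and> L \<inter> R \<subseteq> U"
  proof (induction rule: generate_topology_on.induct)
    case (Int a b)
    show ?case
    proof
      fix x assume "x \<in> a \<inter> b"
      then obtain L R L' R' where *: "L \<in> LL" "R \<in> RR" "x \<in> L" "x \<in> R" "L \<inter> R \<subseteq> a"
        "L' \<in> LL" "R' \<in> RR" "x \<in> L'" "x \<in> R'" "L' \<inter> R' \<subseteq> b"
        using Int.IH by (meson IntD1 IntD2)
      have "L \<inter> L' \<in> LL" "R \<inter> R' \<in> RR" using LI RI * by auto
      moreover have "x \<in> L \<inter> L'" "x \<in> R \<inter> R'" "(L \<inter> L') \<inter> (R \<inter> R') \<subseteq> a \<inter> b" using * by auto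
      ultimately show "\<exists>L\<in>LL. \<exists>R\<in>RR. x \<in> L \<and> x \<in> R \<and> L \<inter> R \<subseteq> a \<inter> b"
        by (intro bexI[of _ "L \<inter> L'"] bexI[of _ "R \<inter> R'"] conjI)
    qed
  next
    case (UN K)
    show ?case
    proof
      fix x assume "x \<in> \<Union>K"
      then obtain k where k: "k \<in> K" "x \<in> k" by blast
      then obtain L R where "L \<in> LL" "R \<in> RR" "x \<in> L" "x \<in> R" "L \<inter> R \<subseteq> k"
        using UN.IH[OF k(1)] by blast
      moreover have "k \<subseteq> \<Union>K" using k by blast
      ultimately show "\<exists>L\<in>LL. \<exists>R\<in>RR. x \<in> L \<and> x \<in> R \<and> L \<inter> R \<subseteq> \<Union>K"
        by (meson order_trans)
    qed
  next
    case (Basis s)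
    show ?case
    proof
      fix x assume x: "x \<in> s"
      then have "s \<subseteq> Field r" using Basis sub by auto
      have "s \<in> LL \<or> s \<in> RR" using Basis by (auto simp: LL_def RR_def)
      moreover have "Field r \<in> LL" "Field r \<in> RR" by (auto simp: LL_def RR_def)
      ultimately show "\<exists>L\<in>LL. \<exists>R\<in>RR. x \<in> L \<and> x \<in> R \<and> L \<inter> R \<subseteq> s"
        using x \<open>s \<subseteq> Field r\<close> by (metis Int_iff Int_lower1 Int_lower2 subsetD)
    qed
  qed auto
  then obtain L R where LR: "L \<in> LL" "R \<in> RR" "x \<in> L" "x \<in> R" "L \<inter> R \<subseteq> U"
    using assms(3) by blast
  show ?thesis
    using LR by (intro exI[of _ L] exI[of _ R]) (auto simp: LL_def RR_def)
qed

lemma is_completion_lots_completion: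
  assumes r: "lots r" and dense: "order_dense r"
  shows "is_completion r (lots_completion r) (under r)"
proof -
  have tr: "\<And>a b c. (a, b) \<in> r \<Longrightarrow> (b, c) \<in> r \<Longrightarrow> (a, c) \<in> r"
    and an: "\<And>a b. (a, b) \<in> r \<Longrightarrow> (b, a) \<in> r \<Longrightarrow> a = b"
    and re: "\<And>a. a \<in> Field r \<Longrightarrow> (a, a) \<in> r"
    using r by (auto simp: order_on_defs refl_on_def dest: transD antisymD)
  have tot: "(a, b) \<in> r \<or> (b, a) \<in> r" if "a \<in> Field r" "b \<in> Field r" for a b
    using that r re by (cases "a = b") (auto simp: order_on_defs total_on_def)
  have fld: "a \<in> Field r" "b \<in> Field r" if "(a, b) \<in> r" for a b
    using that by (auto simp: Field_def)
  have sup_under: "is_sup r (under r a) a" if "a \<in> Field r" for a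
    using that re unfolding is_sup_def Above_def under_def by auto
  have sup_unique: "s = t" if "is_sup r A s" "is_sup r A t" for A s t
    using that an unfolding is_sup_def by blast
  have under_cut: "under r a \<in> cuts r" if "a \<in> Field r" for a
    unfolding cuts_def
  proof (intro CollectI conjI ballI allI impI)
    show "under r a \<subseteq> Field r" using fld unfolding under_def by auto
    show "under r a \<noteq> {}" using re[OF that] unfolding under_def by auto
    show "under r x \<subseteq> under r a" if "x \<in> under r a" for x
      using that tr unfolding under_def by blast
    show "Above r (under r a) \<noteq> {}" using sup_under[OF that] unfolding is_sup_def by auto
    show "s \<in> under r a" if "is_sup r (under r a) s" for s
      using sup_unique[OF that sup_under[OF \<open>a \<in> Field r\<close>]] re[OF \<open>a \<in> Field r\<close>]
      unfolding under_def by auto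
  qed
  have Fld: "Field (lots_completion r) = cuts r"
    unfolding Field_def lots_completion_def by auto
  have cle: "(A, B) \<in> lots_completion r \<longleftrightarrow> A \<in> cuts r \<and> B \<in> cuts r \<and> A \<subseteq> B" for A B
    unfolding lots_completion_def by auto
  have above: "(x, b) \<in> r" if "A \<in> cuts r" "b \<in> Field r" "b \<notin> A" "x \<in> A" for A b x
    using that tot[of x b] unfolding cuts_def under_def by auto
  have lin: "A \<subseteq> B \<or> B \<subseteq> A" if "A \<in> cuts r" "B \<in> cuts r" for A B
  proof (rule ccontr)
    assume "\<not> ?thesis"
    then obtain a b where ab: "a \<in> A" "a \<notin> B" "b \<in> B" "b \<notin> A" by auto
    then have "(a, b) \<in> r" using above[of A b a] that unfolding cuts_def by blast
    with ab that show False unfolding cuts_def under_def by blast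
  qed
  have L: "lots (lots_completion r)"
    unfolding order_on_defs Fld refl_on_def trans_def antisym_def total_on_def
    using lin by (auto simp: cle)
  \<comment> \<open>a point of B outside A is not the supremum of A, so A lies strictly below it\<close>
  have gap: "\<exists>c\<in>Field r. (c, b) \<in> r \<and> c \<noteq> b \<and> (\<forall>x\<in>A. (x, c) \<in> r)"
    if A: "A \<in> cuts r" and b: "b \<in> Field r" "b \<notin> A" for A b
  proof -
    have "b \<in> Above r A" using above[OF A b] b by (auto simp: Above_def)
    moreover have "\<not> is_sup r A b" using A b unfolding cuts_def by auto
    ultimately obtain u where "u \<in> Above r A" "(b, u) \<notin> r" unfolding is_sup_def by auto
    then show ?thesis using tot[of u b] b re unfolding Above_def by blast
  qed
  have D: "order_dense (lots_completion r)"
    unfolding order_dense_def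
  proof (intro allI impI)
    fix A B assume "(A, B) \<in> lots_completion r \<and> A \<noteq> B"
    then have AB: "A \<in> cuts r" "B \<in> cuts r" "A \<subset> B" unfolding cle by auto
    then obtain b where b: "b \<in> B" "b \<notin> A" by auto
    then have bF: "b \<in> Field r" using AB unfolding cuts_def by auto
    obtain c where c: "c \<in> Field r" "(c, b) \<in> r" "c \<noteq> b" "\<forall>x\<in>A. (x, c) \<in> r"
      using gap[OF AB(1) bF b(2)] by blast
    obtain d where d: "(c, d) \<in> r" "(d, b) \<in> r" "d \<noteq> c" "d \<noteq> b"
      using dense c unfolding order_dense_def by metis
    have dF: "d \<in> Field r" using d fld by auto
    have "A \<subseteq> under r d" using c d tr unfolding under_def by blast
    moreover have "d \<notin> A" using c d an by blast
    moreover have "under r d \<subseteq> B"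
      using AB(2) b d tr unfolding cuts_def under_def by blast
    moreover have "b \<notin> under r d" using d an unfolding under_def by blast
    moreover have "d \<in> under r d" using re dF unfolding under_def by auto
    ultimately show "\<exists>C. (A, C) \<in> lots_completion r \<and> (C, B) \<in> lots_completion r \<and> C \<noteq> A \<and> C \<noteq> B"
      using AB under_cut[OF dF] b unfolding cle
      by (intro exI[of _ "under r d"]) auto
  qed
  have C: "lots_complete (lots_completion r)"
    unfolding lots_complete_def Fld
  proof (intro allI impI conjI)
    fix S assume S: "S \<subseteq> cuts r" "S \<noteq> {} \<and> lots_bounded (lots_completion r) S"
    then obtain P Q where PQ: "P \<in> cuts r" "Q \<in> cuts r" "\<And>A. A \<in> S \<Longrightarrow> P \<subseteq> A \<and> A \<subseteq> Q"
    proof -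
      obtain a b where "a \<in> cuts r" "b \<in> cuts r" "S \<subseteq> lots_interval (lots_completion r) a b"
        using S unfolding lots_bounded_def Fld by auto
      then show thesis
        by (intro that[of a b]) (auto simp: lots_interval_def cle)
    qed
    obtain A0 where A0: "A0 \<in> S" using S by auto
    define I where "I = \<Inter>S"
    have I_cut: "I \<in> cuts r"
      unfolding cuts_def
    proof (intro CollectI conjI allI impI)
      show "I \<subseteq> Field r" using A0 S unfolding I_def cuts_def by blast
      show "I \<noteq> {}" using PQ unfolding I_def cuts_def by blast
      show "\<forall>x\<in>I. under r x \<subseteq> I" using S unfolding I_def cuts_def by blast
      have "Above r A0 \<subseteq> Above r I" using A0 unfolding Above_def I_def by auto
      then show "Above r I \<noteq> {}" using A0 S unfolding cuts_def by blast
      fix s assume s: "is_sup r I s"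
      then have sF: "s \<in> Field r" unfolding is_sup_def Above_def by auto
      show "s \<in> I"
        unfolding I_def
      proof
        fix A assume "A \<in> S"
        then have A: "A \<in> cuts r" "I \<subseteq> A" using S unfolding I_def by auto
        show "s \<in> A"
        proof (rule ccontr)
          assume "s \<notin> A"
          then obtain c where c: "c \<in> Field r" "(c, s) \<in> r" "c \<noteq> s" "\<forall>x\<in>A. (x, c) \<in> r"
            using gap[OF A(1) sF] by blast
          then have "c \<in> Above r I" using A(2) unfolding Above_def by auto
          then have "(s, c) \<in> r" using s unfolding is_sup_def by auto
          then show False using c an by blast
        qed
      qed
    qed
    then have "is_inf (lots_completion r) S I"
      using S unfolding is_inf_def Under_def Fld cle I_def by auto
    then show "\<exists>i. is_inf (lots_completion r) S i" by blast
    define T where "T = \<Union>S \<union> {s. is_sup r (\<Union>S) s}"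
    have US: "\<Union>S \<subseteq> Field r" "\<Union>S \<noteq> {}" using A0 S(1) unfolding cuts_def by blast+
    have low: "under r x \<subseteq> \<Union>S" if "x \<in> \<Union>S" for x using that S unfolding cuts_def by blast
    have AbT: "Above r T = Above r (\<Union>S)"
      unfolding T_def Above_def is_sup_def by auto
    have T_cut: "T \<in> cuts r"
      unfolding cuts_def
    proof (intro CollectI conjI allI impI)
      show "T \<subseteq> Field r" using US unfolding T_def is_sup_def Above_def by auto
      show "T \<noteq> {}" using US unfolding T_def by auto
      show "\<forall>x\<in>T. under r x \<subseteq> T"
      proof (intro ballI subsetI)
        fix x y assume x: "x \<in> T" and y: "y \<in> under r x"
        show "y \<in> T"
        proof (cases "x \<in> \<Union>S")
          case True then show ?thesis using low y unfolding T_def by blast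
        next
          case False
          then have x': "is_sup r (\<Union>S) x" using x unfolding T_def by auto
          have yx: "(y, x) \<in> r" using y unfolding under_def by auto
          show ?thesis
          proof (cases "y \<in> \<Union>S")
            case False
            have "y \<in> Above r (\<Union>S)"
              using False low US(1) tot fld(1)[OF yx] unfolding Above_def under_def by blast
            then have "(x, y) \<in> r" using x' unfolding is_sup_def by auto
            then show ?thesis using an yx x by metis
          qed (auto simp: T_def)
        qed
      qed
      have "Above r Q \<subseteq> Above r (\<Union>S)" using PQ(3) unfolding Above_def by blast
      then show "Above r T \<noteq> {}" using PQ(2) unfolding AbT cuts_def by blast
      show "s \<in> T" if "is_sup r T s" for s
      proof -
        have "is_sup r (\<Union>S) s" using that unfolding is_sup_def AbT .
        then show ?thesis unfolding T_def by simp
      qed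
    qed
    have "T \<subseteq> B" if B: "B \<in> cuts r" "\<And>A. A \<in> S \<Longrightarrow> A \<subseteq> B" for B
    proof -
      have "s \<in> B" if s: "is_sup r (\<Union>S) s" for s
      proof (rule ccontr)
        assume "s \<notin> B"
        moreover have "s \<in> Field r" using s unfolding is_sup_def Above_def by auto
        ultimately obtain c where c: "c \<in> Field r" "(c, s) \<in> r" "c \<noteq> s" "\<forall>x\<in>B. (x, c) \<in> r"
          using gap[OF B(1)] by blast
        then have "c \<in> Above r (\<Union>S)" using B(2) unfolding Above_def by auto
        then have "(s, c) \<in> r" using s unfolding is_sup_def by auto
        then show False using c an by blast
      qed
      then show ?thesis using B(2) unfolding T_def by auto
    qed
    then have "is_sup (lots_completion r) S T"
      using S(1) T_cut unfolding is_sup_def Above_def Fld cle by (auto simp: T_def)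
    then show "\<exists>s. is_sup (lots_completion r) S s" by blast
  qed
  have under_mono: "(under r a, under r b) \<in> lots_completion r" if "(a, b) \<in> r" for a b
  proof -
    have "under r a \<subseteq> under r b" using that tr unfolding under_def by blast
    then show ?thesis using that fld under_cut unfolding cle by blast
  qed
  have inj: "inj_on (under r) (Field r)"
    using sup_under sup_unique by (metis inj_onI)
  have E: "order_injection r (lots_completion r) (under r)"
    unfolding order_injection_def compat_def using under_mono inj by blast
  have den: "lots_topology (lots_completion r) closure_of (under r ` Field r)
               = topspace (lots_topology (lots_completion r))"
  proof (rule antisym)
    show "topspace (lots_topology (lots_completion r))
            \<subseteq> lots_topology (lots_completion r) closure_of (under r ` Field r)"
    proof
      fix A assume A: "A \<in> topspace (lots_topology (lots_completion r))"
      then have Ac: "A \<in> cuts r" by (simp add: topspace_lots_topology Fld)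
      show "A \<in> lots_topology (lots_completion r) closure_of (under r ` Field r)"
        unfolding in_closure_of
      proof (intro conjI allI impI)
        fix U assume U: "A \<in> U \<and> openin (lots_topology (lots_completion r)) U"
        show "\<exists>y. y \<in> under r ` Field r \<and> y \<in> U"
        proof (cases "A \<in> under r ` Field r")
          case False
          have AF: "A \<subseteq> Field r" using Ac unfolding cuts_def by auto
          have nomax: "\<exists>y\<in>A. (x, y) \<in> r \<and> x \<noteq> y" if "x \<in> A" for x
          proof (rule ccontr)
            assume "\<not> ?thesis"
            then have "A \<subseteq> under r x" using tot AF that re unfolding under_def by blast
            then have "A = under r x" using Ac that unfolding cuts_def by auto
            then show False using False AF that by auto
          qed
          obtain L R where LR: "L = Field (lots_completion r) \<or> (\<exists>B. L = aboveS (lots_completion r) B)"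
            "R = Field (lots_completion r) \<or> (\<exists>B. R = underS (lots_completion r) B)"
            "A \<in> L" "A \<in> R" "L \<inter> R \<subseteq> U"
            using lots_topology_nbhd[OF L] U by metis
          have down: "under r y \<in> R" if "y \<in> A" for y
          proof -
            have "y \<in> Field r" "under r y \<subseteq> A" using that Ac AF unfolding cuts_def by auto
            moreover have "under r y \<noteq> A" "under r y \<in> cuts r"
              using False under_cut \<open>y \<in> Field r\<close> by auto
            ultimately show ?thesis using LR(2,4) Fld Ac unfolding underS_def cle by (auto simp: cle)
          qed
          have "\<exists>y\<in>A. under r y \<in> L"
            using LR(1)
          proof
            assume "L = Field (lots_completion r)"
            moreover obtain y where "y \<in> A" using Ac unfolding cuts_def by auto
            ultimately show ?thesis using Fld under_cut AF by blast
          next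
            assume "\<exists>B. L = aboveS (lots_completion r) B"
            then obtain B where B: "L = aboveS (lots_completion r) B" by auto
            then have B': "B \<in> cuts r" "B \<subset> A"
              using LR(3) unfolding aboveS_def cle by auto
            then obtain x where x: "x \<in> A" "x \<notin> B" by auto
            obtain y where y: "y \<in> A" "(x, y) \<in> r" "x \<noteq> y" using nomax[OF x(1)] by blast
            have "B \<subseteq> under r y" using above[OF B'(1) _ x(2)] x(1) AF tr y(2)
              unfolding under_def by blast
            moreover have "x \<in> under r y" using y unfolding under_def by auto
            ultimately have "under r y \<in> L"
              using B B'(1) x(2) under_cut y(1) AF unfolding aboveS_def cle by auto
            then show ?thesis using y by auto
          qed
          then show ?thesis using down LR(5) AF by blast
        qed (use U in auto)
      qed (use A in simp)
    qed
  qed (rule closure_of_subset_topspace)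
  have mx: "has_max (lots_completion r) \<longleftrightarrow> has_max r"
  proof
    assume "has_max (lots_completion r)"
    then obtain M where M: "M \<in> cuts r" "\<And>A. A \<in> cuts r \<Longrightarrow> A \<subseteq> M"
      unfolding has_max_def Above_def Fld cle by auto
    then have "Field r \<subseteq> M" using under_cut re unfolding under_def by blast
    then have "M = Field r" using M(1) unfolding cuts_def by auto
    then show "has_max r" using M(1) unfolding has_max_def cuts_def by auto
  next
    assume "has_max r"
    then obtain m where m: "m \<in> Field r" "\<And>x. x \<in> Field r \<Longrightarrow> (x, m) \<in> r"
      unfolding has_max_def Above_def by auto
    then have "A \<subseteq> under r m" if "A \<in> cuts r" for A
      using that unfolding cuts_def under_def by auto
    then show "has_max (lots_completion r)"
      using under_cut[OF m(1)] unfolding has_max_def Above_def Fld cle by blast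
  qed
  have mn: "has_min (lots_completion r) \<longleftrightarrow> has_min r"
  proof
    assume "has_min (lots_completion r)"
    then obtain M where M: "M \<in> cuts r" "\<And>A. A \<in> cuts r \<Longrightarrow> M \<subseteq> A"
      unfolding has_min_def Under_def Fld cle by auto
    obtain m where m: "m \<in> M" "m \<in> Field r" using M(1) unfolding cuts_def by auto
    have "(m, x) \<in> r" if "x \<in> Field r" for x
      using M(2)[OF under_cut[OF that]] m(1) unfolding under_def by auto
    then show "has_min r" using m unfolding has_min_def Under_def by auto
  next
    assume "has_min r"
    then obtain m where m: "m \<in> Field r" "\<And>x. x \<in> Field r \<Longrightarrow> (m, x) \<in> r"
      unfolding has_min_def Under_def by auto
    then have "under r m \<subseteq> A" if "A \<in> cuts r" for A
      using that unfolding cuts_def under_def by blast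
    then show "has_min (lots_completion r)"
      using under_cut[OF m(1)] unfolding has_min_def Under_def Fld cle by blast
  qed
  show ?thesis unfolding is_completion_def using L C D E den mx mn by blast
qed

end

theory Submission
  imports Defs
begin

text \<open>
  Parts (b) and (c) rest on one fact: a linear order \<open>C\<close> in which all suprema exist admits no
  monotone injection of \<open>C \<times> {0, 1}\<close> (ordered lexicographically), by a fixed point argument. If
  \<open>\<beta> < \<alpha>\<close>, then \<open>X\<^sub>\<alpha>\<close> contains \<open>J\<^sup>\<beta> \<times> {0, 1}\<close>, whereas \<open>X\<^sub>\<beta>\<close> embeds into \<open>J\<^sup>\<beta>\<close>, which has all suprema
  when \<open>X\<close> is complete. A homeomorphism of connected orders preserves or reverses the order. If \<open>X\<close>
  injects into \<open>\<real>\<^sub>d\<close>, then \<open>X\<^sub>\<beta>\<close> and its completion inject into the complete order \<open>\<real>\<^sub>d\<^sub>\<beta>\<close>, and conversely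
  \<open>\<real>\<^sub>\<beta>\<close> injects into a tower over \<open>X\<close> of height \<open>\<omega>\<beta>\<close>, because \<open>\<real>\<close> injects into \<open>{0, 1}\<^sup>\<omega>\<close>; for large
  tail-like \<open>\<beta>\<close> one has \<open>\<omega>\<beta> = d\<beta> = \<beta>\<close>, and the fixed point argument applies to a cube over \<open>\<real>\<close>.

  For part (a), the set of points of \<open>X\<^sub>\<alpha>\<close> that are eventually \<open>-1\<close> is dense, and all half-open intervals
  between such points are isomorphic. Every open convex set has countable cofinality and
  coinitiality, so it is a union of a chain of such intervals indexed by the integers.
\<close>

section \<open>Linear orders and isomorphisms\<close>

text \<open>The obstacle in (a) is that \<open>X\<close> need not be isomorphic to its reverse, so a
  cell closed on the left and one closed on the right may have different types. Both occur between
  two points that are eventually \<open>-1\<close>: above the block of the lower point lie cells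
  closed on the right, and the blocks leading up to the higher point are closed on the left. The
  open cell where the two points branch absorbs both, after being cut into a part closed on the
  right, an open part and a part closed on the left. Countability of \<alpha> enters twice:
  concatenations of \<omega> cells, but not of longer families, are used at limit indices, and
  cofinalities in the tower remain countable.

  In (b) the two-point factor is one coordinate of the taller tower, at an index beyond a copy of
  \<beta>. In (c) the fixed point argument cannot run in a cube over the incomplete
  \<open>X\<close>, where suprema are missing. This is why the real line enters, and why heights
  must absorb both the factor that bounds \<open>X\<close> and the factor \<omega> that codes a real
  number.\<close>

definition lt :: "'a rel \<Rightarrow> 'a \<Rightarrow> 'a \<Rightarrow> bool" where
  "lt r a b \<longleftrightarrow> (a, b) \<in> r \<and> a \<noteq> b"

lemma lt_Field: "lt r a b \<Longrightarrow> a \<in> Field r" "lt r a b \<Longrightarrow> b \<in> Field r"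
  by (auto simp: lt_def Field_def)

lemma le_Field: "(a, b) \<in> r \<Longrightarrow> a \<in> Field r" "(a, b) \<in> r \<Longrightarrow> b \<in> Field r"
  by (auto simp: Field_def)

lemma lt_irrefl [simp]: "\<not> lt r a a"
  by (simp add: lt_def)

lemma lt_le: "lt r a b \<Longrightarrow> (a, b) \<in> r"
  by (simp add: lt_def)

lemma lots_refl: "lots r \<Longrightarrow> a \<in> Field r \<Longrightarrow> (a, a) \<in> r"
  by (auto simp: order_on_defs refl_on_def)

lemma lots_trans: "lots r \<Longrightarrow> (a, b) \<in> r \<Longrightarrow> (b, c) \<in> r \<Longrightarrow> (a, c) \<in> r"
  by (auto simp: order_on_defs dest: transD)

lemma lots_antisym: "lots r \<Longrightarrow> (a, b) \<in> r \<Longrightarrow> (b, a) \<in> r \<Longrightarrow> a = b"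
  by (auto simp: order_on_defs dest: antisymD)

lemma lots_total: "lots r \<Longrightarrow> a \<in> Field r \<Longrightarrow> b \<in> Field r \<Longrightarrow> (a, b) \<in> r \<or> (b, a) \<in> r"
  by (cases "a = b") (auto simp: order_on_defs total_on_def refl_on_def)

lemma le_iff_lt: "lots r \<Longrightarrow> (a, b) \<in> r \<longleftrightarrow> lt r a b \<or> a = b \<and> a \<in> Field r"
  by (auto simp: lt_def lots_refl le_Field)

lemma lt_trans: "lots r \<Longrightarrow> lt r a b \<Longrightarrow> lt r b c \<Longrightarrow> lt r a c"
  unfolding lt_def by (metis lots_trans lots_antisym)

lemma lt_le_trans: "lots r \<Longrightarrow> lt r a b \<Longrightarrow> (b, c) \<in> r \<Longrightarrow> lt r a c"
  unfolding lt_def by (metis lots_trans lots_antisym)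

lemma le_lt_trans: "lots r \<Longrightarrow> (a, b) \<in> r \<Longrightarrow> lt r b c \<Longrightarrow> lt r a c"
  unfolding lt_def by (metis lots_trans lots_antisym)

lemma lt_asym: "lots r \<Longrightarrow> lt r a b \<Longrightarrow> \<not> lt r b a"
  unfolding lt_def by (metis lots_antisym)

lemma lt_not_le: "lots r \<Longrightarrow> lt r a b \<Longrightarrow> (b, a) \<notin> r"
  unfolding lt_def by (metis lots_antisym)

lemma lt_cases:
  assumes "lots r" "a \<in> Field r" "b \<in> Field r"
  obtains "lt r a b" | "a = b" | "lt r b a"
  using lots_total[OF assms] by (auto simp: lt_def)

lemma not_le_lt: "lots r \<Longrightarrow> a \<in> Field r \<Longrightarrow> b \<in> Field r \<Longrightarrow> (a, b) \<notin> r \<longleftrightarrow> lt r b a"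
  using lots_total lots_antisym unfolding lt_def by metis

lemma not_lt_le: "lots r \<Longrightarrow> a \<in> Field r \<Longrightarrow> b \<in> Field r \<Longrightarrow> \<not> lt r a b \<longleftrightarrow> (b, a) \<in> r"
  using not_le_lt by metis

lemma lt_underS: "x \<in> underS r a \<longleftrightarrow> lt r x a"
  by (auto simp: underS_def lt_def)

lemma lt_aboveS: "x \<in> aboveS r a \<longleftrightarrow> lt r a x"
  by (auto simp: aboveS_def lt_def)

lemma lt_converse [simp]: "lt (r\<inverse>) a b \<longleftrightarrow> lt r b a"
  by (auto simp: lt_def)

lemma lt_Restr: "lt (Restr r A) a b \<longleftrightarrow> lt r a b \<and> a \<in> A \<and> b \<in> A"
  by (auto simp: lt_def)

lemma lots_converse: "lots r \<Longrightarrow> lots (r\<inverse>)"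
  by (rule linear_order_on_converse[THEN iffD2, of "Field r" r, simplified, unfolded Field_converse[symmetric]] | simp)+

lemma Field_Restr_lots: "lots r \<Longrightarrow> A \<subseteq> Field r \<Longrightarrow> Field (Restr r A) = A"
  using lots_refl unfolding Field_def by fastforce

lemma lots_Restr: "lots r \<Longrightarrow> lots (Restr r A)"
  by (rule Linear_order_Restr)

text \<open>Antisymmetry comes out of transitivity: \<open>a < b < a\<close> would give
  \<open>lt r a a\<close>.\<close>

lemma lots_ltI:
  assumes re: "\<And>a. a \<in> Field r \<Longrightarrow> (a, a) \<in> r"
    and tr: "\<And>a b c. lt r a b \<Longrightarrow> lt r b c \<Longrightarrow> lt r a c"
    and tot: "\<And>a b. a \<in> Field r \<Longrightarrow> b \<in> Field r \<Longrightarrow> a \<noteq> b \<Longrightarrow> lt r a b \<or> lt r b a"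
  shows "lots r"
proof -
  have an: "antisym r"
    by (rule antisymI) (metis lt_def tr)
  have "trans r"
  proof (rule transI)
    fix a b c assume "(a, b) \<in> r" "(b, c) \<in> r"
    then show "(a, c) \<in> r"
      using tr[of a b c] by (cases "a = b"; cases "b = c") (auto simp: lt_def)
  qed
  then show ?thesis
    using an re tot unfolding order_on_defs refl_on_def total_on_def lt_def
    by (auto simp: Field_def)
qed

lemma order_injectionI:
  assumes "lots r" "lots s" "\<And>a. a \<in> Field r \<Longrightarrow> f a \<in> Field s"
    "\<And>a b. lt r a b \<Longrightarrow> lt s (f a) (f b)"
  shows "order_injection r s f"
  unfolding order_injection_def compat_def
proof (intro conjI allI impI inj_onI)
  fix a b assume "(a, b) \<in> r"
  then show "(f a, f b) \<in> s"
    using assms le_iff_lt[of r a b] le_iff_lt[of s] by metis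
next
  fix a b assume "a \<in> Field r" "b \<in> Field r" "f a = f b"
  then show "a = b" using assms lt_cases[of r a b] by (metis lt_irrefl)
qed

lemma order_injectionD:
  assumes "order_injection r s f"
  shows "lt r a b \<Longrightarrow> lt s (f a) (f b)"
    and "(a, b) \<in> r \<Longrightarrow> (f a, f b) \<in> s"
proof -
  show *: "(f a, f b) \<in> s" if "(a, b) \<in> r" for a b
    using assms that unfolding order_injection_def compat_def by auto
  show "lt s (f a) (f b)" if "lt r a b"
    using *[of a b] that assms lt_Field[OF that]
    unfolding lt_def order_injection_def inj_on_def by auto
qed

lemma order_injection_Field:
  "lots r \<Longrightarrow> order_injection r s f \<Longrightarrow> a \<in> Field r \<Longrightarrow> f a \<in> Field s"
  using order_injectionD(2)[of r s f a a] lots_refl[of r a] le_Field by metis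

lemma order_injection_comp:
  assumes "lots r" "order_injection r s f" "order_injection s t g"
  shows "order_injection r t (g \<circ> f)"
  using assms order_injection_Field[OF assms(1,2)]
  unfolding order_injection_def compat_def inj_on_def by (auto simp: comp_def)

lemma injects_into_trans:
  "lots r \<Longrightarrow> injects_into r s \<Longrightarrow> injects_into s t \<Longrightarrow> injects_into r t"
  unfolding injects_into_def using order_injection_comp by metis

text \<open>Between linear orders an increasing surjection is injective with increasing inverse,
  hence an isomorphism. Carriers are plain subsets, so that isomorphic pieces can be glued by taking
  unions.\<close>

definition oiso :: "'a rel \<Rightarrow> 'a set \<Rightarrow> 'b rel \<Rightarrow> 'b set \<Rightarrow> bool" where
  "oiso r A s B \<longleftrightarrow> (\<exists>f. f ` A = B \<and> (\<forall>x\<in>A. \<forall>y\<in>A. lt r x y \<longrightarrow> lt s (f x) (f y)))"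

lemma oiso_refl: "oiso r A r A"
  unfolding oiso_def by (rule exI[of _ id]) auto

lemma oiso_trans: 
  assumes "oiso r A s B" "oiso s B t C" shows "oiso r A t C"
proof -
  obtain f g where f: "f ` A = B" "\<forall>x\<in>A. \<forall>y\<in>A. lt r x y \<longrightarrow> lt s (f x) (f y)"
   and g: "g ` B = C" "\<forall>x\<in>B. \<forall>y\<in>B. lt s x y \<longrightarrow> lt t (g x) (g y)"
    using assms unfolding oiso_def by metis
  show ?thesis unfolding oiso_def
    by (rule exI[of _ "g \<circ> f"]) (use f g in \<open>auto simp: image_iff\<close>)
qed

lemma oiso_sym:
  assumes "lots r" "lots s" "A \<subseteq> Field r" "oiso r A s B" shows "oiso s B r A"
proof -
  obtain f where f: "f ` A = B" "\<And>x y. x\<in>A \<Longrightarrow> y\<in>A \<Longrightarrow> lt r x y \<Longrightarrow> lt s (f x) (f y)"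
    using assms unfolding oiso_def by metis
  have inj: "inj_on f A"
    using f(2) assms(1,3) by (metis inj_onI lt_cases lt_irrefl subsetD)
  show ?thesis unfolding oiso_def
  proof (intro exI[of _ "inv_into A f"] conjI ballI impI)
    show "inv_into A f ` B = A" using inj f(1) by force
    fix x y assume xy: "x \<in> B" "y \<in> B" "lt s x y"
    then obtain a b where ab: "a \<in> A" "b \<in> A" "x = f a" "y = f b" using f(1) by auto
    then have "lt r a b" 
      using f(2)[of b a] xy(3) assms(1,2,3) by (metis lt_asym lt_cases lt_irrefl subsetD)
    then show "lt r (inv_into A f x) (inv_into A f y)" using ab inj by simp
  qed
qed

lemma order_isomorphic_oiso:
  assumes "lots r" "lots s" "C \<subseteq> Field s"
  shows "order_isomorphic r (Restr s C) \<longleftrightarrow> oiso r (Field r) s C"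
proof
  assume "order_isomorphic r (Restr s C)"
  then obtain f where f: "compat r (Restr s C) f" "bij_betw f (Field r) C"
    unfolding order_isomorphic_def Field_Restr_lots[OF assms(2,3)] by auto
  then have "order_injection r (Restr s C) f"
    unfolding order_injection_def by (auto simp: bij_betw_def)
  note * = order_injectionD[OF this]
  show "oiso r (Field r) s C"
    unfolding oiso_def using f(2) *(1) by (intro exI[of _ f]) (auto simp: bij_betw_def lt_Restr)
next
  assume "oiso r (Field r) s C"
  then obtain f where f: "f ` Field r = C" "\<And>x y. lt r x y \<Longrightarrow> lt s (f x) (f y)"
    unfolding oiso_def using lt_Field by metis
  then have "order_injection r (Restr s C) f"
    by (intro order_injectionI assms lots_Restr)
      (auto simp: Field_Restr_lots[OF assms(2,3)] lt_Restr lt_Field)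
  then show "order_isomorphic r (Restr s C)"
    unfolding order_isomorphic_def order_injection_def Field_Restr_lots[OF assms(2,3)]
    using f by (auto simp: bij_betw_def)
qed

text \<open>Pieces with different indices are strictly separated, hence disjoint: each point
  determines its piece, and a piecewise map is well defined. The common index order settles
  comparisons across pieces.\<close>

lemma oiso_UN:
  fixes E :: "'i::linorder \<Rightarrow> 'a set" and F :: "'i \<Rightarrow> 'b set"
  assumes "lots r"
    and E: "\<And>i j x y. i \<in> I \<Longrightarrow> j \<in> I \<Longrightarrow> i < j \<Longrightarrow> x \<in> E i \<Longrightarrow> y \<in> E j \<Longrightarrow> lt r x y"
    and F: "\<And>i j x y. i \<in> I \<Longrightarrow> j \<in> I \<Longrightarrow> i < j \<Longrightarrow> x \<in> F i \<Longrightarrow> y \<in> F j \<Longrightarrow> lt s x y"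
    and EF: "\<And>i. i \<in> I \<Longrightarrow> oiso r (E i) s (F i)"
  shows "oiso r (\<Union>i\<in>I. E i) s (\<Union>i\<in>I. F i)"
proof -
  obtain f where f: "\<And>i. i \<in> I \<Longrightarrow> f i ` E i = F i"
    "\<And>i x y. i \<in> I \<Longrightarrow> x\<in>E i \<Longrightarrow> y\<in>E i \<Longrightarrow> lt r x y \<Longrightarrow> lt s (f i x) (f i y)"
    using EF unfolding oiso_def by metis
  define \<pi> where "\<pi> x = (SOME i. i \<in> I \<and> x \<in> E i)" for x
  have \<pi>: "\<pi> x = i" if "i \<in> I" "x \<in> E i" for i x
  proof -
    have "\<pi> x \<in> I \<and> x \<in> E (\<pi> x)" unfolding \<pi>_def using that by (rule someI[where x=i, OF conjI])
    then show ?thesis using E[of i "\<pi> x" x x] E[of "\<pi> x" i x x] that lt_irrefl by (metis neq_iff)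
  qed
  define g where "g x = f (\<pi> x) x" for x
  have g: "g x = f i x" if "i \<in> I" "x \<in> E i" for x i using \<pi>[OF that] by (simp add: g_def)
  show ?thesis unfolding oiso_def
  proof (intro exI[of _ g] conjI ballI impI)
    have "g ` E i = F i" if "i \<in> I" for i using f(1)[OF that] g[OF that] by (metis image_cong)
    then show "g ` (\<Union>i\<in>I. E i) = (\<Union>i\<in>I. F i)" by (simp add: image_UN)
    fix x y assume xy: "x \<in> (\<Union>i\<in>I. E i)" "y \<in> (\<Union>i\<in>I. E i)" "lt r x y"
    then obtain i j where ij: "i \<in> I" "j \<in> I" "x \<in> E i" "y \<in> E j" by auto
    consider "i < j" | "i = j" | "j < i" by fastforce
    then show "lt s (g x) (g y)"
    proof cases
      case 1
      then show ?thesis using F[of i j] ij f(1) g by (metis imageI)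
    next
      case 2
      then show ?thesis using f(2) ij g xy(3) by metis
    next
      case 3
      then show ?thesis using E[of j i y x] ij xy(3) lt_asym[OF assms(1)] by metis
    qed
  qed
qed

lemma oiso_Un:
  assumes "lots r" "\<And>x y. x \<in> A \<Longrightarrow> y \<in> A' \<Longrightarrow> lt r x y" "\<And>x y. x \<in> B \<Longrightarrow> y \<in> B' \<Longrightarrow> lt s x y"
    "oiso r A s B" "oiso r A' s B'"
  shows "oiso r (A \<union> A') s (B \<union> B')"
proof -
  \<comment> \<open>Two pieces indexed by the booleans; \<open>False < True\<close> puts
    \<open>A\<close> and \<open>B\<close> first.\<close>
  have "oiso r (\<Union>i\<in>UNIV. if i then A' else A) s (\<Union>i\<in>UNIV. if i then B' else B)"
    using assms by (intro oiso_UN) (auto split: if_splits)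
  then show ?thesis by (simp add: UNIV_bool Un_commute)
qed

lemma oiso_converse: "oiso (r\<inverse>) A (s\<inverse>) B \<longleftrightarrow> oiso r A s B"
  unfolding oiso_def by auto

section \<open>Order topology and homogeneous orders\<close>

text \<open>Reversing the order swaps the two kinds of rays. Downward versions of one-sided
  arguments are obtained in this way from the upward ones.\<close>

lemma lots_topology_converse: "lots_topology (r\<inverse>) = lots_topology r"
proof -
  have "underS (r\<inverse>) = aboveS r" "aboveS (r\<inverse>) = underS r"
    by (auto simp: underS_def aboveS_def)
  then show ?thesis
    unfolding lots_topology_def by (simp add: Un_commute Un_left_commute)
qed

lemma order_dense_lt: "order_dense r \<longleftrightarrow> (\<forall>a b. lt r a b \<longrightarrow> (\<exists>c. lt r a c \<and> lt r c b))"
  unfolding order_dense_def lt_def by metis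

lemma order_denseE:
  assumes "order_dense r" "lt r a b" obtains c where "lt r a c" "lt r c b"
  using assms order_dense_lt by metis

lemma order_dense_converse: "order_dense (r\<inverse>) \<longleftrightarrow> order_dense r"
  unfolding order_dense_lt by auto

lemma openin_underS: "a \<in> Field r \<Longrightarrow> openin (lots_topology r) (underS r a)"
  unfolding lots_topology_def by (rule topology_generated_by_Basis) auto

lemma openin_aboveS: "a \<in> Field r \<Longrightarrow> openin (lots_topology r) (aboveS r a)"
  unfolding lots_topology_def by (rule topology_generated_by_Basis) auto

text \<open>The set contains everything from \<open>x\<close> up to some \<open>w\<close> not beyond
  \<open>z\<close>; density supplies a point strictly between \<open>x\<close> and
  \<open>w\<close>.\<close>

lemma open_right:
  assumes r: "lots r" "order_dense r" and C: "openin (lots_topology r) C" "x \<in> C" "lt r x z"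
  shows "\<exists>y\<in>C. lt r x y \<and> lt r y z"
proof -
  obtain L R where LR: "L = Field r \<or> (\<exists>a. L = aboveS r a)" "R = Field r \<or> (\<exists>b. R = underS r b)"
    "x \<in> L" "x \<in> R" "L \<inter> R \<subseteq> C"
    using lots_topology_nbhd[OF r(1) C(1,2)] by metis
  have "\<exists>w. lt r x w \<and> (w, z) \<in> r \<and> (\<forall>y. lt r y w \<longrightarrow> y \<in> R)"
    using LR(2)
  proof
    assume "R = Field r"
    then show ?thesis using C(3) lt_Field lots_refl[OF r(1)] by metis
  next
    assume "\<exists>b. R = underS r b"
    then obtain b where b: "R = underS r b" by auto
    then have xb: "lt r x b" using LR(4) by (simp add: lt_underS)
    show ?thesis
    proof (cases "(z, b) \<in> r")
      case True
      then show ?thesis using b C(3) lt_le_trans[OF r(1)] lots_refl[OF r(1)] lt_Field lt_underS by metis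
    next
      case False
      then have "(b, z) \<in> r" using lots_total[OF r(1)] xb C(3) lt_Field by metis
      then show ?thesis using b xb lt_underS by metis
    qed
  qed
  then obtain w where w: "lt r x w" "(w, z) \<in> r" "\<And>y. lt r y w \<Longrightarrow> y \<in> R" by auto
  obtain y where y: "lt r x y" "lt r y w" using order_denseE[OF r(2) w(1)] .
  have "y \<in> L" using LR(1)
  proof
    assume "\<exists>a. L = aboveS r a"
    then show ?thesis using LR(3) y(1) lt_trans[OF r(1)] lt_aboveS by metis
  qed (use y lt_Field in metis)
  then show ?thesis using w y LR(5) lt_le_trans[OF r(1)] by blast
qed

lemma open_left:
  assumes r: "lots r" "order_dense r" and C: "openin (lots_topology r) C" "x \<in> C" "lt r z x"
  shows "\<exists>y\<in>C. lt r z y \<and> lt r y x"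
  using open_right[of "r\<inverse>" C x z] assms
  by (auto simp: lots_converse order_dense_converse lots_topology_converse)

lemma lots_convex_lt:
  "lots_convex r C \<Longrightarrow> a \<in> C \<Longrightarrow> b \<in> C \<Longrightarrow> lt r a x \<Longrightarrow> lt r x b \<Longrightarrow> x \<in> C"
  unfolding lots_convex_def lots_interval_def lt_def by auto

lemma lots_convexI:
  assumes "lots r" "C \<subseteq> Field r" "\<And>a b x. a \<in> C \<Longrightarrow> b \<in> C \<Longrightarrow> lt r a x \<Longrightarrow> lt r x b \<Longrightarrow> x \<in> C"
  shows "lots_convex r C"
  unfolding lots_convex_def
proof (intro conjI ballI subsetI)
  fix a b x assume *: "a \<in> C" "b \<in> C" "x \<in> lots_interval r a b"
  then have "lt r a x \<or> x = a" "lt r x b \<or> x = b"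
    by (auto simp: lots_interval_def lt_def)
  then show "x \<in> C" using assms(3)[OF *(1,2)] *(1,2) by blast
qed (use assms(2) in blast)

lemma lots_convex_converse: "lots_convex (r\<inverse>) C \<longleftrightarrow> lots_convex r C"
proof -
  have "lots_interval (r\<inverse>) a b = lots_interval r b a" for a b
    by (auto simp: lots_interval_def)
  then show ?thesis unfolding lots_convex_def by simp blast
qed

lemma HLOTS_lots: "HLOTS r \<Longrightarrow> lots r"
  by (simp add: HLOTS_def)

lemma HLOTS_oiso:
  assumes "HLOTS r" "openin (lots_topology r) C" "lots_convex r C" "C \<noteq> {}"
  shows "oiso r (Field r) r C"
proof -
  have "C \<subseteq> Field r" using assms(3) by (simp add: lots_convex_def)
  moreover have "order_isomorphic r (Restr r C)" using assms unfolding HLOTS_def by blast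
  ultimately show ?thesis using order_isomorphic_oiso[OF HLOTS_lots HLOTS_lots] assms(1) by blast
qed

lemma HLOTS_iff:
  "HLOTS r \<longleftrightarrow> lots r \<and>
     (\<exists>a\<in>Field r. \<exists>b\<in>Field r. \<exists>c\<in>Field r. a \<noteq> b \<and> a \<noteq> c \<and> b \<noteq> c) \<and>
     (\<forall>C. openin (lots_topology r) C \<and> lots_convex r C \<and> C \<noteq> {} \<longrightarrow> oiso r (Field r) r C)"
proof (cases "lots r")
  case True
  have "order_isomorphic r (Restr r C) \<longleftrightarrow> oiso r (Field r) r C" if "lots_convex r C" for C
    using order_isomorphic_oiso[OF True True] that by (simp add: lots_convex_def)
  then have "(openin (lots_topology r) C \<and> lots_convex r C \<and> C \<noteq> {} \<longrightarrow> order_isomorphic r (Restr r C))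
    \<longleftrightarrow> (openin (lots_topology r) C \<and> lots_convex r C \<and> C \<noteq> {} \<longrightarrow> oiso r (Field r) r C)" for C
    by blast
  then show ?thesis unfolding HLOTS_def by simp
qed (simp add: HLOTS_def)

lemma HLOTS_converse: "HLOTS r \<Longrightarrow> HLOTS (r\<inverse>)"
  unfolding HLOTS_iff
  by (simp add: lots_topology_converse lots_convex_converse oiso_converse lots_converse)

lemma underS_convex: "lots r \<Longrightarrow> lots_convex r (underS r a)"
  by (intro lots_convexI) (auto simp: lt_underS lt_Field dest: lt_trans)

lemma aboveS_convex: "lots r \<Longrightarrow> lots_convex r (aboveS r a)"
  by (intro lots_convexI) (auto simp: lt_aboveS lt_Field dest: lt_trans)

lemma HLOTS_no_max_transfer:
  assumes "HLOTS r" "openin (lots_topology r) C" "lots_convex r C" "m \<in> C" "\<And>x. x \<in> C \<Longrightarrow> (x, m) \<in> r"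
  shows "\<exists>m'\<in>Field r. \<forall>x\<in>Field r. (x, m') \<in> r"
proof -
  note r = HLOTS_lots[OF assms(1)]
  have "C \<subseteq> Field r" using assms(3) by (simp add: lots_convex_def)
  then have "oiso r C r (Field r)" using HLOTS_oiso[OF assms(1-3)] assms(4) oiso_sym[OF r r] by blast
  then obtain f where f: "f ` C = Field r" "\<And>x y. x \<in> C \<Longrightarrow> y \<in> C \<Longrightarrow> lt r x y \<Longrightarrow> lt r (f x) (f y)"
    unfolding oiso_def by metis
  show ?thesis
  proof (intro bexI[of _ "f m"] ballI)
    fix y assume "y \<in> Field r"
    then obtain x where x: "x \<in> C" "y = f x" using f(1) by auto
    then show "(y, f m) \<in> r" using f(2)[of x m] assms(4,5) le_iff_lt[OF r] \<open>y \<in> Field r\<close> by metis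
  qed (use f(1) assms(4) in auto)
qed

text \<open>A maximum \<open>x\<close> would pass to the open initial segment below
  \<open>x\<close>, giving it a maximum \<open>m\<close>. Nothing lies between \<open>m\<close> and
  \<open>x\<close> then, so \<open>{x}\<close> is open and convex, and by homogeneity the whole
  order would be a single point.\<close>

lemma HLOTS_no_max:
  assumes "HLOTS r" "x \<in> Field r" shows "\<exists>y. lt r x y"
proof (rule ccontr)
  note r = HLOTS_lots[OF assms(1)]
  assume "\<not> ?thesis"
  then have x: "(y, x) \<in> r" if "y \<in> Field r" for y using lt_cases[OF r assms(2) that] lots_refl[OF r] lt_le that by metis
  obtain a b where ab: "a \<in> Field r" "b \<in> Field r" "a \<noteq> b" using assms(1) unfolding HLOTS_def by blast
  then obtain c where c: "lt r c x" using x unfolding lt_def by metis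
  have "oiso r (Field r) r (underS r x)"
    using HLOTS_oiso[OF assms(1) openin_underS[OF assms(2)] underS_convex[OF r]] c lt_underS[of c r x] by auto
  then obtain f where f: "f ` Field r = underS r x" "\<And>a b. lt r a b \<Longrightarrow> lt r (f a) (f b)"
    unfolding oiso_def using lt_Field by metis
  define m where "m = f x"
  have m: "lt r m x" using f(1) assms(2) lt_underS[of m r x] unfolding m_def by auto
  have max: "(z, m) \<in> r" if z: "lt r z x" for z
  proof -
    obtain y where y: "y \<in> Field r" "z = f y" using z f(1) lt_underS[of z r x] by (metis imageE)
    then show ?thesis using f(2)[of y x] x[OF y(1)] le_iff_lt[OF r] lt_Field(1)[OF z] unfolding m_def by metis
  qed
  have "aboveS r m = {x}"
  proof (intro equalityI subsetI)
    fix y assume "y \<in> aboveS r m"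
    then have y: "lt r m y" by (simp add: lt_aboveS)
    have "\<not> lt r y x" using max[of y] lt_not_le[OF r y] by blast
    moreover have "(y, x) \<in> r" using x lt_Field(2)[OF y] by blast
    ultimately show "y \<in> {x}" unfolding lt_def by blast
  qed (use m in \<open>simp add: lt_aboveS\<close>)
  then have "oiso r (Field r) r {x}"
    using HLOTS_oiso[OF assms(1) openin_aboveS aboveS_convex[OF r], of m] m lt_Field(1)[OF m] by auto
  then obtain g where g: "g ` Field r = {x}" "\<And>a b. lt r a b \<Longrightarrow> lt r (g a) (g b)"
    unfolding oiso_def using lt_Field by metis
  then show False using m g(2)[OF m] lt_Field[OF m] by (metis imageI lt_irrefl singletonD)
qed

lemma HLOTS_no_min:
  assumes "HLOTS r" "x \<in> Field r" shows "\<exists>y. lt r y x"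
  using HLOTS_no_max[OF HLOTS_converse[OF assms(1)]] assms(2) by auto

text \<open>In a jump \<open>a < b\<close> the point \<open>a\<close> is the maximum of the open
  convex set below \<open>b\<close>; by homogeneity the whole order would have a maximum.\<close>

lemma HLOTS_dense:
  assumes "HLOTS r" shows "order_dense r"
  unfolding order_dense_lt
proof (intro allI impI, rule ccontr)
  note r = HLOTS_lots[OF assms]
  fix a b assume ab: "lt r a b" and no: "\<not> (\<exists>c. lt r a c \<and> lt r c b)"
  have le: "(x, a) \<in> r" if "x \<in> underS r b" for x
  proof -
    have x: "lt r x b" using that by (simp add: lt_underS)
    then have "\<not> lt r a x" using no by blast
    then show ?thesis using not_lt_le[OF r lt_Field(1)[OF ab] lt_Field(1)[OF x]] by blast
  qed
  have "a \<in> underS r b" using ab by (simp add: lt_underS)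
  from HLOTS_no_max_transfer[OF assms openin_underS[OF lt_Field(2)[OF ab]] underS_convex[OF r] this le]
  obtain m where m: "m\<in>Field r" "\<forall>x\<in>Field r. (x, m) \<in> r" by blast
  then obtain y where y: "lt r m y" using HLOTS_no_max[OF assms] by blast
  then show False using m(2) lt_not_le[OF r y] lt_Field(2)[OF y] by blast
qed

text \<open>Equivalently, there is no strictly increasing sequence of length \<omega>1. Asking it of
  all subsets gives a condition that passes to lexicographic products.\<close>

definition ccof :: "'a rel \<Rightarrow> bool" where
  "ccof r \<longleftrightarrow> (\<forall>A \<subseteq> Field r. \<exists>B \<subseteq> A. countable B \<and> (\<forall>a\<in>A. \<exists>b\<in>B. (a, b) \<in> r))"

lemma lt_chain:
  assumes "lots r" "\<And>n. lt r (x n) (x (Suc n))" "m < n"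
  shows "lt r (x m) (x n)"
  using assms(3)
proof (induction rule: less_Suc_induct)
  case (1 i)
  show ?case by (rule assms(2))
next
  case (2 i j k)
  show ?case by (rule lt_trans[OF assms(1) 2(3,4)])
qed

lemma cofinal_seq:
  assumes r: "lots r" and A: "A \<subseteq> Field r" "\<And>a. a \<in> A \<Longrightarrow> \<exists>b\<in>A. lt r a b" "a0 \<in> A"
    and B: "B \<subseteq> A" "countable B" "\<And>a. a \<in> A \<Longrightarrow> \<exists>b\<in>B. (a, b) \<in> r"
  obtains x :: "nat \<Rightarrow> 'a" where "x 0 = a0" "\<And>n. x n \<in> A" "\<And>n. lt r (x n) (x (Suc n))"
    "\<And>a. a \<in> A \<Longrightarrow> \<exists>n. lt r a (x n)"
proof -
  have ne: "B \<noteq> {}" using A(3) B(3) by auto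
  define b where "b = from_nat_into B"
  have b: "b n \<in> B" for n using from_nat_into[OF ne] unfolding b_def .
  \<comment> \<open>Each term is chosen above its predecessor and above the matching element of an
    enumeration of \<open>B\<close>, which makes the sequence cofinal; the guard on
    \<open>n = 0\<close> fixes the starting point.\<close>
  have "\<exists>f. \<forall>n. (f n \<in> A \<and> (n = 0 \<longrightarrow> f n = a0)) \<and> (lt r (f n) (f (Suc n)) \<and> lt r (b n) (f (Suc n)))"
  proof (rule dependent_nat_choice)
    fix y and n :: nat assume "y \<in> A \<and> (n = 0 \<longrightarrow> y = a0)"
    then have y: "y \<in> A" by simp
    have bn: "b n \<in> A" using b B(1) by auto
    have "\<exists>m\<in>A. (y, m) \<in> r \<and> (b n, m) \<in> r"
      using lots_total[OF r, of y "b n"] lots_refl[OF r] y bn A(1) by blast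
    then obtain m where m: "m \<in> A" "(y, m) \<in> r" "(b n, m) \<in> r" by auto
    obtain z where "z \<in> A" "lt r m z" using A(2)[OF m(1)] by auto
    then show "\<exists>z. (z \<in> A \<and> (Suc n = 0 \<longrightarrow> z = a0)) \<and> lt r y z \<and> lt r (b n) z"
      using m le_lt_trans[OF r] by blast
  qed (use A(3) in auto)
  then obtain f where f: "\<And>n. f n \<in> A" "f 0 = a0" "\<And>n. lt r (f n) (f (Suc n))" "\<And>n. lt r (b n) (f (Suc n))"
    by metis
  show ?thesis
  proof (rule that[of f])
    fix a assume "a \<in> A"
    then obtain c where c: "c \<in> B" "(a, c) \<in> r" using B(3) by auto
    then obtain n where "c = b n" using from_nat_into_surj[OF B(2)] unfolding b_def by metis
    then show "\<exists>n. lt r a (f n)" using f(4) c le_lt_trans[OF r] by metis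
  qed (use f in auto)
qed

lemma ccof_seq:
  assumes "lots r" "ccof r" "A \<subseteq> Field r" "\<And>a. a \<in> A \<Longrightarrow> \<exists>b\<in>A. lt r a b" "a0 \<in> A"
  obtains x :: "nat \<Rightarrow> 'a" where "x 0 = a0" "\<And>n. x n \<in> A" "\<And>n. lt r (x n) (x (Suc n))"
    "\<And>a. a \<in> A \<Longrightarrow> \<exists>n. lt r a (x n)"
proof -
  obtain B where "B \<subseteq> A" "countable B" "\<forall>a\<in>A. \<exists>b\<in>B. (a, b) \<in> r"
    using assms(2,3) unfolding ccof_def by metis
  then show ?thesis using cofinal_seq[OF assms(1,3,4,5), of B thesis] that by blast
qed

lemma openin_UN_underS:
  assumes "A \<subseteq> Field r" shows "openin (lots_topology r) (\<Union>a\<in>A. underS r a)"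
  by (rule openin_Union) (use assms in \<open>auto intro!: openin_underS\<close>)

lemma UN_underS_convex:
  assumes "lots r" shows "lots_convex r (\<Union>a\<in>A. underS r a)"
proof (rule lots_convexI[OF assms])
  show "(\<Union>a\<in>A. underS r a) \<subseteq> Field r" by (auto simp: lt_underS lt_Field(1))
  fix x y z assume "y \<in> (\<Union>a\<in>A. underS r a)" "lt r z y"
  then show "z \<in> (\<Union>a\<in>A. underS r a)" using lt_trans[OF assms] unfolding UN_iff lt_underS by blast
qed

text \<open>An increasing sequence generates an open convex set of countable cofinality, so by
  homogeneity every open convex set has countable cofinality.\<close>

lemma HLOTS_ccof:
  assumes "HLOTS r" shows "ccof r"
  unfolding ccof_def
proof (intro allI impI)
  fix A assume A: "A \<subseteq> Field r"
  note r = HLOTS_lots[OF assms]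
  obtain a0 where "a0 \<in> Field r" using assms unfolding HLOTS_def by auto
  have "\<exists>f::nat\<Rightarrow>_. \<forall>n. f n \<in> Field r \<and> lt r (f n) (f (Suc n))"
  proof (rule dependent_nat_choice)
    show "\<exists>x. x \<in> Field r" using \<open>a0 \<in> Field r\<close> by blast
    fix x and n :: nat assume "x \<in> Field r"
    then obtain y where "lt r x y" using HLOTS_no_max[OF assms] by blast
    then show "\<exists>y. y \<in> Field r \<and> lt r x y" using lt_Field(2)[of r x y] by blast
  qed
  then obtain u :: "nat \<Rightarrow> _" where u': "\<forall>n. u n \<in> Field r \<and> lt r (u n) (u (Suc n))" ..
  have u: "u n \<in> Field r" "lt r (u n) (u (Suc n))" for n using u' by blast+
  define U where "U = (\<Union>a\<in>range u. underS r a)"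
  have "u 0 \<in> U" unfolding U_def using u(2)[of 0] by (auto simp: lt_underS)
  then have U: "oiso r U r (Field r)"
    using HLOTS_oiso[OF assms] openin_UN_underS[of "range u" r] UN_underS_convex[OF r] u(1) oiso_sym[OF r r]
    unfolding U_def by blast
  then obtain f where f: "f ` U = Field r" "\<And>x y. x \<in> U \<Longrightarrow> y \<in> U \<Longrightarrow> lt r x y \<Longrightarrow> lt r (f x) (f y)"
    unfolding oiso_def by metis
  have uU: "u n \<in> U" for n unfolding U_def using u(2)[of n] by (auto simp: lt_underS)
  define v where "v n = f (u n)" for n
  have v: "\<exists>n. lt r a (v n)" "v n \<in> Field r" if a: "a \<in> Field r" for a n
  proof -
    obtain x where x: "x \<in> U" "a = f x" using f(1) a by auto
    then obtain k where "lt r x (u k)" unfolding U_def by (auto simp: lt_underS)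
    then show "\<exists>n. lt r a (v n)" using f(2) uU x unfolding v_def by blast
    show "v n \<in> Field r" using f(1) uU unfolding v_def by auto
  qed
  show "\<exists>B\<subseteq>A. countable B \<and> (\<forall>a\<in>A. \<exists>b\<in>B. (a, b) \<in> r)"
  proof (cases "\<exists>m\<in>A. \<forall>a\<in>A. (a, m) \<in> r")
    case True
    then obtain m where "m \<in> A" "\<forall>a\<in>A. (a, m) \<in> r" by auto
    then show ?thesis by (intro exI[of _ "{m}"]) auto
  next
    case False
    then have nm: "\<exists>b\<in>A. lt r a b" if "a \<in> A" for a
      using that not_le_lt[OF r] A by blast
    show ?thesis
    proof (cases "A = {}")
      case False
      \<comment> \<open>Without a greatest element, \<open>A\<close> is cofinal in the open initial
        segment \<open>W\<close> that it generates. The copy in \<open>W\<close> of the cofinal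
        sequence \<open>v\<close> is then moved up into \<open>A\<close> term by term.\<close>
      define W where "W = (\<Union>a\<in>A. underS r a)"
      have "A \<subseteq> W" unfolding W_def UN_iff subset_iff lt_underS using nm by blast
      then have "W \<noteq> {}" using False by blast
      then have "oiso r (Field r) r W"
        using HLOTS_oiso[OF assms] openin_UN_underS[OF A] UN_underS_convex[OF r] unfolding W_def by blast
      then obtain g where g: "g ` Field r = W" "\<And>x y. lt r x y \<Longrightarrow> lt r (g x) (g y)"
        unfolding oiso_def using lt_Field by metis
      have "\<exists>a\<in>A. lt r (g (v n)) a" for n
        using g(1) v(2)[OF \<open>a0 \<in> Field r\<close>, of n] unfolding W_def by (force simp: lt_underS)
      then obtain c where c: "\<And>n. c n \<in> A" "\<And>n. lt r (g (v n)) (c n)" by metis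
      have "\<exists>b\<in>range c. (a, b) \<in> r" if aA: "a \<in> A" for a
      proof -
        obtain x where x: "x \<in> Field r" "a = g x" using aA \<open>A \<subseteq> W\<close> g(1) by blast
        then obtain n where "lt r x (v n)" using v(1)[OF x(1)] by blast
        then have "lt r a (c n)" using g(2) c(2) x lt_trans[OF r] by metis
        then show ?thesis using lt_le by (metis rangeI)
      qed
      then show ?thesis using c by (intro exI[of _ "range c"]) auto
    qed auto
  qed
qed

section \<open>Lexicographic products\<close>

lemma wo_lots: "Well_order r \<Longrightarrow> lots r"
  by (simp add: well_order_on_def)

lemma wo_least:
  assumes "Well_order r" "A \<subseteq> Field r" "A \<noteq> {}"
  obtains m where "m \<in> A" "\<And>a. a \<in> A \<Longrightarrow> (m, a) \<in> r"
proof -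
  have "wf (r - Id)" using assms(1) by (simp add: well_order_on_def)
  then obtain m where m: "m \<in> A" "\<And>y. (y, m) \<in> r - Id \<Longrightarrow> y \<notin> A"
    using assms(3) by (metis wfE_min ex_in_conv)
  show ?thesis
  proof (rule that[OF m(1)])
    fix a assume a: "a \<in> A"
    then have "\<not> lt r a m" using m(2)[of a] by (auto simp: lt_def)
    then show "(m, a) \<in> r" using not_lt_le[OF wo_lots[OF assms(1)], of a m] a m(1) assms(2) by blast
  qed
qed

lemma wo_induct [consumes 2, case_names less]:
  assumes "Well_order r" "i \<in> Field r"
    and step: "\<And>i. i \<in> Field r \<Longrightarrow> (\<And>j. lt r j i \<Longrightarrow> P j) \<Longrightarrow> P i"
  shows "P i"
proof -
  have "wf (r - Id)" using assms(1) by (simp add: well_order_on_def)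
  then have "i \<in> Field r \<longrightarrow> P i"
  proof (induction i rule: wf_induct_rule)
    case (less x)
    show ?case
    proof
      assume "x \<in> Field r"
      then show "P x"
        by (rule step) (use less lt_Field in \<open>auto simp: lt_def Field_def\<close>)
    qed
  qed
  then show ?thesis using assms(2) by blast
qed

text \<open>Each index has its own range \<open>S i\<close>, so that towers (first coordinate free,
  the others in an interval) and cubes (all coordinates in the interval) are instances of one
  construction.\<close>

definition lexp :: "'a rel \<Rightarrow> 'i rel \<Rightarrow> ('i \<Rightarrow> 'a set) \<Rightarrow> ('i \<Rightarrow> 'a) rel" where
  "lexp X r S = Restr (lex_power X r) (PiE (Field r) S)"

locale lexprod =
  fixes X :: "'a rel" and r :: "'i rel" and S :: "'i \<Rightarrow> 'a set"
  assumes X: "lots X" and r: "Well_order r" and S: "\<And>i. i \<in> Field r \<Longrightarrow> S i \<subseteq> Field X"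
begin

abbreviation "Y \<equiv> lexp X r S"

lemmas lr = wo_lots[OF r]

lemma PiE_sub: "x \<in> PiE (Field r) S \<Longrightarrow> x \<in> Field r \<rightarrow>\<^sub>E Field X"
  using S by (auto simp: PiE_def Pi_def)

lemma Field_lexp: "Field Y = PiE (Field r) S"
proof -
  have "(x, x) \<in> Y" if "x \<in> PiE (Field r) S" for x
    using that PiE_sub[OF that] unfolding lexp_def lex_power_def by auto
  then show ?thesis unfolding lexp_def Field_def by blast
qed

lemma first_diff:
  assumes "x \<in> PiE (Field r) S" "y \<in> PiE (Field r) S" "x \<noteq> y"
  obtains i where "i \<in> Field r" "x i \<noteq> y i" "\<And>k. lt r k i \<Longrightarrow> x k = y k"
proof -
  have "{i\<in>Field r. x i \<noteq> y i} \<noteq> {}" using assms PiE_ext[OF assms(1,2)] by blast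
  then obtain i where i: "i \<in> {i\<in>Field r. x i \<noteq> y i}" "\<And>a. a \<in> {i\<in>Field r. x i \<noteq> y i} \<Longrightarrow> (i, a) \<in> r"
    using wo_least[OF r, of "{i\<in>Field r. x i \<noteq> y i}"] by blast
  show ?thesis
  proof (rule that[of i])
    fix k assume k: "lt r k i"
    then show "x k = y k" using i(2)[of k] lt_not_le[OF lr k] lt_Field(1)[OF k] by blast
  qed (use i in auto)
qed

lemma lt_lexp:
  "lt Y x y \<longleftrightarrow> x \<in> PiE (Field r) S \<and> y \<in> PiE (Field r) S \<and>
     (\<exists>i\<in>Field r. lt X (x i) (y i) \<and> (\<forall>k. lt r k i \<longrightarrow> x k = y k))"
  (is "?L \<longleftrightarrow> ?R")
proof
  assume ?L
  then show ?R unfolding lexp_def lt_def lex_power_def by (auto simp: underS_def)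
next
  assume R: ?R
  then have "x \<in> Field r \<rightarrow>\<^sub>E Field X" "y \<in> Field r \<rightarrow>\<^sub>E Field X" using PiE_sub by blast+
  with R show ?L unfolding lexp_def lt_def lex_power_def by (fastforce simp: underS_def)
qed

lemma lt_lexpI:
  "\<lbrakk>x \<in> PiE (Field r) S; y \<in> PiE (Field r) S; i \<in> Field r; lt X (x i) (y i); \<And>k. lt r k i \<Longrightarrow> x k = y k\<rbrakk> \<Longrightarrow> lt Y x y"
  unfolding lt_lexp by blast

lemma lt_lexpE:
  assumes "lt Y x y"
  obtains i where "i \<in> Field r" "lt X (x i) (y i)" "\<And>k. lt r k i \<Longrightarrow> x k = y k"
  using assms unfolding lt_lexp by blast

lemma coord: "x \<in> PiE (Field r) S \<Longrightarrow> i \<in> Field r \<Longrightarrow> x i \<in> Field X"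
  using S by (auto simp: PiE_def Pi_def)

lemma lots_lexp: "lots Y"
proof (rule lots_ltI)
  fix a assume "a \<in> Field Y"
  then show "(a, a) \<in> Y"
    using PiE_sub[of a] unfolding Field_lexp unfolding lexp_def lex_power_def by auto
next
  fix x y z assume xy: "lt Y x y" and yz: "lt Y y z"
  have P: "x \<in> PiE (Field r) S" "z \<in> PiE (Field r) S" using xy yz unfolding lt_lexp by blast+
  obtain i where i: "i \<in> Field r" "lt X (x i) (y i)" "\<And>k. lt r k i \<Longrightarrow> x k = y k" by (rule lt_lexpE[OF xy]) blast
  obtain j where j: "j \<in> Field r" "lt X (y j) (z j)" "\<And>k. lt r k j \<Longrightarrow> y k = z k" by (rule lt_lexpE[OF yz]) blast
  consider "lt r i j" | "i = j" | "lt r j i" by (rule lt_cases[OF lr i(1) j(1)])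
  then show "lt Y x z"
  proof cases
    case 1
    show ?thesis
      by (rule lt_lexpI[OF P i(1)]) (use i j 1 lt_trans[OF lr _ 1] in metis)+
  next
    case 2
    show ?thesis
      by (rule lt_lexpI[OF P i(1)]) (use i j 2 lt_trans[OF X] in metis)+
  next
    case 3
    show ?thesis
      by (rule lt_lexpI[OF P j(1)]) (use i j 3 lt_trans[OF lr _ 3] in metis)+
  qed
next
  fix a b assume ab: "a \<in> Field Y" "b \<in> Field Y" "a \<noteq> b"
  then have P: "a \<in> PiE (Field r) S" "b \<in> PiE (Field r) S" by (simp_all add: Field_lexp)
  obtain i where i: "i \<in> Field r" "a i \<noteq> b i" "\<And>k. lt r k i \<Longrightarrow> a k = b k" by (rule first_diff[OF P ab(3)]) blast
  then show "lt Y a b \<or> lt Y b a"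
    using lt_cases[OF X coord[OF P(1) i(1)] coord[OF P(2) i(1)]] lt_lexpI[OF P i(1)] lt_lexpI[OF P(2,1) i(1)] by metis
qed

lemma order_dense_lexp:
  assumes "\<And>i a b. i \<in> Field r \<Longrightarrow> a \<in> S i \<Longrightarrow> b \<in> S i \<Longrightarrow> lt X a b \<Longrightarrow> \<exists>c\<in>S i. lt X a c \<and> lt X c b"
  shows "order_dense Y"
  unfolding order_dense_lt
proof (intro allI impI)
  fix x y assume xy: "lt Y x y"
  then have P: "x \<in> PiE (Field r) S" "y \<in> PiE (Field r) S" unfolding lt_lexp by blast+
  obtain i where i: "i \<in> Field r" "lt X (x i) (y i)" "\<And>k. lt r k i \<Longrightarrow> x k = y k" by (rule lt_lexpE[OF xy]) blast
  obtain c where c: "c \<in> S i" "lt X (x i) c" "lt X c (y i)" using assms[OF i(1) _ _ i(2)] P i(1) by blast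
  define z where "z = x(i := c)"
  have z: "z \<in> PiE (Field r) S" unfolding z_def using P(1) c(1) i(1) by (auto simp: PiE_def Pi_def extensional_def)
  have zk: "z k = x k" if "lt r k i" for k using that unfolding z_def by auto
  have zi: "z i = c" unfolding z_def by simp
  have "lt Y x z" by (rule lt_lexpI[OF P(1) z i(1)]) (simp_all add: zi zk c)
  moreover have "lt Y z y" by (rule lt_lexpI[OF z P(2) i(1)]) (simp_all add: zi zk c i(3))
  ultimately show "\<exists>z. lt Y x z \<and> lt Y z y" by blast
qed

text \<open>Recursion along the well-order, where the value at \<open>i\<close> may depend on the
  members of \<open>A\<close> that agree with all values chosen so far. \<open>H\<close> will pick a
  supremum of coordinates, or a greatest coordinate.\<close>

lemma lex_rec:
  "\<exists>s. s \<in> extensional (Field r) \<and> (\<forall>i\<in>Field r. s i = H i {a\<in>A. \<forall>k. lt r k i \<longrightarrow> a k = s k})"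
proof -
  have wf: "wf (r - Id)" using r by (simp add: well_order_on_def)
  define F where "F s i = H i {a\<in>A. \<forall>k. lt r k i \<longrightarrow> a k = s k}" for s i
  define s where "s = wfrec (r - Id) F"
  have "s i = F s i" for i
  proof -
    have "s i = F (cut s (r - Id) i) i" unfolding s_def by (rule wfrec[OF wf])
    also have "\<dots> = F s i"
      unfolding F_def by (rule arg_cong[where f = "H i"]) (auto simp: cut_def lt_def)
    finally show ?thesis .
  qed
  \<comment> \<open>The value at \<open>i\<close> is computed from indices below \<open>i\<close>,
    all of them in the field, so restricting the function to \<open>Field r\<close> does not affect
    it.\<close>
  moreover have "F (restrict s (Field r)) i = F s i" for i
    unfolding F_def by (rule arg_cong[where f = "H i"]) (use lt_Field(1) in \<open>fastforce\<close>)
  ultimately have "restrict s (Field r) i = F (restrict s (Field r)) i" if "i \<in> Field r" for i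
    using that by simp
  then show ?thesis unfolding F_def
    by (intro exI[of _ "restrict s (Field r)"] conjI ballI restrict_extensional)
qed

text \<open>The supremum is built coordinate by coordinate: the \<open>i\<close>-th one is the supremum of the \<open>i\<close>-th
  coordinates of the members of \<open>A\<close> that agree with it below \<open>i\<close>.\<close>

lemma lex_sup:
  assumes A: "A \<subseteq> PiE (Field r) S"
    and sup: "\<And>i B. i \<in> Field r \<Longrightarrow> B \<subseteq> A \<Longrightarrow> B \<noteq> {} \<Longrightarrow>
       \<exists>m\<in>S i. (\<forall>a\<in>B. (a i, m) \<in> X) \<and> (\<forall>u\<in>S i. (\<forall>a\<in>B. (a i, u) \<in> X) \<longrightarrow> (m, u) \<in> X)"
    and min: "\<And>i. i \<in> Field r \<Longrightarrow> (\<exists>m\<in>S i. \<forall>u\<in>S i. (m, u) \<in> X) \<or> A \<noteq> {} \<and> (\<forall>k. \<not> lt r k i)"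
  shows "\<exists>s. is_sup Y A s"
proof -
  define H where "H i B = (SOME m. m \<in> S i \<and> (\<forall>a\<in>B. (a i, m) \<in> X) \<and>
     (\<forall>u\<in>S i. (\<forall>a\<in>B. (a i, u) \<in> X) \<longrightarrow> (m, u) \<in> X))" for i and B :: "('i \<Rightarrow> 'a) set"
  obtain s where s: "s \<in> extensional (Field r)"
     "\<And>i. i\<in>Field r \<Longrightarrow> s i = H i {a\<in>A. \<forall>k. lt r k i \<longrightarrow> a k = s k}"
    using lex_rec[of H A] by blast
  define B where "B i = {a\<in>A. \<forall>k. lt r k i \<longrightarrow> a k = s k}" for i
  have *: "s i \<in> S i \<and> (\<forall>a\<in>B i. (a i, s i) \<in> X) \<and>
     (\<forall>u\<in>S i. (\<forall>a\<in>B i. (a i, u) \<in> X) \<longrightarrow> (s i, u) \<in> X)" if i: "i \<in> Field r" for i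
  proof -
    have BA: "B i \<subseteq> A" unfolding B_def by blast
    have "\<exists>m. m \<in> S i \<and> (\<forall>a\<in>B i. (a i, m) \<in> X) \<and> (\<forall>u\<in>S i. (\<forall>a\<in>B i. (a i, u) \<in> X) \<longrightarrow> (m, u) \<in> X)"
    proof (cases "B i = {}")
      \<comment> \<open>No member of \<open>A\<close> agrees with \<open>s\<close> so far, so the
        least value of \<open>S i\<close> is taken. At the first index this occurs only if
        \<open>A\<close> is empty, whence the form of the hypothesis on minima.\<close>
      case True
      then have "\<not> (A \<noteq> {} \<and> (\<forall>k. \<not> lt r k i))" unfolding B_def by blast
      then have "\<exists>m\<in>S i. \<forall>u\<in>S i. (m, u) \<in> X" using min[OF i] by blast
      then show ?thesis using True by auto
    next
      case False
      then show ?thesis using sup[OF i BA] by blast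
    qed
    from someI_ex[OF this] show ?thesis
      unfolding s(2)[OF i] B_def[symmetric] by (simp add: H_def)
  qed
  have sP: "s \<in> PiE (Field r) S" using s(1) * by (auto simp: PiE_def)
  have "(a, s) \<in> Y" if a: "a \<in> A" for a
  proof (cases "a = s")
    case True then show ?thesis using sP lots_refl[OF lots_lexp] Field_lexp by simp
  next
    case False
    have aP: "a \<in> PiE (Field r) S" using a A by blast
    obtain i where i: "i \<in> Field r" "a i \<noteq> s i" "\<And>k. lt r k i \<Longrightarrow> a k = s k" by (rule first_diff[OF aP sP False]) blast
    have "a \<in> B i" unfolding B_def using a i by blast
    then have "lt X (a i) (s i)" using *[OF i(1)] i(2) unfolding lt_def by blast
    then show ?thesis using lt_le[OF lt_lexpI[OF aP sP i(1) _ i(3)]] by blast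
  qed
  moreover have "(s, u) \<in> Y" if u: "u \<in> PiE (Field r) S" "\<And>a. a \<in> A \<Longrightarrow> (a, u) \<in> Y" for u
  proof (rule ccontr)
    assume "(s, u) \<notin> Y"
    then have us: "lt Y u s" using not_le_lt[OF lots_lexp] u sP Field_lexp by blast
    obtain i where i: "i \<in> Field r" "lt X (u i) (s i)" "\<And>k. lt r k i \<Longrightarrow> u k = s k" by (rule lt_lexpE[OF us]) blast
    have "u i \<in> S i" using u(1) i(1) by blast
    \<comment> \<open>Being below the supremum \<open>s i\<close>, the value \<open>u i\<close>
      fails to bound the coordinates of \<open>B i\<close>; a member that exceeds it there lies
      above \<open>u\<close>.\<close>
    then obtain a where a: "a \<in> B i" "(a i, u i) \<notin> X" using *[OF i(1)] lt_not_le[OF X i(2)] by blast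
    then have aA: "a \<in> A" "\<And>k. lt r k i \<Longrightarrow> a k = s k" unfolding B_def by auto
    then have aP: "a \<in> PiE (Field r) S" using A by blast
    have ua: "lt X (u i) (a i)" using a(2) not_le_lt[OF X coord[OF aP i(1)] coord[OF u(1) i(1)]] by blast
    have "lt Y u a" by (rule lt_lexpI[OF u(1) aP i(1) ua]) (simp add: i(3) aA(2))
    then show False using u(2)[OF aA(1)] lt_not_le[OF lots_lexp] by blast
  qed
  ultimately have "is_sup Y A s"
    unfolding is_sup_def Above_def using sP Field_lexp by blast
  then show ?thesis by blast
qed

text \<open>\<open>s\<close> follows, wherever there is one, the greatest coordinate among the
  members of \<open>A\<close> that agree with it so far. A member \<open>a\<close> other than
  \<open>s\<close> leaves it at some \<open>i\<close> where \<open>a i\<close> is not greatest, so a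
  countable family cofinal in the \<open>i\<close>-th coordinates contains a point above
  \<open>a\<close>. Countably many indices give countably many candidates, with \<open>s\<close>
  added if it lies in \<open>A\<close>.\<close>

lemma ccof_lexp:
  assumes cX: "ccof X" and cr: "countable (Field r)"
  shows "ccof Y"
  unfolding ccof_def Field_lexp
proof (intro allI impI)
  fix A assume A: "A \<subseteq> PiE (Field r) S"
  define H where "H i B = (SOME m. m \<in> (\<lambda>a. a i) ` B \<and> (\<forall>a\<in>B. (a i, m) \<in> X))" for i and B :: "('i \<Rightarrow> 'a) set"
  obtain s where s': "s \<in> extensional (Field r) \<and> (\<forall>i\<in>Field r. s i = H i {a\<in>A. \<forall>k. lt r k i \<longrightarrow> a k = s k})"
    using lex_rec[of H A] ..
  have s: "s i = H i {a\<in>A. \<forall>k. lt r k i \<longrightarrow> a k = s k}" if "i \<in> Field r" for i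
    using s' that by blast
  define D where "D i = {a\<in>A. \<forall>k. lt r k i \<longrightarrow> a k = s k}" for i
  have "\<exists>B\<subseteq>D i. countable B \<and> (\<forall>a\<in>D i. \<exists>b\<in>B. (a i, b i) \<in> X)" if i: "i \<in> Field r" for i
  proof -
    have "(\<lambda>a. a i) ` D i \<subseteq> Field X" using A coord i unfolding D_def by blast
    then have "\<exists>C\<subseteq>(\<lambda>a. a i) ` D i. countable C \<and> (\<forall>a\<in>(\<lambda>a. a i) ` D i. \<exists>b\<in>C. (a, b) \<in> X)"
      using cX unfolding ccof_def by (elim allE impE)
    then obtain C where C: "C \<subseteq> (\<lambda>a. a i) ` D i" "countable C" "\<forall>a\<in>(\<lambda>a. a i) ` D i. \<exists>b\<in>C. (a, b) \<in> X"
      by (elim exE conjE)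
    obtain B where B: "B \<subseteq> D i" "countable B" "C = (\<lambda>a. a i) ` B"
      using C(1,2) countable_subset_image[of C "\<lambda>a. a i" "D i"] by blast
    then show ?thesis using C(3) by (intro exI[of _ B]) auto
  qed
  then obtain B where B: "\<And>i. i \<in> Field r \<Longrightarrow> B i \<subseteq> D i" "\<And>i. i \<in> Field r \<Longrightarrow> countable (B i)"
    "\<And>i a. i \<in> Field r \<Longrightarrow> a \<in> D i \<Longrightarrow> \<exists>b\<in>B i. (a i, b i) \<in> X" by metis
  show "\<exists>B\<subseteq>A. countable B \<and> (\<forall>a\<in>A. \<exists>b\<in>B. (a, b) \<in> Y)"
  proof (intro exI[of _ "(\<Union>i\<in>Field r. B i) \<union> ({s} \<inter> A)"] conjI ballI)
    show "(\<Union>i\<in>Field r. B i) \<union> ({s} \<inter> A) \<subseteq> A" using B(1) unfolding D_def by blast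
    show "countable ((\<Union>i\<in>Field r. B i) \<union> ({s} \<inter> A))" using cr B(2) by auto
    fix a assume a: "a \<in> A"
    then have aP: "a \<in> PiE (Field r) S" using A by blast
    have a_ext: "a \<in> extensional (Field r)" using aP by (simp add: PiE_def)
    show "\<exists>b\<in>(\<Union>i\<in>Field r. B i) \<union> ({s} \<inter> A). (a, b) \<in> Y"
    proof (cases "a = s")
      case True
      then show ?thesis using a lots_refl[OF lots_lexp] aP Field_lexp by blast
    next
      case False
      have "{i\<in>Field r. a i \<noteq> s i} \<noteq> {}"
        using False extensionalityI[OF a_ext, of s] s' by blast
      then obtain i where i: "i \<in> {i\<in>Field r. a i \<noteq> s i}" "\<And>k. k \<in> {i\<in>Field r. a i \<noteq> s i} \<Longrightarrow> (i, k) \<in> r"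
        using wo_least[OF r, of "{i\<in>Field r. a i \<noteq> s i}"] by blast
      have ir: "i \<in> Field r" and ne: "a i \<noteq> s i" using i by auto
      have eq: "a k = s k" if k: "lt r k i" for k
        using i(2)[of k] lt_not_le[OF lr k] lt_Field(1)[OF k] by blast
      have aD: "a \<in> D i" unfolding D_def using a eq by blast
      have "\<exists>a'\<in>D i. lt X (a i) (a' i)"
      proof (rule ccontr)
        assume no: "\<not> ?thesis"
        have mx: "(a' i, a i) \<in> X" if "a' \<in> D i" for a'
        proof -
          have "a' \<in> PiE (Field r) S" using that A unfolding D_def by blast
          then show ?thesis using no that not_lt_le[OF X coord[OF aP ir] coord[OF _ ir]] by blast
        qed
        have "a i \<in> (\<lambda>a. a i) ` D i \<and> (\<forall>a'\<in>D i. (a' i, a i) \<in> X)" using aD mx by blast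
        then have "H i (D i) \<in> (\<lambda>a. a i) ` D i \<and> (\<forall>a\<in>D i. (a i, H i (D i)) \<in> X)"
          unfolding H_def by (rule someI)
        moreover have "H i (D i) = s i" using s[OF ir] unfolding D_def by simp
        ultimately have "(a i, s i) \<in> X" "(s i, a i) \<in> X" using aD mx by auto
        then show False using ne lots_antisym[OF X] by blast
      qed
      then obtain a' where a': "a' \<in> D i" "lt X (a i) (a' i)" by blast
      then obtain b where b: "b \<in> B i" "(a' i, b i) \<in> X" using B(3)[OF ir] by blast
      have bD: "b \<in> D i" using b(1) B(1)[OF ir] by blast
      then have bP: "b \<in> PiE (Field r) S" "\<And>k. lt r k i \<Longrightarrow> b k = s k" using A unfolding D_def by auto
      have "lt X (a i) (b i)" using lt_le_trans[OF X a'(2) b(2)] .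
      then have "lt Y a b" by (rule lt_lexpI[OF aP bP(1) ir]) (simp add: eq bP(2))
      then have "(a, b) \<in> Y" by (rule lt_le)
      then show ?thesis using b(1) ir by blast
    qed
  qed
qed

end

section \<open>Maps induced by an increasing change of indices\<close>

definition coord_map :: "'i rel \<Rightarrow> 'j rel \<Rightarrow> ('i \<Rightarrow> 'j) \<Rightarrow> ('i \<Rightarrow> 'a \<Rightarrow> 'b) \<Rightarrow> ('j \<Rightarrow> 'b) \<Rightarrow> ('i \<Rightarrow> 'a) \<Rightarrow> 'j \<Rightarrow> 'b" where
  "coord_map r s e \<phi> t z = (\<lambda>k\<in>Field s. if k \<in> e ` Field r
      then \<phi> (inv_into (Field r) e k) (z (inv_into (Field r) e k)) else t k)"

lemma strict_mono_reflect:
  assumes "lots r" "lots s" "\<And>i j. lt r i j \<Longrightarrow> lt s (e i) (e j)" "i \<in> Field r" "j \<in> Field r" "lt s (e i) (e j)"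
  shows "lt r i j"
  using lt_cases[OF assms(1,4,5)] assms(3)[of j i] assms(6) lt_asym[OF assms(2)] lt_irrefl by metis

lemma strict_mono_inj:
  assumes "lots r" "\<And>i j. lt r i j \<Longrightarrow> lt s (e i) (e j)"
  shows "inj_on e (Field r)"
  using lt_cases[OF assms(1)] assms(2) lt_irrefl by (metis inj_onI)

locale lexprod_map = L: lexprod X r S + L': lexprod X' r' S'
  for X :: "'a rel" and r :: "'i rel" and S and X' :: "'b rel" and r' :: "'j rel" and S' +
  fixes e :: "'i \<Rightarrow> 'j" and \<phi> :: "'i \<Rightarrow> 'a \<Rightarrow> 'b"
  assumes e: "\<And>i j. lt r i j \<Longrightarrow> lt r' (e i) (e j)" "\<And>i. i \<in> Field r \<Longrightarrow> e i \<in> Field r'"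
    and \<phi>: "\<And>i x. i \<in> Field r \<Longrightarrow> x \<in> S i \<Longrightarrow> \<phi> i x \<in> S' (e i)"
      "\<And>i x y. i \<in> Field r \<Longrightarrow> x \<in> S i \<Longrightarrow> y \<in> S i \<Longrightarrow> lt X x y \<Longrightarrow> lt X' (\<phi> i x) (\<phi> i y)"
begin

abbreviation "F \<equiv> coord_map r r' e \<phi>"

lemma e_inj: "inj_on e (Field r)"
  using strict_mono_inj[OF L.lr e(1)] .

lemma F_e: "i \<in> Field r \<Longrightarrow> F t z (e i) = \<phi> i (z i)"
  using e(2) e_inj by (simp add: coord_map_def)

lemma F_fill: "k \<in> Field r' \<Longrightarrow> k \<notin> e ` Field r \<Longrightarrow> F t z k = t k"
  by (simp add: coord_map_def)

lemma F_in:
  assumes "z \<in> PiE (Field r) S" "\<And>k. k \<in> Field r' \<Longrightarrow> k \<notin> e ` Field r \<Longrightarrow> t k \<in> S' k"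
  shows "F t z \<in> PiE (Field r') S'"
proof
  fix k assume k: "k \<in> Field r'"
  show "F t z k \<in> S' k"
  proof (cases "k \<in> e ` Field r")
    case True
    then obtain i where "i \<in> Field r" "k = e i" by blast
    then show ?thesis using F_e \<phi>(1) assms(1) by fastforce
  qed (use k F_fill assms(2) in simp)
qed (simp add: coord_map_def)

text \<open>The first difference moves from \<open>i\<close> to \<open>e i\<close>: image indices
  below \<open>e i\<close> come from indices below \<open>i\<close>, and the fillings agree there.
  Beyond all images the two fillings \<open>t\<close> and \<open>t'\<close> may differ, which is
  what the fixed point argument exploits.\<close>

lemma F_lt:
  assumes zw: "lt L.Y z w"
    and t: "\<And>k. k \<in> Field r' \<Longrightarrow> k \<notin> e ` Field r \<Longrightarrow> t k \<in> S' k"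
     "\<And>k. k \<in> Field r' \<Longrightarrow> k \<notin> e ` Field r \<Longrightarrow> t' k \<in> S' k"
     "\<And>k i. k \<notin> e ` Field r \<Longrightarrow> i \<in> Field r \<Longrightarrow> lt r' k (e i) \<Longrightarrow> t k = t' k"
  shows "lt L'.Y (F t z) (F t' w)"
proof -
  have P: "z \<in> PiE (Field r) S" "w \<in> PiE (Field r) S" using zw unfolding L.lt_lexp by blast+
  obtain i where i: "i \<in> Field r" "lt X (z i) (w i)" "\<And>k. lt r k i \<Longrightarrow> z k = w k" by (rule L.lt_lexpE[OF zw]) blast
  show ?thesis
  proof (rule L'.lt_lexpI[OF F_in[OF P(1) t(1)] F_in[OF P(2) t(2)] e(2)[OF i(1)]])
    show "lt X' (F t z (e i)) (F t' w (e i))"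
      using \<phi>(2)[OF i(1) _ _ i(2)] P i(1) F_e by (metis PiE_mem)
    fix k assume k: "lt r' k (e i)"
    show "F t z k = F t' w k"
    proof (cases "k \<in> e ` Field r")
      case True
      then obtain j where j: "j \<in> Field r" "k = e j" by blast
      then have "lt r j i" using strict_mono_reflect[of r r' e j i] L.lr L'.lr e(1) j i(1) k by blast
      then show ?thesis using i(3) F_e j by metis
    next
      case False
      then show ?thesis using F_fill[OF lt_Field(1)[OF k] False] t(3)[OF False i(1) k] by metis
    qed
  qed
qed

lemma F_injection:
  assumes t: "\<And>k. k \<in> Field r' \<Longrightarrow> k \<notin> e ` Field r \<Longrightarrow> t k \<in> S' k"
  shows "order_injection L.Y L'.Y (F t)"
  by (rule order_injectionI[OF L.lots_lexp L'.lots_lexp])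
    (use F_in[OF _ t] F_lt[OF _ t t] in \<open>simp_all add: L.Field_lexp L'.Field_lexp\<close>)

end

section \<open>Ordinals and increasing maps\<close>

lemma ordLeq_strict_mono:
  assumes "r \<le>o s"
  obtains e where "\<And>i. i \<in> Field r \<Longrightarrow> e i \<in> Field s" "\<And>i j. lt r i j \<Longrightarrow> lt s (e i) (e j)"
proof -
  obtain e where e: "Well_order r" "Well_order s" "embed r s e" using assms unfolding ordLeq_def by auto
  have c: "compat r s e" and i: "inj_on e (Field r)" using embed_compat embed_inj_on e by blast+
  then have inj: "order_injection r s e" unfolding order_injection_def by blast
  show ?thesis
    using that[of e] order_injectionD(1)[OF inj] order_injection_Field[OF wo_lots[OF e(1)] inj] by blast
qed

text \<open>The strict bound \<open>i0\<close> is the spare index that will carry the two-point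
  factor.\<close>

lemma ordLess_strict_mono:
  assumes "r <o s"
  obtains e i0 where "i0 \<in> Field s" "\<And>i. i \<in> Field r \<Longrightarrow> lt s (e i) i0" "\<And>i j. lt r i j \<Longrightarrow> lt s (e i) (e j)"
proof -
  have wo: "Well_order r" "Well_order s" using assms unfolding ordLess_def by auto
  obtain i0 where i0: "i0 \<in> Field s" "r =o Restr s (underS s i0)"
    using assms ordLess_iff_ordIso_Restr[OF wo(2,1)] by blast
  then have "r \<le>o Restr s (underS s i0)" using ordIso_iff_ordLeq by blast
  then obtain e where e: "\<And>i. i \<in> Field r \<Longrightarrow> e i \<in> Field (Restr s (underS s i0))"
     "\<And>i j. lt r i j \<Longrightarrow> lt (Restr s (underS s i0)) (e i) (e j)" by (rule ordLeq_strict_mono) blast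
  have "Field (Restr s (underS s i0)) \<subseteq> underS s i0" unfolding Field_def by auto
  then show ?thesis using that[of i0 e] i0(1) e unfolding lt_Restr by (auto simp: lt_underS[symmetric])
qed

text \<open>A least \<open>i\<close> with \<open>g i < i\<close> would give
  \<open>g (g i) < g i\<close>, a smaller instance.\<close>

lemma wo_strict_mono_ge:
  assumes "Well_order r" "\<And>i. i \<in> Field r \<Longrightarrow> g i \<in> Field r" "\<And>i j. lt r i j \<Longrightarrow> lt r (g i) (g j)" "i \<in> Field r"
  shows "(i, g i) \<in> r"
  using assms(1,4)
proof (induction rule: wo_induct)
  case (less i)
  note l = wo_lots[OF assms(1)]
  show ?case
  proof (rule ccontr)
    assume "(i, g i) \<notin> r"
    then have a: "lt r (g i) i" using not_le_lt[OF l less(1) assms(2)[OF less(1)]] by blast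
    then show False using less(2)[OF a] assms(3)[OF a] lt_not_le[OF l] by blast
  qed
qed

text \<open>If \<open>s\<close> were shorter, composing with a map of \<open>s\<close> below some
  \<open>i0\<close> would give an increasing self-map of \<open>r\<close> that sends
  \<open>i0\<close> below itself. So ordinals can be compared by increasing maps whose ranges are
  not initial segments.\<close>

lemma strict_mono_ordLeq:
  assumes "Well_order r" "Well_order s" "\<And>i. i \<in> Field r \<Longrightarrow> e i \<in> Field s" "\<And>i j. lt r i j \<Longrightarrow> lt s (e i) (e j)"
  shows "r \<le>o s"
proof (rule ccontr)
  assume "\<not> r \<le>o s"
  then have "s <o r" using not_ordLeq_iff_ordLess[OF assms(2,1)] by simp
  then obtain e' i0 where e': "i0 \<in> Field r" "\<And>i. i \<in> Field s \<Longrightarrow> lt r (e' i) i0" "\<And>i j. lt s i j \<Longrightarrow> lt r (e' i) (e' j)"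
    by (rule ordLess_strict_mono) blast
  have "(i0, e' (e i0)) \<in> r"
    by (rule wo_strict_mono_ge[OF assms(1) _ _ e'(1), of "\<lambda>i. e' (e i)"])
      (use e' assms lt_Field(1)[of r] in blast)+
  then show False using e'(2)[OF assms(3)[OF e'(1)]] lt_not_le[OF wo_lots[OF assms(1)]] by blast
qed

lemma strict_mono_ordLess:
  assumes "Well_order r" "Well_order s" "i0 \<in> Field s" "\<And>i. i \<in> Field r \<Longrightarrow> lt s (e i) i0" "\<And>i j. lt r i j \<Longrightarrow> lt s (e i) (e j)"
  shows "r <o s"
proof -
  have "Field (Restr s (underS s i0)) = underS s i0"
    by (rule Field_Restr_lots[OF wo_lots[OF assms(2)]]) (auto simp: underS_def Field_def)
  moreover have "Well_order (Restr s (underS s i0))" by (rule Well_order_Restr[OF assms(2)])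
  ultimately have "r \<le>o Restr s (underS s i0)"
    using assms lt_Field[of r] by (intro strict_mono_ordLeq[of r _ e]) (auto simp: lt_Restr lt_underS)
  moreover have "Restr s (underS s i0) <o s"
    by (rule underS_Restr_ordLess[OF assms(2)]) (use assms(3) in blast)
  ultimately show ?thesis by (rule ordLeq_ordLess_trans)
qed

section \<open>Suprema in complete orders\<close>

lemma is_sup_iff: "is_sup r A s \<longleftrightarrow> s \<in> Field r \<and> (\<forall>a\<in>A. (a, s) \<in> r) \<and>
   (\<forall>u\<in>Field r. (\<forall>a\<in>A. (a, u) \<in> r) \<longrightarrow> (s, u) \<in> r)"
  unfolding is_sup_def Above_def by blast

text \<open>Completeness speaks of sets bounded on both sides, so \<open>A\<close> is cut off below
  one of its members \<open>a0\<close>, which leaves its upper bounds unchanged.\<close>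

lemma lots_complete_sup:
  assumes r: "lots r" and c: "lots_complete r" and A: "A \<subseteq> Field r" "A \<noteq> {}" "u \<in> Field r" "\<And>a. a \<in> A \<Longrightarrow> (a, u) \<in> r"
  shows "\<exists>s. is_sup r A s"
proof -
  obtain a0 where a0: "a0 \<in> A" using A(2) by blast
  define B where "B = {a\<in>A. (a0, a) \<in> r}"
  have a0F: "a0 \<in> Field r" using a0 A(1) by blast
  have B: "B \<subseteq> Field r" "a0 \<in> B" using A(1) a0 lots_refl[OF r a0F] unfolding B_def by blast+
  have "lots_bounded r B" unfolding lots_bounded_def
    by (intro bexI[OF _ a0F] bexI[OF _ A(3)]) (use A(4) in \<open>auto simp: B_def lots_interval_def\<close>)
  then obtain s where s: "is_sup r B s" using c B unfolding lots_complete_def by blast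
  have "(a, s) \<in> r" if a: "a \<in> A" for a
  proof (cases "a \<in> B")
    case False
    then have "(a, a0) \<in> r" using a a0F A(1) lots_total[OF r, of a a0] unfolding B_def by blast
    then show ?thesis using s B(2) lots_trans[OF r] unfolding is_sup_iff by blast
  qed (use s in \<open>auto simp: is_sup_iff\<close>)
  then have "is_sup r A s" using s unfolding is_sup_iff B_def by blast
  then show ?thesis by blast
qed

text \<open>The infimum of \<open>A\<close> is the supremum of its lower bounds; only those above a
  fixed lower bound \<open>a\<close> are kept, to obtain a bounded set.\<close>

lemma lots_completeI:
  assumes r: "lots r" and sup: "\<And>A. A \<subseteq> Field r \<Longrightarrow> A \<noteq> {} \<Longrightarrow> lots_bounded r A \<Longrightarrow> \<exists>s. is_sup r A s"
  shows "lots_complete r"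
  unfolding lots_complete_def
proof (intro allI impI conjI)
  fix A assume A: "A \<subseteq> Field r" "A \<noteq> {} \<and> lots_bounded r A"
  then show "\<exists>s. is_sup r A s" using sup by blast
  obtain a b where ab: "a \<in> Field r" "b \<in> Field r" "A \<subseteq> lots_interval r a b"
    using A(2) unfolding lots_bounded_def by blast
  define B where "B = {x. (a, x) \<in> r \<and> (\<forall>y\<in>A. (x, y) \<in> r)}"
  obtain y where y: "y \<in> A" using A by blast
  have aB: "a \<in> B" using ab lots_refl[OF r ab(1)] unfolding B_def lots_interval_def by auto
  have BF: "B \<subseteq> Field r" unfolding B_def using le_Field by fast
  have "lots_bounded r B" unfolding lots_bounded_def
    by (intro bexI[OF _ ab(1)] bexI[of _ y]) (use y A in \<open>auto simp: B_def lots_interval_def\<close>)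
  then obtain s where s: "is_sup r B s" using sup BF aB by blast
  have "is_inf r A s" unfolding is_inf_def Under_def
  proof (intro conjI ballI CollectI)
    show "s \<in> Field r" using s unfolding is_sup_iff by blast
    show "(s, y) \<in> r" if "y \<in> A" for y using s that A(1) unfolding is_sup_iff B_def by blast
    fix l assume l: "l \<in> {b \<in> Field r. \<forall>a\<in>A. (b, a) \<in> r}"
    show "(l, s) \<in> r"
    proof (cases "(a, l) \<in> r")
      case True
      then show ?thesis using l s unfolding is_sup_iff B_def by blast
    next
      case False
      then have "(l, a) \<in> r" using l lots_total[OF r ab(1)] by blast
      moreover have "(a, s) \<in> r" using s aB unfolding is_sup_iff by blast
      ultimately show ?thesis by (rule lots_trans[OF r])
    qed
  qed
  then show "\<exists>i. is_inf r A i" by blast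
qed

text \<open>The hypotheses say that the lexicographic product of the order with a two-point order
  maps monotonically into the order. Consider the supremum of \<open>{x. x \<le> g x}\<close>.\<close>

lemma no_lex_double:
  assumes r: "lots r" and sup: "\<And>A. A \<subseteq> Field r \<Longrightarrow> \<exists>s. is_sup r A s"
    and gh: "\<And>x. x \<in> Field r \<Longrightarrow> lt r (g x) (h x)" "\<And>x y. lt r x y \<Longrightarrow> lt r (h x) (g y)"
  shows False
proof -
  define S where "S = {x\<in>Field r. (x, g x) \<in> r}"
  obtain s where s: "is_sup r S s" using sup[of S] unfolding S_def by blast
  then have sF: "s \<in> Field r" unfolding is_sup_iff by blast
  note gs = gh(1)[OF sF]
  have "(x, g s) \<in> r" if x: "x \<in> S" for x
  proof (cases "x = s")
    case False
    then have "lt r x s" using s x unfolding is_sup_iff lt_def by blast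
    then have "lt r (g x) (g s)"
      using gh(2) gh(1)[of x] x lt_trans[OF r] unfolding S_def by blast
    then show ?thesis using x lots_trans[OF r] lt_le[of r "g x" "g s"] unfolding S_def by blast
  qed (use x in \<open>simp add: S_def\<close>)
  then have "(s, g s) \<in> r" using s lt_Field(1)[OF gs] unfolding is_sup_iff by blast
  \<comment> \<open>Now \<open>s <= g s < h s\<close>, hence \<open>h s < g (h s)\<close>: the point
    \<open>h s\<close> belongs to \<open>S\<close> and exceeds its supremum.\<close>
  then have sh: "lt r s (h s)" using le_lt_trans[OF r _ gs] by blast
  then have "h s \<in> S" unfolding S_def using gh(2)[OF sh] lt_Field(2)[OF sh] lt_le[of r "h s"] by blast
  then have "(h s, s) \<in> r" using s unfolding is_sup_iff by blast
  then show False using sh lt_not_le[OF r] by blast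
qed

section \<open>Towers and cubes\<close>

definition tower_coord :: "'a rel \<Rightarrow> 'a \<Rightarrow> 'a \<Rightarrow> 'i rel \<Rightarrow> 'i \<Rightarrow> 'a set" where
  "tower_coord X p q r i = (if \<exists>k. lt r k i then lots_interval X p q else Field X)"

lemma lots_interval_Field: "lots_interval X p q \<subseteq> Field X"
  unfolding lots_interval_def using le_Field(1) by fast

lemma lots_interval_ends: "lots X \<Longrightarrow> (p, q) \<in> X \<Longrightarrow> p \<in> lots_interval X p q \<and> q \<in> lots_interval X p q"
  unfolding lots_interval_def using lots_refl[of X] le_Field[of p q X] by blast

lemma tower_coord_Field: "tower_coord X p q r i \<subseteq> Field X"
  using lots_interval_Field[of X p q] by (auto simp: tower_coord_def)

lemma interval_tower_coord: "lots_interval X p q \<subseteq> tower_coord X p q r i"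
  using lots_interval_Field[of X p q] by (auto simp: tower_coord_def)

lemma tower_eq_lexp: "tower X p q r = lexp X r (tower_coord X p q r)"
proof -
  have *: "(\<exists>k. lt r k i) \<longleftrightarrow> underS r i \<noteq> {}" for i by (auto simp: lt_underS[symmetric])
  have "PiE (Field r) (tower_coord X p q r) =
      (Field r \<rightarrow>\<^sub>E Field X) \<inter> {x. \<forall>i\<in>Field r. underS r i \<noteq> {} \<longrightarrow> x i \<in> lots_interval X p q}"
  proof (intro equalityI subsetI IntI CollectI ballI impI)
    fix x i assume "x \<in> PiE (Field r) (tower_coord X p q r)" "i \<in> Field r" "underS r i \<noteq> {}"
    then show "x i \<in> lots_interval X p q" using *[of i] PiE_mem[of x "Field r" "tower_coord X p q r" i] by (simp add: tower_coord_def)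
  next
    fix x assume x: "x \<in> (Field r \<rightarrow>\<^sub>E Field X) \<inter> {x. \<forall>i\<in>Field r. underS r i \<noteq> {} \<longrightarrow> x i \<in> lots_interval X p q}"
    then show "x \<in> PiE (Field r) (tower_coord X p q r)" using * unfolding tower_coord_def PiE_def Pi_def by simp
  qed (use tower_coord_Field[of X p q r] in blast)
  moreover have "lex_power X r \<subseteq> (Field r \<rightarrow>\<^sub>E Field X) \<times> (Field r \<rightarrow>\<^sub>E Field X)"
    unfolding lex_power_def by auto
  ultimately show ?thesis unfolding tower_def lexp_def by blast
qed

text \<open>With both ends present, every subset of a cube over a complete order has a supremum,
  including the empty set. The fixed point argument needs this, and towers without a greatest point
  cannot provide it.\<close>

definition cube :: "'a rel \<Rightarrow> 'a \<Rightarrow> 'a \<Rightarrow> 'i rel \<Rightarrow> ('i \<Rightarrow> 'a) rel" where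
  "cube X p q r = lexp X r (\<lambda>_. lots_interval X p q)"

lemma lexprod_cube: "lots X \<Longrightarrow> Well_order r \<Longrightarrow> lexprod X r (\<lambda>_. lots_interval X p q)"
  by unfold_locales (simp_all add: lots_interval_Field)

lemma lexprod_tower: "lots X \<Longrightarrow> Well_order r \<Longrightarrow> lexprod X r (tower_coord X p q r)"
  by unfold_locales (simp_all add: tower_coord_Field)

lemma lots_tower: "lots X \<Longrightarrow> Well_order r \<Longrightarrow> lots (tower X p q r)"
  unfolding tower_eq_lexp by (rule lexprod.lots_lexp[OF lexprod_tower])

lemma lots_cube: "lots X \<Longrightarrow> Well_order r \<Longrightarrow> lots (cube X p q r)"
  unfolding cube_def by (rule lexprod.lots_lexp[OF lexprod_cube])

lemma order_dense_tower:
  assumes "lots X" "Well_order r" "order_dense X" shows "order_dense (tower X p q r)"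
  unfolding tower_eq_lexp
proof (rule lexprod.order_dense_lexp[OF lexprod_tower[OF assms(1,2)]])
  fix i a b assume ab: "a \<in> tower_coord X p q r i" "b \<in> tower_coord X p q r i" "lt X a b"
  obtain c where c: "lt X a c" "lt X c b" using order_denseE[OF assms(3) ab(3)] .
  have "c \<in> tower_coord X p q r i"
  proof (cases "\<exists>k. lt r k i")
    case True
    then have "(p, a) \<in> X" "(b, q) \<in> X" using ab(1,2) by (simp_all add: tower_coord_def lots_interval_def)
    then have "(p, c) \<in> X" "(c, q) \<in> X" using lots_trans[OF assms(1)] lt_le[OF c(1)] lt_le[OF c(2)] by blast+
    then show ?thesis using True by (simp add: tower_coord_def lots_interval_def)
  qed (use lt_Field(2)[OF c(1)] in \<open>simp add: tower_coord_def\<close>)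
  then show "\<exists>c\<in>tower_coord X p q r i. lt X a c \<and> lt X c b" using c by blast
qed

lemma interval_sup:
  assumes X: "lots X" "lots_complete X" and B: "B \<subseteq> lots_interval X p q" "B \<noteq> {}"
  shows "\<exists>m\<in>lots_interval X p q. is_sup X B m"
proof -
  obtain b where b: "b \<in> B" using B by blast
  then have bq: "(b, q) \<in> X" "(p, b) \<in> X" using B unfolding lots_interval_def by blast+
  then obtain m where m: "is_sup X B m"
    using lots_complete_sup[OF X, of B q] B lots_interval_Field[of X p q] le_Field[of b q X]
    unfolding lots_interval_def by blast
  then have "(b, m) \<in> X" "(m, q) \<in> X" using b B le_Field(2)[OF bq(1)] unfolding is_sup_iff lots_interval_def by blast+
  then show ?thesis using m bq lots_trans[OF X(1)] unfolding lots_interval_def by blast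
qed

lemma interval_sup_image:
  assumes X: "lots X" "lots_complete X" and B: "g ` B \<subseteq> lots_interval X p q" "B \<noteq> {}"
  shows "\<exists>m\<in>lots_interval X p q. (\<forall>a\<in>B. (g a, m) \<in> X) \<and>
    (\<forall>u\<in>lots_interval X p q. (\<forall>a\<in>B. (g a, u) \<in> X) \<longrightarrow> (m, u) \<in> X)"
proof -
  obtain m where m: "m \<in> lots_interval X p q" "is_sup X (g ` B) m" using interval_sup[OF X B(1)] B(2) by blast
  show ?thesis
  proof (intro bexI[OF _ m(1)] conjI ballI impI)
    show "(g a, m) \<in> X" if "a \<in> B" for a using m(2) that unfolding is_sup_iff by blast
    fix u assume "u \<in> lots_interval X p q" "\<forall>a\<in>B. (g a, u) \<in> X"
    then show "(m, u) \<in> X" using m(2) lots_interval_Field[of X p q] unfolding is_sup_iff by blast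
  qed
qed

lemma cube_sup:
  assumes X: "lots X" "lots_complete X" "(p, q) \<in> X" and r: "Well_order r" and A: "A \<subseteq> Field (cube X p q r)"
  shows "\<exists>s. is_sup (cube X p q r) A s"
proof -
  interpret L: lexprod X r "\<lambda>_. lots_interval X p q" by (rule lexprod_cube[OF X(1) r])
  show ?thesis unfolding cube_def
  proof (rule L.lex_sup)
    show "A \<subseteq> Field r \<rightarrow>\<^sub>E lots_interval X p q" using A unfolding cube_def L.Field_lexp .
    show "(\<exists>m\<in>lots_interval X p q. \<forall>u\<in>lots_interval X p q. (m, u) \<in> X) \<or> A \<noteq> {} \<and> (\<forall>k. \<not> lt r k i)" for i
      using lots_interval_ends[OF X(1,3)] unfolding lots_interval_def by blast
    fix i B assume i: "i \<in> Field r" and B: "B \<subseteq> A" "B \<noteq> {}"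
    have "(\<lambda>a. a i) ` B \<subseteq> lots_interval X p q" using A B i unfolding cube_def L.Field_lexp by blast
    then show "\<exists>m\<in>lots_interval X p q. (\<forall>a\<in>B. (a i, m) \<in> X) \<and>
        (\<forall>u\<in>lots_interval X p q. (\<forall>a\<in>B. (a i, u) \<in> X) \<longrightarrow> (m, u) \<in> X)"
      by (rule interval_sup_image[OF X(1,2) _ B(2)])
  qed
qed

text \<open>Only the least index has an unbounded range. There the coordinates are bounded by that
  of an upper bound of \<open>A\<close>, and the members in play are all of \<open>A\<close>, a
  nonempty set; every other range is an interval.\<close>

lemma lots_complete_tower:
  assumes X: "lots X" "lots_complete X" "(p, q) \<in> X" and r: "Well_order r"
  shows "lots_complete (tower X p q r)"
proof (rule lots_completeI[OF lots_tower[OF X(1) r]])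
  interpret L: lexprod X r "tower_coord X p q r" by (rule lexprod_tower[OF X(1) r])
  fix A assume A: "A \<subseteq> Field (tower X p q r)" "A \<noteq> {}" "lots_bounded (tower X p q r) A"
  then obtain b where b: "b \<in> PiE (Field r) (tower_coord X p q r)" "\<And>a. a \<in> A \<Longrightarrow> (a, b) \<in> L.Y"
    unfolding lots_bounded_def tower_eq_lexp L.Field_lexp lots_interval_def by blast
  have AP: "A \<subseteq> PiE (Field r) (tower_coord X p q r)" using A(1) unfolding tower_eq_lexp L.Field_lexp .
  show "\<exists>s. is_sup (tower X p q r) A s" unfolding tower_eq_lexp
  proof (rule L.lex_sup[OF AP])
    show "(\<exists>m\<in>tower_coord X p q r i. \<forall>u\<in>tower_coord X p q r i. (m, u) \<in> X) \<or> A \<noteq> {} \<and> (\<forall>k. \<not> lt r k i)" for i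
    proof (cases "\<exists>k. lt r k i")
      case True
      then show ?thesis using lots_interval_ends[OF X(1,3)] unfolding tower_coord_def lots_interval_def by auto
    qed (use A(2) in blast)
    fix i B assume i: "i \<in> Field r" and B: "B \<subseteq> A" "B \<noteq> {}"
    show "\<exists>m\<in>tower_coord X p q r i. (\<forall>a\<in>B. (a i, m) \<in> X) \<and>
        (\<forall>u\<in>tower_coord X p q r i. (\<forall>a\<in>B. (a i, u) \<in> X) \<longrightarrow> (m, u) \<in> X)"
    proof (cases "\<exists>k. lt r k i")
      case True
      then have tc: "tower_coord X p q r i = lots_interval X p q" by (simp add: tower_coord_def)
      have "(\<lambda>a. a i) ` B \<subseteq> lots_interval X p q" using AP B i tc by blast
      then show ?thesis unfolding tc by (rule interval_sup_image[OF X(1,2) _ B(2)])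
    next
      case False
      then have tc: "tower_coord X p q r i = Field X" by (simp add: tower_coord_def)
      have sub: "(\<lambda>a. a i) ` B \<subseteq> Field X" using AP B i tc by blast
      have "(a i, b i) \<in> X" if a: "a \<in> B" for a
      proof (cases "a = b")
        case True
        then show ?thesis using lots_refl[OF X(1)] L.coord[OF b(1) i] by simp
      next
        case ne: False
        then have "lt L.Y a b" using b(2)[of a] a B unfolding lt_def by blast
        then obtain j where j: "j \<in> Field r" "lt X (a j) (b j)" "\<And>k. lt r k j \<Longrightarrow> a k = b k"
          by (rule L.lt_lexpE) blast
        have "j = i \<or> lt r i j" using False lt_cases[OF L.lr i j(1)] by blast
        then show ?thesis using j(2) j(3)[of i] lt_le[OF j(2)] lots_refl[OF X(1) L.coord[OF b(1) i]] by auto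
      qed
      then obtain m where m: "is_sup X ((\<lambda>a. a i) ` B) m"
        using lots_complete_sup[OF X(1,2) sub _ L.coord[OF b(1) i]] B(2) by blast
      show ?thesis unfolding tc
      proof (intro bexI[of _ m] conjI ballI impI)
        fix u assume "u \<in> Field X" "\<forall>a\<in>B. (a i, u) \<in> X"
        then show "(m, u) \<in> X" using m unfolding is_sup_iff by blast
      qed (use m in \<open>unfold is_sup_iff, blast+\<close>)
    qed
  qed
qed

lemma cube_mono:
  assumes X: "lots X" "(p, q) \<in> X" and rs: "r \<le>o s" "Well_order r" "Well_order s"
  shows "injects_into (cube X p q r) (cube X p q s)"
proof -
  obtain e where e: "\<And>i. i \<in> Field r \<Longrightarrow> e i \<in> Field s" "\<And>i j. lt r i j \<Longrightarrow> lt s (e i) (e j)"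
    by (rule ordLeq_strict_mono[OF rs(1)]) blast
  interpret L: lexprod X r "\<lambda>_. lots_interval X p q" by (rule lexprod_cube[OF X(1) rs(2)])
  interpret L': lexprod X s "\<lambda>_. lots_interval X p q" by (rule lexprod_cube[OF X(1) rs(3)])
  interpret lexprod_map X r "\<lambda>_. lots_interval X p q" X s "\<lambda>_. lots_interval X p q" e "\<lambda>_ x. x"
    by unfold_locales (use e in auto)
  have "order_injection L.Y L'.Y (coord_map r s e (\<lambda>_ x. x) (\<lambda>_. p))"
    by (rule F_injection) (use lots_interval_ends[OF X] in blast)
  then show ?thesis unfolding injects_into_def cube_def by blast
qed

lemma tower_into_cube:
  assumes X: "lots X" and sq: "\<And>x. x \<in> Field X \<Longrightarrow> sq x \<in> lots_interval X p q" "\<And>x y. lt X x y \<Longrightarrow> lt X (sq x) (sq y)"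
    and r: "Well_order r"
  shows "injects_into (tower X p q r) (cube X p q r)"
proof -
  interpret L: lexprod X r "tower_coord X p q r" by (rule lexprod_tower[OF X r])
  interpret L': lexprod X r "\<lambda>_. lots_interval X p q" by (rule lexprod_cube[OF X r])
  interpret lexprod_map X r "tower_coord X p q r" X r "\<lambda>_. lots_interval X p q" "\<lambda>i. i" "\<lambda>_. sq"
    by unfold_locales (auto intro: sq subsetD[OF tower_coord_Field[of X p q r]])
  have "order_injection L.Y L'.Y (coord_map r r (\<lambda>i. i) (\<lambda>_. sq) (\<lambda>_. undefined))"
    by (rule F_injection) simp
  then show ?thesis unfolding injects_into_def cube_def tower_eq_lexp by blast
qed

lemma cube_into_tower:
  assumes X: "lots X" and r: "Well_order r"
  shows "injects_into (cube X p q r) (tower X p q r)"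
proof -
  interpret L': lexprod X r "tower_coord X p q r" by (rule lexprod_tower[OF X r])
  interpret L: lexprod X r "\<lambda>_. lots_interval X p q" by (rule lexprod_cube[OF X r])
  interpret lexprod_map X r "\<lambda>_. lots_interval X p q" X r "tower_coord X p q r" "\<lambda>i. i" "\<lambda>_ x. x"
    by unfold_locales (use interval_tower_coord[of X p q r] in auto)
  have "order_injection L.Y L'.Y (coord_map r r (\<lambda>i. i) (\<lambda>_ x. x) (\<lambda>_. undefined))"
    by (rule F_injection) simp
  then show ?thesis unfolding injects_into_def cube_def tower_eq_lexp by blast
qed

text \<open>Through \<open>\<rho>\<close>, a point of the cube over \<open>X'\<close> is written
  into the coordinates \<open>e i\<close> of the tower. Setting the spare coordinate
  \<open>i0\<close> to \<open>p\<close> or to \<open>q\<close> gives two points, and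
  \<open>f\<close> brings both back into the cube: these are the maps \<open>g\<close> and
  \<open>h\<close> excluded by \<open>no_lex_double\<close>. \<open>X'\<close> will be
  \<open>X\<close> itself in (b) and the real line in (c).\<close>

lemma tower_not_into_cube:
  fixes X :: "'a rel" and X' :: "'b rel"
  assumes X: "lots X" "lt X p q" and X': "lots X'" "lots_complete X'" "(p', q') \<in> X'"
    and ba: "\<beta> <o \<alpha>" and C: "injects_into (cube X' p' q' \<beta>) (cube X p q \<beta>)"
  shows "\<not> injects_into (tower X p q \<alpha>) (cube X' p' q' \<beta>)"
proof
  assume "injects_into (tower X p q \<alpha>) (cube X' p' q' \<beta>)"
  then obtain f where f: "order_injection (tower X p q \<alpha>) (cube X' p' q' \<beta>) f" unfolding injects_into_def by blast
  obtain \<rho> where \<rho>: "order_injection (cube X' p' q' \<beta>) (cube X p q \<beta>) \<rho>" using C unfolding injects_into_def by blast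
  have wo: "Well_order \<beta>" "Well_order \<alpha>" using ba unfolding ordLess_def by auto
  obtain e i0 where em: "i0 \<in> Field \<alpha>" "\<And>i. i \<in> Field \<beta> \<Longrightarrow> lt \<alpha> (e i) i0" "\<And>i j. lt \<beta> i j \<Longrightarrow> lt \<alpha> (e i) (e j)"
    by (rule ordLess_strict_mono[OF ba]) blast
  note pq = lots_interval_ends[OF X(1) lt_le[OF X(2)]]
  interpret L: lexprod X \<beta> "\<lambda>_. lots_interval X p q" by (rule lexprod_cube[OF X(1) wo(1)])
  interpret L': lexprod X \<alpha> "tower_coord X p q \<alpha>" by (rule lexprod_tower[OF X(1) wo(2)])
  interpret lexprod_map X \<beta> "\<lambda>_. lots_interval X p q" X \<alpha> "tower_coord X p q \<alpha>" e "\<lambda>_ x. x"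
    by unfold_locales (auto intro: em(3) lt_Field(1)[OF em(2)] subsetD[OF interval_tower_coord[of X p q \<alpha>]])
  define t where "t m k = (if k = i0 then m else p)" for m k
  define G where "G m z = f (coord_map \<beta> \<alpha> e (\<lambda>_ x. x) (t m) (\<rho> z))" for m z
  have tS: "t m k \<in> tower_coord X p q \<alpha> k" if "m \<in> {p, q}" for m k
    using that pq interval_tower_coord[of X p q \<alpha> k] unfolding t_def by auto
  have i0: "i0 \<notin> e ` Field \<beta>"
  proof
    assume "i0 \<in> e ` Field \<beta>"
    then obtain i where "i \<in> Field \<beta>" "i0 = e i" by blast
    then show False using em(2)[of i] by simp
  qed
  have below: "t m k = t m' k" if "i \<in> Field \<beta>" "lt \<alpha> k (e i)" for m m' i k
    using that em(2)[OF that(1)] lt_asym[OF L'.lr that(2)] unfolding t_def by auto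
  have \<rho>P: "\<rho> z \<in> PiE (Field \<beta>) (\<lambda>_. lots_interval X p q)" if "z \<in> Field (cube X' p' q' \<beta>)" for z
    using order_injection_Field[OF lots_cube[OF X'(1) wo(1)] \<rho> that] unfolding cube_def L.Field_lexp .
  show False
  proof (rule no_lex_double[OF lots_cube[OF X'(1) wo(1)] cube_sup[OF X' wo(1)]])
    fix z assume "z \<in> Field (cube X' p' q' \<beta>)"
    note z = \<rho>P[OF this]
    have "lt L'.Y (coord_map \<beta> \<alpha> e (\<lambda>_ x. x) (t p) (\<rho> z)) (coord_map \<beta> \<alpha> e (\<lambda>_ x. x) (t q) (\<rho> z))"
    proof (rule L'.lt_lexpI[OF F_in[OF z] F_in[OF z] em(1)])
      show "lt X (coord_map \<beta> \<alpha> e (\<lambda>_ x. x) (t p) (\<rho> z) i0) (coord_map \<beta> \<alpha> e (\<lambda>_ x. x) (t q) (\<rho> z) i0)"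
        unfolding F_fill[OF em(1) i0] using X(2) by (simp add: t_def)
      fix k assume k: "lt \<alpha> k i0"
      then show "coord_map \<beta> \<alpha> e (\<lambda>_ x. x) (t p) (\<rho> z) k = coord_map \<beta> \<alpha> e (\<lambda>_ x. x) (t q) (\<rho> z) k"
        unfolding coord_map_def t_def by (auto simp: lt_Field(1)[OF k])
    qed (use tS in auto)
    then show "lt (cube X' p' q' \<beta>) (G p z) (G q z)"
      unfolding G_def tower_eq_lexp[symmetric] by (rule order_injectionD(1)[OF f])
  next
    fix z w assume zw: "lt (cube X' p' q' \<beta>) z w"
    have "lt L.Y (\<rho> z) (\<rho> w)" using order_injectionD(1)[OF \<rho> zw] unfolding cube_def .
    then have "lt L'.Y (coord_map \<beta> \<alpha> e (\<lambda>_ x. x) (t q) (\<rho> z)) (coord_map \<beta> \<alpha> e (\<lambda>_ x. x) (t p) (\<rho> w))"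
      by (rule F_lt) (use tS below in auto)
    then show "lt (cube X' p' q' \<beta>) (G q z) (G p w)"
      unfolding G_def tower_eq_lexp[symmetric] by (rule order_injectionD(1)[OF f])
  qed
qed

text \<open>The open interval from \<open>p\<close> to \<open>q\<close> is a copy of
  \<open>X\<close> by homogeneity; in this way the free first coordinate of a tower can be squeezed
  into the interval.\<close>

lemma HLOTS_squash:
  assumes "HLOTS X" "lt X p q"
  obtains sq where "\<And>x. x \<in> Field X \<Longrightarrow> sq x \<in> aboveS X p \<inter> underS X q" "\<And>x y. lt X x y \<Longrightarrow> lt X (sq x) (sq y)"
proof -
  note X = HLOTS_lots[OF assms(1)]
  have "openin (lots_topology X) (aboveS X p \<inter> underS X q)"
    using openin_aboveS openin_underS lt_Field assms(2) by (metis openin_Int)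
  moreover have "lots_convex X (aboveS X p \<inter> underS X q)"
    using aboveS_convex[OF X, of p] underS_convex[OF X, of q] unfolding lots_convex_def by blast
  moreover obtain c where "lt X p c" "lt X c q" using order_denseE[OF HLOTS_dense[OF assms(1)] assms(2)] .
  then have "c \<in> aboveS X p \<inter> underS X q" by (simp add: lt_aboveS lt_underS)
  ultimately have "oiso X (Field X) X (aboveS X p \<inter> underS X q)" using HLOTS_oiso[OF assms(1)] by blast
  then obtain f where f: "f ` Field X = aboveS X p \<inter> underS X q" "\<forall>x\<in>Field X. \<forall>y\<in>Field X. lt X x y \<longrightarrow> lt X (f x) (f y)"
    unfolding oiso_def by blast
  show ?thesis by (rule that[of f]) (use f lt_Field[of X] in blast)+
qed

section \<open>Continuous injections of complete orders\<close>

text \<open>Consider the supremum \<open>m\<close> of the points between \<open>x\<close> and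
  \<open>y\<close> whose value is below \<open>c\<close>. Openness of the two preimages excludes
  both \<open>f m < c\<close> and \<open>f m > c\<close>.\<close>

lemma ivt_lots:
  assumes r: "lots r" "lots_complete r" "order_dense r" and s: "lots s"
    and f: "continuous_map (lots_topology r) (lots_topology s) f"
    and xy: "lt r x y" and c: "lt s (f x) c" "lt s c (f y)"
  shows "\<exists>z. (x, z) \<in> r \<and> (z, y) \<in> r \<and> f z = c"
proof -
  have cF: "c \<in> Field s" using lt_Field(1)[OF c(2)] .
  have fF: "f z \<in> Field s" if "z \<in> Field r" for z
    using continuous_map_image_subset_topspace[OF f] that by (auto simp: topspace_lots_topology)
  define U where "U = {z\<in>Field r. lt s (f z) c}"
  define V where "V = {z\<in>Field r. lt s c (f z)}"
  have U: "openin (lots_topology r) U"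
    using openin_continuous_map_preimage[OF f openin_underS[OF cF]]
    unfolding U_def by (simp add: topspace_lots_topology lt_underS)
  have V: "openin (lots_topology r) V"
    using openin_continuous_map_preimage[OF f openin_aboveS[OF cF]]
    unfolding V_def by (simp add: topspace_lots_topology lt_aboveS)
  define S where "S = {z\<in>U. (x, z) \<in> r \<and> (z, y) \<in> r}"
  have xS: "x \<in> S" unfolding S_def U_def using lt_Field(1)[OF xy] c(1) lt_le[OF xy] lots_refl[OF r(1)] by blast
  obtain m where m: "is_sup r S m"
    using lots_complete_sup[OF r(1,2), of S y] xS lt_Field(2)[OF xy] unfolding S_def U_def by blast
  have mF: "m \<in> Field r" and xm: "(x, m) \<in> r" using m xS unfolding is_sup_iff by blast+
  have my: "(m, y) \<in> r" using m lt_Field(2)[OF xy] unfolding is_sup_iff S_def by blast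
  have "\<not> lt s (f m) c"
  proof
    assume l: "lt s (f m) c"
    then have "m \<in> U" using mF unfolding U_def by blast
    moreover have "m \<noteq> y" using l c(2) lt_asym[OF s] by blast
    then have "lt r m y" using my unfolding lt_def by blast
    ultimately obtain z where z: "z \<in> U" "lt r m z" "lt r z y" using open_right[OF r(1,3) U] by blast
    then have "z \<in> S" unfolding S_def using lots_trans[OF r(1) xm lt_le[OF z(2)]] lt_le[OF z(3)] by blast
    then have "(z, m) \<in> r" using m unfolding is_sup_iff by blast
    then show False using lt_not_le[OF r(1) z(2)] by blast
  qed
  moreover have "\<not> lt s c (f m)"
  proof
    assume l: "lt s c (f m)"
    then have mV: "m \<in> V" using mF unfolding V_def by blast
    have "m \<noteq> x" using l c(1) lt_asym[OF s] by blast
    have "m \<notin> S" using l lt_asym[OF s] unfolding S_def U_def by blast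
    obtain L R where LR: "L = Field r \<or> (\<exists>a. L = aboveS r a)" "R = Field r \<or> (\<exists>b. R = underS r b)"
      "m \<in> L" "m \<in> R" "L \<inter> R \<subseteq> V"
      using lots_topology_nbhd[OF r(1) V mV] by blast
    have "\<exists>z\<in>S. z \<in> L"
    proof (cases "L = Field r")
      case True then show ?thesis using xS lt_Field(1)[OF xy] by blast
    next
      case False
      then obtain a where a: "L = aboveS r a" using LR(1) by blast
      then have am: "lt r a m" using LR(3) lt_aboveS by metis
      have "\<not> (\<forall>z\<in>S. (z, a) \<in> r)"
        using m lt_Field(1)[OF am] lt_not_le[OF r(1) am] unfolding is_sup_iff by blast
      then obtain z where z: "z \<in> S" "(z, a) \<notin> r" by blast
      then have "z \<in> Field r" unfolding S_def U_def by blast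
      then have "lt r a z" using not_le_lt[OF r(1) _ lt_Field(1)[OF am]] z(2) by blast
      then show ?thesis using z(1) unfolding a lt_aboveS[symmetric] by blast
    qed
    then obtain z where z: "z \<in> S" "z \<in> L" by blast
    have "(z, m) \<in> r" "z \<noteq> m" using m z(1) \<open>m \<notin> S\<close> unfolding is_sup_iff by blast+
    then have zm: "lt r z m" unfolding lt_def by blast
    have "z \<in> R"
    proof (cases "R = Field r")
      case True then show ?thesis using lt_Field(1)[OF zm] by blast
    next
      case False
      then obtain b where b: "R = underS r b" using LR(2) by blast
      then have "lt r m b" using LR(4) lt_underS by metis
      then show ?thesis unfolding b lt_underS by (rule lt_trans[OF r(1) zm])
    qed
    then have "z \<in> V" using z LR(5) by blast
    then show False using z(1) lt_asym[OF s] unfolding S_def U_def V_def by blast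
  qed
  ultimately have "f m = c" using lt_cases[OF s fF[OF mF] cF] by blast
  then show ?thesis using xm my by blast
qed

lemma ivt_lots':
  assumes r: "lots r" "lots_complete r" "order_dense r" and s: "lots s"
    and f: "continuous_map (lots_topology r) (lots_topology s) f"
    and xy: "lt r x y" and c: "lt s (f y) c" "lt s c (f x)"
  shows "\<exists>z. (x, z) \<in> r \<and> (z, y) \<in> r \<and> f z = c"
  using ivt_lots[OF r lots_converse[OF s], of f x y c] f xy c by (simp add: lots_topology_converse)

text \<open>If \<open>f z\<close> lay between \<open>f x\<close> and \<open>f y\<close>, it would
  also be attained between \<open>x\<close> and \<open>y\<close>, against injectivity; likewise for
  \<open>f x\<close> on the interval from \<open>y\<close> to \<open>z\<close>. So
  \<open>f y\<close> is the middle value.\<close>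

lemma continuous_inj_monotone3:
  assumes r: "lots r" "lots_complete r" "order_dense r" and s: "lots s"
    and f: "continuous_map (lots_topology r) (lots_topology s) f" "inj_on f (Field r)"
    and xyz: "lt r x y" "lt r y z"
  shows "lt s (f x) (f y) \<and> lt s (f y) (f z) \<and> lt s (f x) (f z) \<or>
    lt s (f y) (f x) \<and> lt s (f z) (f y) \<and> lt s (f z) (f x)"
proof -
  have F: "x \<in> Field r" "y \<in> Field r" "z \<in> Field r" using lt_Field[OF xyz(1)] lt_Field[OF xyz(2)] by blast+
  have xz: "lt r x z" using lt_trans[OF r(1) xyz] .
  have fF: "f z \<in> Field s" if "z \<in> Field r" for z
    using continuous_map_image_subset_topspace[OF f(1)] that by (auto simp: topspace_lots_topology)
  have ne: "f x \<noteq> f y" "f y \<noteq> f z" "f x \<noteq> f z"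
    using f(2) F xyz xz unfolding inj_on_def lt_def by blast+
  have inj: "u = v" if "f u = f v" "u \<in> Field r" "v \<in> Field r" for u v using f(2) that by (auto simp: inj_on_def)
  have no1: "\<not> lt s (f u) (f w)" "\<not> lt s (f w) (f u)"
    if w: "lt s (f u) (f w) \<and> lt s (f w) (f v) \<or> lt s (f v) (f w) \<and> lt s (f w) (f u)" 
     and uv: "lt r u v" and out: "lt r w u \<or> lt r v w" for u v w
  proof -
    obtain z where z: "(u, z) \<in> r" "(z, v) \<in> r" "f z = f w"
      using w ivt_lots[OF r s f(1) uv, of "f w"] ivt_lots'[OF r s f(1) uv, of "f w"] by blast
    have "w \<in> Field r" using out lt_Field[of r] by blast
    then have "z = w" using inj[OF z(3)] le_Field[OF z(1)] by blast
    then have False using out z lt_not_le[OF r(1)] by blast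
    then show "\<not> lt s (f u) (f w)" "\<not> lt s (f w) (f u)" by blast+
  qed
  have c: "lt s (f x) (f y) \<or> lt s (f y) (f x)" "lt s (f y) (f z) \<or> lt s (f z) (f y)" "lt s (f x) (f z) \<or> lt s (f z) (f x)"
    using ne lt_cases[OF s fF fF] F by metis+
  show ?thesis
    using c no1[of x z y, OF _ xyz(1)] no1[of y x z, OF _ xyz(2)] xyz lt_asym[OF s] lt_trans[OF s] by blast
qed

text \<open>The direction in which \<open>f\<close> moves a pair is unchanged when the pair is
  widened at either end, and any two pairs have a common widening.\<close>

lemma continuous_inj_monotone:
  assumes r: "lots r" "lots_complete r" "order_dense r" and s: "lots s"
    and f: "continuous_map (lots_topology r) (lots_topology s) f" "inj_on f (Field r)"
  shows "(\<forall>x y. lt r x y \<longrightarrow> lt s (f x) (f y)) \<or> (\<forall>x y. lt r x y \<longrightarrow> lt s (f y) (f x))"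
proof -
  note m3 = continuous_inj_monotone3[OF r s f]
  have as: "\<not> (lt s u v \<and> lt s v u)" for u v using lt_asym[OF s] by blast
  have ext: "lt s (f a) (f b) \<longleftrightarrow> lt s (f m) (f M)"
    if "lt r a b" "m = a \<or> lt r m a" "M = b \<or> lt r b M" for a b m M
  proof -
    have mb: "lt r m b" using that lt_trans[OF r(1)] by blast
    have "lt s (f a) (f b) \<longleftrightarrow> lt s (f m) (f b)" using that(2) m3[of m a b] that(1) as by blast
    also have "\<dots> \<longleftrightarrow> lt s (f m) (f M)" using that(3) m3[of m b M] mb as by blast
    finally show ?thesis .
  qed
  have "lt s (f a) (f b) \<longleftrightarrow> lt s (f c) (f d)" if ab: "lt r a b" and cd: "lt r c d" for a b c d
  proof -
    obtain m where m: "m = a \<or> lt r m a" "m = c \<or> lt r m c"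
      using lt_cases[OF r(1) lt_Field(1)[OF ab] lt_Field(1)[OF cd]] by blast
    obtain M where M: "M = b \<or> lt r b M" "M = d \<or> lt r d M"
      using lt_cases[OF r(1) lt_Field(2)[OF ab] lt_Field(2)[OF cd]] by blast
    show ?thesis using ext[OF ab m(1) M(1)] ext[OF cd m(2) M(2)] by blast
  qed
  moreover have "lt s (f a) (f b) \<or> lt s (f b) (f a)" if ab: "lt r a b" for a b
  proof -
    have F: "a \<in> Field r" "b \<in> Field r" using lt_Field[OF ab] by blast+
    have "f a \<in> Field s" "f b \<in> Field s"
      using continuous_map_image_subset_topspace[OF f(1)] F by (auto simp: topspace_lots_topology)
    moreover have "f a \<noteq> f b" using f(2) F ab unfolding inj_on_def lt_def by blast
    ultimately show ?thesis using lt_cases[OF s] by blast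
  qed
  ultimately show ?thesis by blast
qed

text \<open>An increasing index map may send the least index to a later one, where coordinates are
  confined to the interval. Hence the detour through cubes, with the first coordinate squeezed
  beforehand.\<close>

lemma tower_into_tower:
  assumes X: "lots X" "(p, q) \<in> X"
    and sq: "\<And>x. x \<in> Field X \<Longrightarrow> sq x \<in> lots_interval X p q" "\<And>x y. lt X x y \<Longrightarrow> lt X (sq x) (sq y)"
    and rs: "r \<le>o s"
  shows "injects_into (tower X p q r) (tower X p q s)"
proof -
  have wo: "Well_order r" "Well_order s" using rs unfolding ordLeq_def by auto
  have "injects_into (tower X p q r) (cube X p q r)" by (rule tower_into_cube[OF X(1) sq wo(1)])
  moreover have "injects_into (cube X p q r) (cube X p q s)" by (rule cube_mono[OF X rs wo])
  moreover have "injects_into (cube X p q s) (tower X p q s)" by (rule cube_into_tower[OF X(1) wo(2)])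
  ultimately show ?thesis
    using injects_into_trans[OF lots_tower[OF X(1) wo(1)]] by metis
qed

text \<open>If a homeomorphism \<open>f\<close> reverses the order and \<open>h\<close> is an injection in the other direction, then
  \<open>f \<circ> h \<circ> f\<close> preserves the order, so that a self-dual \<open>X\<close> is not needed.\<close>

lemma tower_not_homeomorphic:
  assumes X: "lots X" "lots_complete X" "order_dense X" "(p, q) \<in> X" and wo: "Well_order \<alpha>" "Well_order \<beta>"
    and ba: "injects_into (tower X p q \<beta>) (tower X p q \<alpha>)" "\<not> injects_into (tower X p q \<alpha>) (tower X p q \<beta>)"
  shows "\<not> lots_topology (tower X p q \<alpha>) homeomorphic_space lots_topology (tower X p q \<beta>)"
proof
  let ?A = "tower X p q \<alpha>" and ?B = "tower X p q \<beta>"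
  assume "lots_topology ?A homeomorphic_space lots_topology ?B"
  then obtain f where "homeomorphic_map (lots_topology ?A) (lots_topology ?B) f"
    using homeomorphic_space by blast
  then have f: "continuous_map (lots_topology ?A) (lots_topology ?B) f" "inj_on f (Field ?A)"
    using homeomorphic_imp_continuous_map homeomorphic_imp_injective_map topspace_lots_topology by metis+
  note l = lots_tower[OF X(1) wo(1), of p q] lots_tower[OF X(1) wo(2), of p q]
  have fF: "f x \<in> Field ?B" if "x \<in> Field ?A" for x
    using continuous_map_image_subset_topspace[OF f(1)] that by (auto simp: topspace_lots_topology)
  obtain h where h: "order_injection ?B ?A h" using ba(1) unfolding injects_into_def by blast
  have hF: "h x \<in> Field ?A" if "x \<in> Field ?B" for x using order_injection_Field[OF l(2) h that] .
  consider "\<forall>x y. lt ?A x y \<longrightarrow> lt ?B (f x) (f y)" | "\<forall>x y. lt ?A x y \<longrightarrow> lt ?B (f y) (f x)"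
    using continuous_inj_monotone[OF l(1) lots_complete_tower[OF X(1,2,4) wo(1)] order_dense_tower[OF X(1) wo(1) X(3)] l(2) f] by blast
  then have "\<exists>g. order_injection ?A ?B g"
  proof cases
    case 1
    then have "order_injection ?A ?B f" by (intro order_injectionI l fF) blast+
    then show ?thesis by blast
  next
    case 2
    then have "order_injection ?A ?B (\<lambda>x. f (h (f x)))"
      using order_injectionD(1)[OF h] by (intro order_injectionI l fF hF) blast+
    then show ?thesis by blast
  qed
  then show False using ba(2) unfolding injects_into_def by blast
qed

lemma injects_into_refl: "injects_into r r"
  unfolding injects_into_def order_injection_def compat_def by (rule exI[of _ id]) auto

theorem tower_bigger:
  assumes X: "CHLOTS X" "lt X p q" and ba: "\<beta> <o \<alpha>"
  shows "bigger (tower X p q \<alpha>) (tower X p q \<beta>)"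
    and "\<not> lots_topology (tower X p q \<alpha>) homeomorphic_space lots_topology (tower X p q \<beta>)"
proof -
  have HX: "HLOTS X" and cX: "lots_complete X" using X(1) unfolding CHLOTS_def by auto
  note lX = HLOTS_lots[OF HX]
  have wo: "Well_order \<alpha>" "Well_order \<beta>" using ba unfolding ordLess_def by auto
  obtain sq where sq': "\<And>x. x \<in> Field X \<Longrightarrow> sq x \<in> aboveS X p \<inter> underS X q" "\<And>x y. lt X x y \<Longrightarrow> lt X (sq x) (sq y)"
    using HLOTS_squash[OF HX X(2)] by blast
  have sq: "sq x \<in> lots_interval X p q" if "x \<in> Field X" for x
    using sq'(1)[OF that] unfolding lots_interval_def by (simp add: aboveS_def underS_def)
  have inj: "injects_into (tower X p q \<beta>) (tower X p q \<alpha>)"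
    using tower_into_tower[OF lX lt_le[OF X(2)] sq sq'(2) ordLess_imp_ordLeq[OF ba]] .
  have "injects_into (tower X p q \<beta>) (cube X p q \<beta>)" by (rule tower_into_cube[OF lX sq sq'(2) wo(2)])
  then have ninj: "\<not> injects_into (tower X p q \<alpha>) (tower X p q \<beta>)"
    using tower_not_into_cube[OF lX X(2) lX cX lt_le[OF X(2)] ba injects_into_refl]
      injects_into_trans[OF lots_tower[OF lX wo(1)]] by blast
  show "bigger (tower X p q \<alpha>) (tower X p q \<beta>)" using inj ninj unfolding bigger_def by blast
  show "\<not> lots_topology (tower X p q \<alpha>) homeomorphic_space lots_topology (tower X p q \<beta>)"
    by (rule tower_not_homeomorphic[OF lX cX HLOTS_dense[OF HX] lt_le[OF X(2)] wo inj ninj])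
qed

section \<open>Completions\<close>

lemma Field_completion: "Field (lots_completion r) = cuts r"
  unfolding Field_def lots_completion_def by auto

lemma le_completion: "(A, B) \<in> lots_completion r \<longleftrightarrow> A \<in> cuts r \<and> B \<in> cuts r \<and> A \<subseteq> B"
  unfolding lots_completion_def by auto

lemma lt_completion: "lt (lots_completion r) A B \<longleftrightarrow> A \<in> cuts r \<and> B \<in> cuts r \<and> A \<subset> B"
  unfolding lt_def le_completion by auto

lemma completion_lots:
  assumes "lots r" "order_dense r"
  shows "lots (lots_completion r)" "lots_complete (lots_completion r)" "order_dense (lots_completion r)"
    "order_injection r (lots_completion r) (under r)"
  using is_completion_lots_completion[OF assms] unfolding is_completion_def by blast+

text \<open>A cut contains its supremum whenever there is one, so a point \<open>b\<close> outside,
  although an upper bound, is not the least one.\<close>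

lemma cut_gap:
  assumes r: "lots r" and A: "A \<in> cuts r" and b: "b \<in> Field r" "b \<notin> A"
  obtains c where "lt r c b" "A \<subseteq> under r c"
proof -
  have low: "(x, b) \<in> r" if x: "x \<in> A" for x
  proof -
    have "x \<in> Field r" "(b, x) \<notin> r" using x A b unfolding cuts_def under_def by blast+
    then show ?thesis using lots_total[OF r b(1)] by blast
  qed
  have "\<not> is_sup r A b" using A b unfolding cuts_def by blast
  then obtain c where c: "c \<in> Field r" "\<forall>a\<in>A. (a, c) \<in> r" "(b, c) \<notin> r" using b low unfolding is_sup_iff by blast
  then have "lt r c b" using not_le_lt[OF r b(1) c(1)] by blast
  then show ?thesis using that c(2) unfolding under_def by blast
qed

text \<open>Choosing \<open>d\<close> strictly inside the gap below \<open>b\<close> makes both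
  inclusions strict, even when \<open>A\<close> or \<open>B\<close> is itself principal.\<close>

lemma cuts_between:
  assumes r: "lots r" "order_dense r" and AB: "A \<in> cuts r" "B \<in> cuts r" "A \<subset> B"
  shows "\<exists>d\<in>Field r. A \<subset> under r d \<and> under r d \<subset> B \<and> d \<in> B \<and> d \<notin> A"
proof -
  obtain b where b: "b \<in> B" "b \<notin> A" using AB(3) by blast
  then have "b \<in> Field r" using AB(2) unfolding cuts_def by blast
  then obtain c where c: "lt r c b" "A \<subseteq> under r c" using cut_gap[OF r(1) AB(1) _ b(2)] by blast
  obtain d where d: "lt r c d" "lt r d b" using order_denseE[OF r(2) c(1)] .
  have dF: "d \<in> Field r" using lt_Field(2)[OF d(1)] .
  have "d \<in> B" using AB(2) b(1) lt_le[OF d(2)] unfolding cuts_def under_def by blast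
  moreover have "d \<notin> A" using c(2) lt_not_le[OF r(1) d(1)] unfolding under_def by blast
  moreover have "under r c \<subseteq> under r d" using lots_trans[OF r(1) _ lt_le[OF d(1)]] unfolding under_def by blast
  moreover have "d \<in> under r d" using lots_refl[OF r(1) dF] unfolding under_def by blast
  moreover have "under r d \<subseteq> B" using AB(2) \<open>d \<in> B\<close> unfolding cuts_def by blast
  moreover have "b \<notin> under r d" using lt_not_le[OF r(1) d(2)] unfolding under_def by blast
  ultimately have "A \<subset> under r d \<and> under r d \<subset> B \<and> d \<in> B \<and> d \<notin> A" using c(2) b(1) by blast
  then show ?thesis using dF by blast
qed

text \<open>Each cut goes to the supremum of its image. Suprema alone would give a weak inequality;
  two points \<open>d < e\<close> of \<open>r\<close> between the cuts make it strict.\<close>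

lemma completion_injects:
  assumes r: "lots r" "order_dense r" and s: "lots s" "lots_complete s" and f: "injects_into r s"
  shows "injects_into (lots_completion r) s"
proof -
  obtain f where f: "order_injection r s f" using f unfolding injects_into_def by blast
  define F where "F A = (SOME m. is_sup s (f ` A) m)" for A
  have sup: "is_sup s (f ` A) (F A)" if A: "A \<in> cuts r" for A
  proof -
    obtain u where u: "u \<in> Field r" "\<forall>a\<in>A. (a, u) \<in> r" using A unfolding cuts_def Above_def by blast
    have "f ` A \<subseteq> Field s" using A order_injection_Field[OF r(1) f] unfolding cuts_def by blast
    moreover have "f ` A \<noteq> {}" using A unfolding cuts_def by blast
    moreover have "(y, f u) \<in> s" if "y \<in> f ` A" for y using that u(2) order_injectionD(2)[OF f] by blast
    ultimately have "\<exists>m. is_sup s (f ` A) m"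
      using lots_complete_sup[OF s _ _ order_injection_Field[OF r(1) f u(1)], of "f ` A"] by blast
    then show ?thesis unfolding F_def by (rule someI_ex)
  qed
  have "order_injection (lots_completion r) s F"
  proof (rule order_injectionI[OF completion_lots(1)[OF r] s(1)])
    show "F A \<in> Field s" if "A \<in> Field (lots_completion r)" for A
      using sup[of A] that unfolding Field_completion is_sup_iff by blast
    fix A B assume "lt (lots_completion r) A B"
    then have AB: "A \<in> cuts r" "B \<in> cuts r" "A \<subset> B" unfolding lt_completion by blast+
    obtain d where d: "d \<in> Field r" "A \<subset> under r d" "under r d \<subset> B" "d \<in> B"
      using cuts_between[OF r AB] by blast
    have ud: "under r d \<in> cuts r"
      using order_injection_Field[OF r(1) completion_lots(4)[OF r] d(1)] unfolding Field_completion .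
    obtain e where e: "e \<in> Field r" "under r d \<subset> under r e" "e \<in> B" "e \<notin> under r d"
      using cuts_between[OF r ud AB(2) d(3)] by blast
    have "(F A, f d) \<in> s"
    proof -
      have "(f a, f d) \<in> s" if "a \<in> A" for a
        using that d(2) order_injectionD(2)[OF f] unfolding under_def by blast
      then show ?thesis using sup[OF AB(1)] order_injection_Field[OF r(1) f d(1)] unfolding is_sup_iff by blast
    qed
    moreover have "lt s (f d) (f e)"
      using e(4) not_le_lt[OF r(1) e(1) d(1)] order_injectionD(1)[OF f] unfolding under_def by blast
    moreover have "(f e, F B) \<in> s" using sup[OF AB(2)] e(3) unfolding is_sup_iff by blast
    ultimately show "lt s (F A) (F B)" using le_lt_trans[OF s(1)] lt_le_trans[OF s(1)] by blast
  qed
  then show ?thesis unfolding injects_into_def by blast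
qed

text \<open>An isomorphism \<open>f\<close> onto the points of \<open>r\<close> lying in an open convex set of cuts induces the
  isomorphism \<open>B \<mapsto> f\<^sup>-\<^sup>1 B\<close> from that set onto all cuts.\<close>

lemma CHLOTS_completion:
  assumes H: "HLOTS r" shows "CHLOTS (lots_completion r)"
proof -
  note r = HLOTS_lots[OF H] HLOTS_dense[OF H]
  let ?R = "lots_completion r"
  note R = completion_lots[OF r]
  have uc: "under r a \<in> cuts r" if "a \<in> Field r" for a
    using order_injection_Field[OF r(1) R(4) that] unfolding Field_completion .
  have umono: "under r a \<subseteq> under r b" if "(a, b) \<in> r" for a b
    using lots_trans[OF r(1) _ that] unfolding under_def by blast
  have usub: "under r a \<subseteq> A" if "A \<in> cuts r" "a \<in> A" for A a using that unfolding cuts_def by blast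
  have uin: "a \<in> under r a" if "a \<in> Field r" for a using lots_refl[OF r(1) that] unfolding under_def by blast
  have three: "\<exists>a\<in>Field ?R. \<exists>b\<in>Field ?R. \<exists>c\<in>Field ?R. a \<noteq> b \<and> a \<noteq> c \<and> b \<noteq> c"
  proof -
    obtain a b c where abc: "a \<in> Field r" "b \<in> Field r" "c \<in> Field r" "a \<noteq> b" "a \<noteq> c" "b \<noteq> c"
      using H unfolding HLOTS_def by blast
    have "inj_on (under r) (Field r)" using R(4) unfolding order_injection_def by blast
    then have "under r a \<noteq> under r b" "under r a \<noteq> under r c" "under r b \<noteq> under r c"
      using abc unfolding inj_on_def by blast+
    then show ?thesis using uc abc(1-3) unfolding Field_completion by blast
  qed
  have "oiso ?R (Field ?R) ?R C"
    if C: "openin (lots_topology ?R) C" "lots_convex ?R C" "C \<noteq> {}" for C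
  proof -
    have CF: "C \<subseteq> cuts r" using C(2) unfolding lots_convex_def Field_completion by blast
    have conv: "B \<in> C" if "A \<in> C" "A' \<in> C" "B \<in> cuts r" "A \<subseteq> B" "B \<subseteq> A'" for A A' B
    proof -
      have "B \<in> lots_interval ?R A A'" using that CF unfolding lots_interval_def le_completion by blast
      then show ?thesis using C(2) that unfolding lots_convex_def by blast
    qed
    define D where "D = {a\<in>Field r. under r a \<in> C}"
    \<comment> \<open>\<open>r\<close> has no maximum, so no cut is greatest. Openness gives a
      larger cut inside \<open>C\<close>, and a principal cut lies in between.\<close>
    have up: "\<exists>d\<in>D. A \<subset> under r d" if A: "A \<in> C" for A
    proof -
      have Ac: "A \<in> cuts r" using A CF by blast
      obtain u where u: "u \<in> Field r" "\<forall>a\<in>A. (a, u) \<in> r" using Ac unfolding cuts_def Above_def by blast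
      obtain v where v: "lt r u v" using HLOTS_no_max[OF H u(1)] by blast
      have "v \<notin> A" using u(2) lt_not_le[OF r(1) v] by blast
      moreover have "A \<subseteq> under r v" using u(2) lots_trans[OF r(1) _ lt_le[OF v]] unfolding under_def by blast
      ultimately have "lt ?R A (under r v)"
        using uin[OF lt_Field(2)[OF v]] uc[OF lt_Field(2)[OF v]] Ac unfolding lt_completion by blast
      then obtain B where B: "B \<in> C" "lt ?R A B" using open_right[OF R(1,3) C(1) A] by blast
      then obtain d where d: "d \<in> Field r" "A \<subset> under r d" "under r d \<subset> B"
        using cuts_between[OF r, of A B] unfolding lt_completion by blast
      then have "under r d \<in> C" using conv[OF A B(1) uc[OF d(1)]] by blast
      then show ?thesis using d unfolding D_def by blast
    qed
    have down: "\<exists>d\<in>D. under r d \<subset> A \<and> d \<in> A" if A: "A \<in> C" for A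
    proof -
      have Ac: "A \<in> cuts r" using A CF by blast
      obtain u where u: "u \<in> A" "u \<in> Field r" using Ac unfolding cuts_def by blast
      obtain v where v: "lt r v u" using HLOTS_no_min[OF H u(2)] by blast
      have "u \<notin> under r v" using lt_not_le[OF r(1) v] unfolding under_def by blast
      moreover have "under r v \<subseteq> A" using umono[OF lt_le[OF v]] usub[OF Ac u(1)] by blast
      ultimately have "lt ?R (under r v) A"
        using uc[OF lt_Field(1)[OF v]] Ac u(1) unfolding lt_completion by blast
      then obtain B where B: "B \<in> C" "lt ?R B A" using open_left[OF R(1,3) C(1) A] by blast
      then obtain d where d: "d \<in> Field r" "B \<subset> under r d" "under r d \<subset> A" "d \<in> A"
        using cuts_between[OF r, of B A] unfolding lt_completion by blast
      then have "under r d \<in> C" using conv[OF B(1) A uc[OF d(1)]] by blast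
      then show ?thesis using d unfolding D_def by blast
    qed
    have Dconv: "x \<in> D" if "a \<in> D" "b \<in> D" "(a, x) \<in> r" "(x, b) \<in> r" for a b x
      using conv[of "under r a" "under r b" "under r x"] umono[OF that(3)] umono[OF that(4)] uc[OF le_Field(2)[OF that(3)]]
        le_Field(2)[OF that(3)] that(1,2) unfolding D_def by blast
    \<comment> \<open>\<open>D\<close> has no end points, so it is the union of the open intervals
      between its members, and thus open in \<open>r\<close>.\<close>
    have "D = (\<Union>a\<in>D. \<Union>b\<in>D. aboveS r a \<inter> underS r b)"
    proof (intro equalityI subsetI)
      fix x assume x: "x \<in> D"
      then have xF: "x \<in> Field r" "under r x \<in> C" unfolding D_def by blast+
      obtain b where b: "b \<in> D" "under r x \<subset> under r b" using up[OF xF(2)] by blast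
      obtain a where a: "a \<in> D" "under r a \<subset> under r x" using down[OF xF(2)] by blast
      have "lt r a x" using a uin[of a] uin[OF xF(1)] umono[of x a] unfolding D_def under_def lt_def by blast
      moreover have "lt r x b" using b uin[of b] uin[OF xF(1)] umono[of b x] unfolding D_def under_def lt_def by blast
      ultimately show "x \<in> (\<Union>a\<in>D. \<Union>b\<in>D. aboveS r a \<inter> underS r b)"
        using a(1) b(1) by (auto simp: lt_aboveS lt_underS)
    next
      fix x assume "x \<in> (\<Union>a\<in>D. \<Union>b\<in>D. aboveS r a \<inter> underS r b)"
      then obtain a b where "a \<in> D" "b \<in> D" "lt r a x" "lt r x b" by (auto simp: lt_aboveS lt_underS)
      then show "x \<in> D" using Dconv lt_le[of r] by blast
    qed
    moreover have "openin (lots_topology r) (\<Union>a\<in>D. \<Union>b\<in>D. aboveS r a \<inter> underS r b)"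
      by (intro openin_Union) (auto simp: D_def intro!: openin_Union openin_Int openin_aboveS openin_underS)
    ultimately have Dopen: "openin (lots_topology r) D" by simp
    have "lots_convex r D"
    proof (rule lots_convexI[OF r(1)])
      show "D \<subseteq> Field r" unfolding D_def by blast
      show "x \<in> D" if "a \<in> D" "b \<in> D" "lt r a x" "lt r x b" for a b x
        using Dconv[OF that(1,2) lt_le[OF that(3)] lt_le[OF that(4)]] .
    qed
    moreover have "D \<noteq> {}" using C(3) up by blast
    ultimately have "oiso r (Field r) r D" using HLOTS_oiso[OF H Dopen] by blast
    then obtain f where f: "f ` Field r = D" "\<And>x y. lt r x y \<Longrightarrow> lt r (f x) (f y)"
      unfolding oiso_def using lt_Field[of r] by blast
    have DF: "D \<subseteq> Field r" unfolding D_def by blast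
    have fF: "f x \<in> Field r" if "x \<in> Field r" for x using f(1) DF that by blast
    have fle: "(f x, f y) \<in> r" if "(x, y) \<in> r" for x y
      using that f(2)[of x y] le_iff_lt[OF r(1)] fF[OF le_Field(1)[OF that]] by blast
    have fle': "(x, y) \<in> r" if "(f x, f y) \<in> r" "x \<in> Field r" "y \<in> Field r" for x y
      using that f(2)[of y x] not_le_lt[OF r(1) that(2,3)] lt_not_le[OF r(1), of "f y" "f x"] by blast
    define G where "G B = {a\<in>Field r. f a \<in> B}" for B
    have Gcut: "G B \<in> cuts r" if B: "B \<in> C" for B
    proof -
      have Bc: "B \<in> cuts r" using B CF by blast
      obtain d where d: "d \<in> D" "under r d \<subset> B" "d \<in> B" using down[OF B] by blast
      obtain d' where d': "d' \<in> D" "B \<subset> under r d'" using up[OF B] by blast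
      show ?thesis unfolding cuts_def
      proof (intro CollectI conjI ballI allI impI)
        show "G B \<subseteq> Field r" unfolding G_def by blast
        show "G B \<noteq> {}" using d f(1) unfolding G_def by blast
        show "under r x \<subseteq> G B" if x: "x \<in> G B" for x
        proof
          fix y assume "y \<in> under r x"
          then have "(y, x) \<in> r" unfolding under_def by blast
          then show "y \<in> G B" using fle[of y x] x usub[OF Bc, of "f x"] le_Field(1)[of y x r] unfolding G_def under_def by blast
        qed
        obtain u where u: "u \<in> Field r" "d' = f u" using d'(1) f(1) by blast
        have "(x, u) \<in> r" if "x \<in> G B" for x
          using that d'(2) fle'[OF _ _ u(1), of x] u(2) unfolding G_def under_def by blast
        then show "Above r (G B) \<noteq> {}" using u(1) unfolding Above_def by blast
        fix s assume s: "is_sup r (G B) s"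
        then have sF: "s \<in> Field r" unfolding is_sup_iff by blast
        show "s \<in> G B"
        proof (rule ccontr)
          assume "s \<notin> G B"
          then have "f s \<notin> B" using sF unfolding G_def by blast
          \<comment> \<open>The bound \<open>c\<close> lies between two members of \<open>D\<close>,
            so it is \<open>f c'\<close> for an upper bound \<open>c'\<close> of \<open>G B\<close>,
            and \<open>c'\<close> is smaller than the supremum \<open>s\<close>.\<close>
          then obtain c where c: "lt r c (f s)" "B \<subseteq> under r c" using cut_gap[OF r(1) Bc fF[OF sF]] by blast
          have "(d, c) \<in> r" using c(2) d(3) unfolding under_def by blast
          then have "c \<in> D" using Dconv[OF d(1) _ _ lt_le[OF c(1)]] f(1) sF by blast
          then obtain c' where c': "c' \<in> Field r" "c = f c'" using f(1) by blast
          have "(x, c') \<in> r" if "x \<in> G B" for x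
            using that c(2) fle'[OF _ _ c'(1), of x] unfolding G_def under_def c'(2) by blast
          then have "(s, c') \<in> r" using s c'(1) unfolding is_sup_iff by blast
          then show False using fle[of s c'] c(1) lt_not_le[OF r(1), of c "f s"] unfolding c'(2) by blast
        qed
      qed
    qed
    have "oiso ?R C ?R (Field ?R)" unfolding oiso_def Field_completion
    proof (intro exI[of _ G] conjI ballI impI equalityI subsetI)
      show "A \<in> cuts r" if "A \<in> G ` C" for A using that Gcut by blast
      fix B B' assume B: "B \<in> C" "B' \<in> C" "lt ?R B B'"
      then have BB: "B \<in> cuts r" "B' \<in> cuts r" "B \<subset> B'" unfolding lt_completion by blast+
      obtain d where d: "d \<in> Field r" "B \<subset> under r d" "under r d \<subset> B'" "d \<in> B'" "d \<notin> B"
        using cuts_between[OF r BB] by blast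
      have "d \<in> D" using conv[OF B(1,2) uc[OF d(1)]] d unfolding D_def by blast
      then obtain a where "a \<in> Field r" "d = f a" using f(1) by blast
      then show "lt ?R (G B) (G B')" using Gcut B(1,2) BB(3) d(4,5) unfolding lt_completion G_def by blast
    next
      fix A assume A: "A \<in> cuts r"
      obtain u where u: "u \<in> Field r" "\<forall>a\<in>A. (a, u) \<in> r" using A unfolding cuts_def Above_def by blast
      obtain a0 where a0: "a0 \<in> A" using A unfolding cuts_def by blast
      have AF: "A \<subseteq> Field r" using A unfolding cuts_def by blast
      \<comment> \<open>The cut sent to \<open>A\<close> is the supremum, among all cuts, of the
        principal cuts at \<open>f a\<close> for \<open>a\<close> in \<open>A\<close>. It belongs to
        \<open>C\<close> because it lies between two of the principal cuts in
        \<open>C\<close>.\<close>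
      define S where "S = (\<lambda>a. under r (f a)) ` A"
      have SF: "S \<subseteq> Field ?R" unfolding S_def Field_completion using uc fF AF by blast
      have Su: "(B, under r (f u)) \<in> ?R" if "B \<in> S" for B
        using that u(2) umono[OF fle] uc[OF fF] u(1) AF unfolding S_def le_completion by blast
      have uF: "under r (f u) \<in> Field ?R" unfolding Field_completion using uc[OF fF[OF u(1)]] .
      obtain T where T: "is_sup ?R S T"
        using lots_complete_sup[OF R(1,2) SF _ uF Su] a0 unfolding S_def by blast
      have Tc: "T \<in> cuts r" using T unfolding is_sup_iff Field_completion by blast
      have T1: "under r (f a) \<subseteq> T" if "a \<in> A" for a
        using T that unfolding is_sup_iff le_completion S_def by blast
      have T2: "T \<subseteq> under r (f c)" if c: "c \<in> Field r" "\<forall>a\<in>A. (a, c) \<in> r" for c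
      proof -
        have cF: "under r (f c) \<in> Field ?R" unfolding Field_completion using uc[OF fF[OF c(1)]] .
        have "(B, under r (f c)) \<in> ?R" if "B \<in> S" for B
          using that c umono[OF fle] uc[OF fF] AF unfolding S_def le_completion by blast
        then show ?thesis using T cF unfolding is_sup_iff le_completion by blast
      qed
      have fC: "under r (f x) \<in> C" if "x \<in> Field r" for x using that f(1) unfolding D_def by blast
      have TC: "T \<in> C" using conv[OF fC[of a0] fC[OF u(1)] Tc T1[OF a0] T2[OF u]] AF a0 by blast
      have "G T = A"
      proof (intro equalityI subsetI)
        fix a assume "a \<in> A"
        then show "a \<in> G T" using T1[of a] AF uin[OF fF, of a] unfolding G_def by blast
      next
        fix a assume a: "a \<in> G T"
        show "a \<in> A"
        proof (rule ccontr)
          assume na: "a \<notin> A"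
          have aF: "a \<in> Field r" "f a \<in> T" using a unfolding G_def by blast+
          obtain c where c: "lt r c a" "A \<subseteq> under r c" using cut_gap[OF r(1) A aF(1) na] by blast
          have "T \<subseteq> under r (f c)" using T2[OF lt_Field(1)[OF c(1)]] c(2) unfolding under_def by blast
          then have "(f a, f c) \<in> r" using aF(2) unfolding under_def by blast
          then show False using f(2)[OF c(1)] lt_not_le[OF r(1)] by blast
        qed
      qed
      then show "A \<in> G ` C" using TC by blast
    qed
    then show ?thesis using oiso_sym[OF R(1) R(1)] CF Field_completion by metis
  qed
  then have "HLOTS ?R" unfolding HLOTS_iff using R(1) three by blast
  then show ?thesis using R(2) unfolding CHLOTS_def by blast
qed

section \<open>Ordinals absorbing a factor\<close>

text \<open>The first component dominates: this is \<open>b\<close> copies of \<open>d\<close> in a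
  row, written \<open>d * b\<close> in the usual ordinal notation.\<close>

definition oprod :: "'b rel \<Rightarrow> 'd rel \<Rightarrow> ('b \<times> 'd) rel" where
  "oprod b d = {((x, y), (x', y')). x \<in> Field b \<and> x' \<in> Field b \<and> y \<in> Field d \<and> y' \<in> Field d \<and>
     (lt b x x' \<or> x = x' \<and> (y, y') \<in> d)}"

lemma Field_oprod:
  assumes "lots d" shows "Field (oprod b d) = Field b \<times> Field d"
proof -
  have "(z, z) \<in> oprod b d" if "z \<in> Field b \<times> Field d" for z
    using that lots_refl[OF assms] unfolding oprod_def by auto
  then have "Field b \<times> Field d \<subseteq> Field (oprod b d)" using le_Field(1) by (metis subsetI)
  moreover have "Field (oprod b d) \<subseteq> Field b \<times> Field d" unfolding Field_def oprod_def by auto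
  ultimately show ?thesis by blast
qed

lemma lt_oprod:
  "lt (oprod b d) z z' \<longleftrightarrow> fst z \<in> Field b \<and> fst z' \<in> Field b \<and> snd z \<in> Field d \<and> snd z' \<in> Field d \<and>
     (lt b (fst z) (fst z') \<or> fst z = fst z' \<and> lt d (snd z) (snd z'))"
  unfolding lt_def oprod_def by (cases z; cases z') auto

lemma Well_order_oprod:
  assumes "Well_order b" "Well_order d" shows "Well_order (oprod b d)"
proof -
  note b = wo_lots[OF assms(1)] and d = wo_lots[OF assms(2)]
  have "lots (oprod b d)"
  proof (rule lots_ltI)
    show "(a, a) \<in> oprod b d" if "a \<in> Field (oprod b d)" for a
      using that lots_refl[OF d] unfolding Field_oprod[OF d] unfolding oprod_def by auto
    show "lt (oprod b d) x z" if "lt (oprod b d) x y" "lt (oprod b d) y z" for x y z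
      using that lt_trans[OF b, of "fst x" "fst y" "fst z"] lt_trans[OF d, of "snd x" "snd y" "snd z"]
      unfolding lt_oprod by auto
    show "lt (oprod b d) x y \<or> lt (oprod b d) y x"
      if "x \<in> Field (oprod b d)" "y \<in> Field (oprod b d)" "x \<noteq> y" for x y
      using that lt_cases[OF b, of "fst x" "fst y"] lt_cases[OF d, of "snd x" "snd y"]
      unfolding Field_oprod[OF d] lt_oprod by (cases x; cases y) auto
  qed
  moreover have "wf (oprod b d - Id)"
  proof (rule wf_subset)
    show "wf ((b - Id) <*lex*> (d - Id))"
      using assms by (intro wf_lex_prod) (simp_all add: well_order_on_def)
    show "oprod b d - Id \<subseteq> (b - Id) <*lex*> (d - Id)"
      unfolding oprod_def lt_def by auto
  qed
  ultimately show ?thesis by (simp add: well_order_on_def)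
qed

lemma oprod_mono:
  assumes "b \<le>o b'" "d \<le>o d'"
  shows "oprod b d \<le>o oprod b' d'"
proof -
  have wo: "Well_order b" "Well_order b'" "Well_order d" "Well_order d'" using assms unfolding ordLeq_def by auto
  obtain e where e: "\<And>i. i \<in> Field b \<Longrightarrow> e i \<in> Field b'" "\<And>i j. lt b i j \<Longrightarrow> lt b' (e i) (e j)"
    by (rule ordLeq_strict_mono[OF assms(1)]) blast
  obtain g where g: "\<And>i. i \<in> Field d \<Longrightarrow> g i \<in> Field d'" "\<And>i j. lt d i j \<Longrightarrow> lt d' (g i) (g j)"
    by (rule ordLeq_strict_mono[OF assms(2)]) blast
  show ?thesis
    by (rule strict_mono_ordLeq[OF Well_order_oprod[OF wo(1,3)] Well_order_oprod[OF wo(2,4)], of "\<lambda>z. (e (fst z), g (snd z))"])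
      (use e g in \<open>auto simp: Field_oprod[OF wo_lots[OF wo(3)]] Field_oprod[OF wo_lots[OF wo(4)]] lt_oprod\<close>)
qed

lemma oprod_strict_mono:
  assumes "b <o b'" "Well_order d" "Field d \<noteq> {}"
  shows "oprod b d <o oprod b' d"
proof -
  have wo: "Well_order b" "Well_order b'" using assms unfolding ordLess_def by auto
  obtain e i0 where e: "i0 \<in> Field b'" "\<And>i. i \<in> Field b \<Longrightarrow> lt b' (e i) i0" "\<And>i j. lt b i j \<Longrightarrow> lt b' (e i) (e j)"
    by (rule ordLess_strict_mono[OF assms(1)]) blast
  obtain y where y: "y \<in> Field d" using assms(3) by blast
  have e': "e i \<in> Field b'" if "i \<in> Field b" for i using lt_Field(1)[OF e(2)[OF that]] .
  show ?thesis
    by (rule strict_mono_ordLess[OF Well_order_oprod[OF wo(1) assms(2)] Well_order_oprod[OF wo(2) assms(2)], of "(i0, y)" "\<lambda>z. (e (fst z), snd z)"])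
      (use e e' y in \<open>auto simp: Field_oprod[OF wo_lots[OF assms(2)]] lt_oprod\<close>)
qed

section \<open>Final segments and tail-like ordinals\<close>

definition tail :: "'i rel \<Rightarrow> 'i \<Rightarrow> 'i rel" where
  "tail r i = Restr r {k. (i, k) \<in> r}"

lemma Field_tail: "Well_order r \<Longrightarrow> Field (tail r i) = {k. (i, k) \<in> r}"
  unfolding tail_def by (rule Field_Restr_lots[OF wo_lots]) (auto simp: Field_def)

lemma Well_order_tail: "Well_order r \<Longrightarrow> Well_order (tail r i)"
  unfolding tail_def by (rule Well_order_Restr)

lemma lt_tail: "lt (tail r i) j k \<longleftrightarrow> lt r j k \<and> (i, j) \<in> r \<and> (i, k) \<in> r"
  unfolding tail_def by (auto simp: lt_Restr)

lemma lt_ord_sum: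
  "lt (ord_sum r s) (Inl x) (Inl x') \<longleftrightarrow> lt r x x'"
  "lt (ord_sum r s) (Inr y) (Inr y') \<longleftrightarrow> lt s y y'"
  "lt (ord_sum r s) (Inl x) (Inr y) \<longleftrightarrow> x \<in> Field r \<and> y \<in> Field s"
  unfolding lt_def ord_sum_def by auto

lemma Field_ord_sum: "Field (ord_sum r s) = Inl ` Field r \<union> Inr ` Field s"
  unfolding Field_def ord_sum_def by force

text \<open>An increasing map \<open>s + r \<Rightarrow> r\<close>, where \<open>s\<close> is the initial segment of \<open>r\<close> below \<open>i\<close>, sends the
  second summand above \<open>i\<close>, since it cannot decrease the points of \<open>s\<close>.\<close>

lemma tail_like_tail:
  assumes tl: "tail_like r" and i: "i \<in> Field r"
  shows "r \<le>o tail r i"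
proof -
  have wo: "Well_order r" using tl unfolding tail_like_def by blast
  note l = wo_lots[OF wo]
  define s where "s = Restr r (underS r i)"
  have Fs: "Field s = underS r i" unfolding s_def
    by (rule Field_Restr_lots[OF l]) (auto simp: underS_def Field_def)
  have "s <o r" unfolding s_def by (rule underS_Restr_ordLess[OF wo]) (use i in blast)
  then have "(ord_sum s r, r) \<in> ordIso" using tl unfolding tail_like_def by blast
  then have "ord_sum s r \<le>o r" using ordIso_iff_ordLeq by blast
  then obtain F where F: "\<And>x. x \<in> Field (ord_sum s r) \<Longrightarrow> F x \<in> Field r" "\<And>x y. lt (ord_sum s r) x y \<Longrightarrow> lt r (F x) (F y)"
    by (rule ordLeq_strict_mono) blast
  have lts: "lt s j k \<longleftrightarrow> lt r j k \<and> lt r j i \<and> lt r k i" for j k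
    unfolding s_def by (simp add: lt_Restr lt_underS)
  have ge: "lt r k i \<Longrightarrow> (k, F (Inl k)) \<in> r" if "k \<in> Field r" for k
    using wo that
  proof (induction rule: wo_induct)
    case (less k)
    have kF: "F (Inl k) \<in> Field r" using F(1) less(3) by (auto simp: Field_ord_sum Fs lt_underS)
    show ?case
    proof (rule ccontr)
      assume "(k, F (Inl k)) \<notin> r"
      then have a: "lt r (F (Inl k)) k" using not_le_lt[OF l less(1) kF] by blast
      have b: "lt r (F (Inl k)) i" using lt_trans[OF l a less(3)] .
      have "lt s (F (Inl k)) k" using a b less(3) lts by blast
      then have "lt r (F (Inl (F (Inl k)))) (F (Inl k))" using F(2) lt_ord_sum(1)[of s r "F (Inl k)" k] by simp
      then show False using less(2)[OF a b] lt_not_le[OF l] by blast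
    qed
  qed
  have "(i, F (Inr x)) \<in> r" if x: "x \<in> Field r" for x
  proof (rule ccontr)
    assume n: "(i, F (Inr x)) \<notin> r"
    have "F (Inr x) \<in> Field r" using F(1) x by (auto simp: Field_ord_sum)
    then have a: "lt r (F (Inr x)) i" using n not_le_lt[OF l i] by blast
    then have "lt (ord_sum s r) (Inl (F (Inr x))) (Inr x)" using x unfolding lt_ord_sum Fs by (simp add: lt_underS)
    then show False using F(2) ge[OF lt_Field(1)[OF a] a] lt_not_le[OF l] by blast
  qed
  then show ?thesis
    by (intro strict_mono_ordLeq[OF wo Well_order_tail[OF wo], of "\<lambda>x. F (Inr x)"])
      (auto simp: Field_tail[OF wo] lt_tail lt_Field(1,2) intro!: F(2) lt_ord_sum(2)[THEN iffD2])
qed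

lemma Field_Restr_underS: "Well_order r \<Longrightarrow> Field (Restr r (underS r i)) = underS r i"
  by (rule Field_Restr_lots[OF wo_lots]) (auto simp: underS_def Field_def)

text \<open>If \<open>\<beta> < \<beta> d\<close> (with \<open>\<beta>\<close> copies of \<open>d\<close>), then \<open>\<beta> = b d + y\<close> with \<open>b < \<beta>\<close>, \<open>y < d\<close>. As \<open>\<beta>\<close> is
  tail-like, \<open>y = 0\<close> and \<open>b\<close> is tail-like. By induction \<open>b < \<theta>\<close>, but then \<open>\<beta> = b d < \<theta>\<close>.\<close>

lemma tail_like_absorbs:
  fixes \<theta> :: "'t rel" and d :: "'d rel" and \<beta> :: "'i rel"
  assumes th: "Well_order \<theta>" "Field \<theta> \<noteq> {}" "oprod \<theta> d \<le>o \<theta>" and d: "Well_order d" "Field d \<noteq> {}"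
    and b: "Well_order \<beta>" "\<And>i. i \<in> Field \<beta> \<Longrightarrow> \<beta> \<le>o tail \<beta> i" "\<theta> \<le>o \<beta>"
  shows "oprod \<beta> d \<le>o \<beta>"
  using b
proof (induction \<beta> rule: wf_induct_rule[OF wf_ordLess])
  case (1 \<beta>)
  note wo = 1(2) and tl = 1(3) and thb = 1(4)
  note ld = wo_lots[OF d(1)] and l = wo_lots[OF wo]
  let ?P = "oprod \<beta> d"
  have woP: "Well_order ?P" using Well_order_oprod[OF wo d(1)] .
  have FP: "Field ?P = Field \<beta> \<times> Field d" using Field_oprod[OF ld] .
  show ?case
  proof (rule ccontr)
    assume "\<not> ?P \<le>o \<beta>"
    then have "\<beta> <o ?P" using not_ordLeq_iff_ordLess[OF wo woP] by simp
    then obtain z where z: "z \<in> Field ?P" "\<beta> =o Restr ?P (underS ?P z)"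
      using ordLess_iff_ordIso_Restr[OF woP wo] by blast
    obtain b y where zby: "z = (b, y)" by (cases z)
    have bF: "b \<in> Field \<beta>" and yF: "y \<in> Field d" using z(1) unfolding FP zby by auto
    let ?Q = "Restr ?P (underS ?P z)"
    have woQ: "Well_order ?Q" by (rule Well_order_Restr[OF woP])
    have FQ: "Field ?Q = underS ?P z" by (rule Field_Restr_underS[OF woP])
    have bQ: "\<beta> \<le>o ?Q" "?Q \<le>o \<beta>" using z(2) ordIso_iff_ordLeq by blast+
    obtain f where f: "iso \<beta> ?Q f" using z(2) unfolding ordIso_def by blast
    have fbij: "bij_betw f (Field \<beta>) (underS ?P z)" using f unfolding iso_def FQ by blast
    have femb: "embed \<beta> ?Q f" using f unfolding iso_def by blast
    have finj: "order_injection \<beta> ?Q f" unfolding order_injection_def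
      using embed_compat[OF femb] fbij by (simp add: bij_betw_def)
    have fmono: "lt ?P (f i) (f j)" if "lt \<beta> i j" for i j
      using order_injectionD(1)[OF finj that] unfolding lt_Restr by blast
    have fin: "lt ?P (f i) z" if "i \<in> Field \<beta>" for i
      using fbij that unfolding lt_underS[symmetric] bij_betw_def by blast
    have fsurj: "\<exists>i\<in>Field \<beta>. f i = w" if "lt ?P w z" for w
      using fbij that unfolding lt_underS[symmetric] bij_betw_def by (metis imageE)
    obtain m where m: "m \<in> Field d" "\<And>k. k \<in> Field d \<Longrightarrow> (m, k) \<in> d" using wo_least[OF d(1) _ d(2)] by blast
    \<comment> \<open>As \<theta> is nonempty, its product with \<open>d\<close> contains a copy of
      \<open>d\<close>.\<close>
    have dth: "d \<le>o \<theta>"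
    proof -
      obtain t where t: "t \<in> Field \<theta>" using th(2) by blast
      have "d \<le>o oprod \<theta> d"
        by (rule strict_mono_ordLeq[OF d(1) Well_order_oprod[OF th(1) d(1)], of "\<lambda>k. (t, k)"])
          (use t lt_Field[of d] in \<open>auto simp: Field_oprod[OF ld] lt_oprod\<close>)
      then show ?thesis using th(3) ordLeq_transitive by blast
    qed
    \<comment> \<open>Otherwise the final segment of \<beta> that starts at \<open>(b, m)\<close>
      embeds into \<open>d\<close> below \<open>y\<close>. It is then shorter than \<open>d\<close>,
      hence than \<theta> and \<beta>, against the hypothesis on final segments.\<close>
    have "y = m"
    proof (rule ccontr)
      assume "y \<noteq> m"
      then have my: "lt d m y" using m(2)[OF yF] unfolding lt_def by blast
      then have "lt ?P (b, m) z" unfolding zby lt_oprod using bF m(1) yF by simp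
      then obtain i where i: "i \<in> Field \<beta>" "f i = (b, m)" using fsurj by blast
      have tlb: "fst (f k) = b \<and> lt d (snd (f k)) y" if k: "(i, k) \<in> \<beta>" for k
      proof -
        have "f k = (b, m) \<or> lt ?P (b, m) (f k)" using fmono[of i k] k i(2) unfolding lt_def by metis
        moreover have "lt ?P (f k) (b, y)" using fin[OF le_Field(2)[OF k]] unfolding zby .
        ultimately show ?thesis using my lt_asym[OF l, of b "fst (f k)"] unfolding lt_oprod by (cases "f k") auto
      qed
      have "tail \<beta> i <o d"
      proof (rule strict_mono_ordLess[OF Well_order_tail[OF wo] d(1) yF, of i "\<lambda>k. snd (f k)"])
        show "lt d (snd (f k)) y" if "k \<in> Field (tail \<beta> i)" for k using that tlb unfolding Field_tail[OF wo] by blast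
        show "lt d (snd (f j)) (snd (f k))" if "lt (tail \<beta> i) j k" for j k
        proof -
          have "lt ?P (f j) (f k)" "fst (f j) = b" "fst (f k) = b" using that fmono tlb unfolding lt_tail by blast+
          then show ?thesis unfolding lt_oprod by simp
        qed
      qed
      then have "tail \<beta> i <o \<theta>" using dth ordLess_ordLeq_trans by blast
      then have "\<beta> <o \<beta>" using tl[OF i(1)] thb ordLeq_ordLess_trans ordLess_ordLeq_trans by blast
      then show False using ordLess_irreflexive by blast
    qed
    then have z': "z = (b, m)" using zby by simp
    have below: "lt ?P w z \<longleftrightarrow> lt \<beta> (fst w) b \<and> snd w \<in> Field d" for w
    proof -
      have "\<not> lt d (snd w) m" using m(2) lt_not_le[OF ld] lt_Field(1) by metis
      then show ?thesis using bF m(1) lt_Field(1)[of \<beta> "fst w" b] unfolding lt_oprod z' by auto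
    qed
    let ?b = "Restr \<beta> (underS \<beta> b)"
    have wob: "Well_order ?b" by (rule Well_order_Restr[OF wo])
    have Fb: "Field ?b = underS \<beta> b" by (rule Field_Restr_underS[OF wo])
    have bb: "?b <o \<beta>" by (rule underS_Restr_ordLess[OF wo]) (use bF in blast)
    have ltb: "lt ?b j k \<longleftrightarrow> lt \<beta> j k \<and> lt \<beta> j b \<and> lt \<beta> k b" for j k by (simp add: lt_Restr lt_underS)
    \<comment> \<open>With \<open>m\<close> least, the points below \<open>z\<close> are those whose
      first component is below \<open>b\<close>, so \<beta> amounts to \<open>?b\<close> copies of
      \<open>d\<close>.\<close>
    have bd1: "\<beta> \<le>o oprod ?b d"
    proof (rule strict_mono_ordLeq[OF wo Well_order_oprod[OF wob d(1)], of f])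
      show "f i \<in> Field (oprod ?b d)" if "i \<in> Field \<beta>" for i
        using fin[OF that] unfolding Field_oprod[OF ld] Fb below by (cases "f i") (simp add: lt_underS)
      show "lt (oprod ?b d) (f i) (f j)" if ij: "lt \<beta> i j" for i j
        using fin[OF lt_Field(1)[OF ij]] fin[OF lt_Field(2)[OF ij]] fmono[OF ij]
        unfolding below unfolding lt_oprod Fb ltb by (simp add: lt_underS)
    qed
    have bd2: "oprod ?b d \<le>o \<beta>"
    proof -
      have "oprod ?b d \<le>o ?Q"
      proof (rule strict_mono_ordLeq[OF Well_order_oprod[OF wob d(1)] woQ, of "\<lambda>x. x"])
        show "w \<in> Field ?Q" if "w \<in> Field (oprod ?b d)" for w
          using that unfolding FQ lt_underS below Field_oprod[OF ld] Fb by (cases w) (simp add: lt_underS)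
        show "lt ?Q w w'" if "lt (oprod ?b d) w w'" for w w'
          using that lt_Field[of \<beta>] unfolding lt_Restr lt_underS below unfolding lt_oprod Fb ltb by (auto simp: lt_underS)
      qed
      then show ?thesis using bQ(2) ordLeq_transitive by blast
    qed
    \<comment> \<open>If the final segment of \<open>?b\<close> from \<open>c\<close> were shorter,
      the final segment of \<beta> from \<open>(c, m)\<close> would fit into that many copies of
      \<open>d\<close>, fewer than make up \<beta>.\<close>
    have btl: "?b \<le>o tail ?b c" if c: "c \<in> Field ?b" for c
    proof (rule ccontr)
      assume "\<not> ?b \<le>o tail ?b c"
      then have "tail ?b c <o ?b" using not_ordLeq_iff_ordLess[OF Well_order_tail[OF wob] wob] by simp
      then have s: "oprod (tail ?b c) d <o oprod ?b d" by (rule oprod_strict_mono[OF _ d])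
      have cb: "lt \<beta> c b" using c unfolding Fb by (simp add: lt_underS)
      then have "lt ?P (c, m) z" unfolding below using m(1) by simp
      then obtain i where i: "i \<in> Field \<beta>" "f i = (c, m)" using fsurj by blast
      have ge: "(c, fst (f k)) \<in> \<beta> \<and> lt \<beta> (fst (f k)) b \<and> snd (f k) \<in> Field d" if k: "(i, k) \<in> \<beta>" for k
      proof -
        have "f k = (c, m) \<or> lt ?P (c, m) (f k)" using fmono[of i k] k i(2) unfolding lt_def by metis
        moreover have "lt ?P (f k) z" using fin[OF le_Field(2)[OF k]] .
        ultimately show ?thesis
          using lots_refl[OF l lt_Field(1)[OF cb]] lt_le[of \<beta> c "fst (f k)"] unfolding below unfolding lt_oprod by auto
      qed
      have Ft: "k \<in> Field (tail ?b c) \<longleftrightarrow> (c, k) \<in> \<beta> \<and> lt \<beta> k b" for k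
        unfolding Field_tail[OF wob] using cb by (auto simp: lt_underS)
      have ltt: "lt (tail ?b c) j k \<longleftrightarrow> lt \<beta> j k \<and> (c, j) \<in> \<beta> \<and> (c, k) \<in> \<beta> \<and> lt \<beta> j b \<and> lt \<beta> k b" for j k
        unfolding lt_tail using cb by (auto simp: lt_underS ltb)
      have "tail \<beta> i \<le>o oprod (tail ?b c) d"
      proof (rule strict_mono_ordLeq[OF Well_order_tail[OF wo] Well_order_oprod[OF Well_order_tail[OF wob] d(1)], of i f])
        show "f k \<in> Field (oprod (tail ?b c) d)" if "k \<in> Field (tail \<beta> i)" for k
          using ge[of k] that unfolding Field_tail[OF wo] Field_oprod[OF ld] by (cases "f k") (simp add: Ft)
        show "lt (oprod (tail ?b c) d) (f j) (f k)" if jk: "lt (tail \<beta> i) j k" for j k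
        proof -
          have "lt ?P (f j) (f k)" "(i, j) \<in> \<beta>" "(i, k) \<in> \<beta>" using jk fmono unfolding lt_tail by blast+
          then show ?thesis using ge[of j] ge[of k] unfolding lt_oprod Ft ltt by auto
        qed
      qed
      then have "\<beta> <o \<beta>"
        using tl[OF i(1)] s bd2 ordLeq_transitive ordLeq_ordLess_trans ordLess_ordLeq_trans by blast
      then show False using ordLess_irreflexive by blast
    qed
    show False
    proof (cases "\<theta> \<le>o ?b")
      case True
      have "oprod ?b d \<le>o ?b" by (rule 1(1)[OF bb wob btl True])
      then have "\<beta> <o \<beta>" using bd1 bb ordLeq_transitive ordLeq_ordLess_trans by blast
      then show False using ordLess_irreflexive by blast
    next
      case False
      then have "?b <o \<theta>" using not_ordLeq_iff_ordLess[OF wob th(1)] by simp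
      then have "oprod ?b d <o oprod \<theta> d" by (rule oprod_strict_mono[OF _ d])
      then have "\<beta> <o \<beta>"
        using bd1 th(3) thb ordLeq_transitive ordLeq_ordLess_trans ordLess_ordLeq_trans by blast
      then show False using ordLess_irreflexive by blast
    qed
  qed
qed

text \<open>The ordinal \<open>d\<^sup>0 + d\<^sup>1 + d\<^sup>2 + \<dots>\<close>, which is countable when \<open>d\<close> is.\<close>

definition finite_seqs :: "'d rel \<Rightarrow> 'd list rel" where
  "finite_seqs d = {(u, v). u \<in> lists (Field d) \<and> v \<in> lists (Field d) \<and> (u = v \<or> (u, v) \<in> lenlex (d - Id))}"

lemma Field_finite_seqs: "Field (finite_seqs d) = lists (Field d)"
  unfolding finite_seqs_def Field_def by auto

lemma lt_finite_seqs: 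
  assumes "Well_order d"
  shows "lt (finite_seqs d) u v \<longleftrightarrow> u \<in> lists (Field d) \<and> v \<in> lists (Field d) \<and> (u, v) \<in> lenlex (d - Id)"
proof -
  have "wf (d - Id)" using assms by (simp add: well_order_on_def)
  then have "(u, u) \<notin> lenlex (d - Id)" using wf_not_refl[OF wf_lenlex] by blast
  then show ?thesis unfolding lt_def finite_seqs_def by auto
qed

lemma Well_order_finite_seqs:
  assumes "Well_order d" shows "Well_order (finite_seqs d)"
proof -
  note l = wo_lots[OF assms]
  have wf: "wf (d - Id)" using assms by (simp add: well_order_on_def)
  have tr: "trans (d - Id)" using lt_trans[OF l] unfolding lt_def trans_def by blast
  have tot: "(u, v) \<in> lenlex (d - Id) \<or> (v, u) \<in> lenlex (d - Id)" 
    if "u \<in> lists (Field d)" "v \<in> lists (Field d)" "u \<noteq> v" for u v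
    using that
  proof (induction u arbitrary: v rule: list.induct)
    case Nil
    then show ?case by simp
  next
    case (Cons x u)
    show ?case
    proof (cases v)
      case v: (Cons y w)
      have "x \<in> Field d" "y \<in> Field d" "u \<in> lists (Field d)" "w \<in> lists (Field d)"
        using Cons.prems v by auto
      then have "(x, y) \<in> d - Id \<or> x = y \<or> (y, x) \<in> d - Id"
          "u = w \<or> (u, w) \<in> lenlex (d - Id) \<or> (w, u) \<in> lenlex (d - Id)"
        using lots_total[OF l, of x y] Cons.IH[of w] by blast+
      then show ?thesis using Cons.prems(3) unfolding v Cons_lenlex_iff by (cases "length u" "length w" rule: linorder_cases) auto
    qed simp
  qed
  have "lots (finite_seqs d)"
  proof (rule lots_ltI)
    show "(a, a) \<in> finite_seqs d" if "a \<in> Field (finite_seqs d)" for a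
      using that unfolding Field_finite_seqs unfolding finite_seqs_def by blast
    show "lt (finite_seqs d) a c" if "lt (finite_seqs d) a b" "lt (finite_seqs d) b c" for a b c
      using that lenlex_trans[OF _ _ tr, of a b c] unfolding lt_finite_seqs[OF assms] by blast
    show "lt (finite_seqs d) a b \<or> lt (finite_seqs d) b a"
      if "a \<in> Field (finite_seqs d)" "b \<in> Field (finite_seqs d)" "a \<noteq> b" for a b
      using that tot unfolding lt_finite_seqs[OF assms] Field_finite_seqs by blast
  qed
  moreover have "wf (finite_seqs d - Id)"
    by (rule wf_subset[OF wf_lenlex[OF wf]]) (auto simp: finite_seqs_def)
  ultimately show ?thesis by (simp add: well_order_on_def)
qed

text \<open>Appending a letter is increasing: the word lengths are compared first, and the new
  letter is compared last. In terms of powers, multiplication by \<open>d\<close> moves each summand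
  to the next one.\<close>

lemma finite_seqs_absorbs:
  assumes d: "Well_order d"
  shows "oprod (finite_seqs d) d \<le>o finite_seqs d"
proof (rule strict_mono_ordLeq[OF Well_order_oprod[OF Well_order_finite_seqs[OF d] d] Well_order_finite_seqs[OF d]])
  let ?f = "\<lambda>z. fst z @ [snd z]"
  show "?f z \<in> Field (finite_seqs d)" if "z \<in> Field (oprod (finite_seqs d) d)" for z
    using that unfolding Field_oprod[OF wo_lots[OF d]] Field_finite_seqs by auto
  fix z w assume zw: "lt (oprod (finite_seqs d) d) z w"
  have app: "(u @ [x], v @ [y]) \<in> lenlex (d - Id)" if "(u, v) \<in> lenlex (d - Id)" for u v x y
    using that unfolding lenlex_conv lex_conv by force
  have app': "(u @ [x], u @ [y]) \<in> lenlex (d - Id)" if "lt d x y" for u x y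
    using that unfolding lenlex_conv lex_conv lt_def by force
  show "lt (finite_seqs d) (?f z) (?f w)"
    using zw app app' unfolding lt_oprod lt_finite_seqs[OF d] Field_finite_seqs by auto
qed

section \<open>Real-bounded orders\<close>

lemma Field_real_lots: "Field real_lots = UNIV"
  unfolding real_lots_def Field_def by auto

lemma lt_real_lots: "lt real_lots x y \<longleftrightarrow> x < y"
  unfolding real_lots_def lt_def by auto

lemma lots_real: "lots real_lots"
  by (rule lots_ltI) (auto simp: lt_real_lots, simp add: real_lots_def)

lemma lots_complete_real: "lots_complete real_lots"
proof (rule lots_completeI[OF lots_real])
  fix A :: "real set" assume A: "A \<noteq> {}" "lots_bounded real_lots A"
  then obtain b where b: "\<And>a. a \<in> A \<Longrightarrow> a \<le> b"
    unfolding lots_bounded_def lots_interval_def real_lots_def by auto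
  then have "bdd_above A" by (rule bdd_aboveI)
  then have "is_sup real_lots A (Sup A)"
    unfolding is_sup_iff Field_real_lots unfolding real_lots_def using A(1) by (auto intro: cSup_upper cSup_least)
  then show "\<exists>s. is_sup real_lots A s" by blast
qed

text \<open>The arctangent is bounded by \<open>pi / 2 < 2\<close> in absolute value, so half of it
  stays between \<open>-1\<close> and \<open>1\<close>.\<close>

lemma real_squash:
  "arctan x / 2 \<in> lots_interval real_lots (-1) 1"
  "lt real_lots x y \<Longrightarrow> lt real_lots (arctan x / 2) (arctan y / 2)"
  using arctan_bounded[of x] pi_less_4 arctan_less_iff[of x y]
  unfolding lots_interval_def lt_real_lots by (auto simp: real_lots_def)

text \<open>Each coordinate is replaced by a block of \<open>d\<close> coordinates. If two points
  first differ at \<open>i\<close>, and their blocks there first differ at \<open>j\<close>, their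
  images first differ at \<open>(i, j)\<close>.\<close>

lemma cube_nested:
  assumes X: "lots X" and X': "lots X'" and b: "Well_order b" and d: "Well_order d"
    and \<psi>: "\<And>x. x \<in> lots_interval X' p' q' \<Longrightarrow> \<psi> x \<in> Field (cube X p q d)"
      "\<And>x y. x \<in> lots_interval X' p' q' \<Longrightarrow> y \<in> lots_interval X' p' q' \<Longrightarrow> lt X' x y \<Longrightarrow> lt (cube X p q d) (\<psi> x) (\<psi> y)"
  shows "injects_into (cube X' p' q' b) (cube X p q (oprod b d))"
proof -
  note ld = wo_lots[OF d]
  note wop = Well_order_oprod[OF b d]
  interpret L: lexprod X' b "\<lambda>_. lots_interval X' p' q'" by (rule lexprod_cube[OF X' b])
  interpret D: lexprod X d "\<lambda>_. lots_interval X p q" by (rule lexprod_cube[OF X d])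
  interpret P: lexprod X "oprod b d" "\<lambda>_. lots_interval X p q" by (rule lexprod_cube[OF X wop])
  have FP: "Field (oprod b d) = Field b \<times> Field d" by (rule Field_oprod[OF ld])
  define F where "F z = (\<lambda>w\<in>Field b \<times> Field d. \<psi> (z (fst w)) (snd w))" for z
  have FF: "F z \<in> PiE (Field (oprod b d)) (\<lambda>_. lots_interval X p q)" if "z \<in> Field b \<rightarrow>\<^sub>E lots_interval X' p' q'" for z
    unfolding F_def FP restrict_PiE_iff
  proof
    fix w assume w: "w \<in> Field b \<times> Field d"
    then have "z (fst w) \<in> lots_interval X' p' q'" using that by auto
    then have "\<psi> (z (fst w)) \<in> PiE (Field d) (\<lambda>_. lots_interval X p q)" using \<psi>(1) unfolding cube_def D.Field_lexp by blast
    then show "\<psi> (z (fst w)) (snd w) \<in> lots_interval X p q" using w by auto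
  qed
  have "order_injection L.Y P.Y F"
  proof (rule order_injectionI[OF L.lots_lexp P.lots_lexp])
    show "F z \<in> Field P.Y" if "z \<in> Field L.Y" for z using that FF unfolding L.Field_lexp P.Field_lexp by blast
    fix z z' assume zz: "lt L.Y z z'"
    then have P: "z \<in> Field b \<rightarrow>\<^sub>E lots_interval X' p' q'" "z' \<in> Field b \<rightarrow>\<^sub>E lots_interval X' p' q'" unfolding L.lt_lexp by blast+
    obtain i where i: "i \<in> Field b" "lt X' (z i) (z' i)" "\<And>k. lt b k i \<Longrightarrow> z k = z' k" by (rule L.lt_lexpE[OF zz]) blast
    have "lt D.Y (\<psi> (z i)) (\<psi> (z' i))" using \<psi>(2)[OF _ _ i(2)] P i(1) unfolding cube_def by blast
    then obtain j where j: "j \<in> Field d" "lt X (\<psi> (z i) j) (\<psi> (z' i) j)" "\<And>k. lt d k j \<Longrightarrow> \<psi> (z i) k = \<psi> (z' i) k"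
      by (rule D.lt_lexpE) blast
    show "lt P.Y (F z) (F z')"
    proof (rule P.lt_lexpI[OF FF[OF P(1)] FF[OF P(2)], of "(i, j)"])
      show "(i, j) \<in> Field (oprod b d)" unfolding FP using i(1) j(1) by blast
      show "lt X (F z (i, j)) (F z' (i, j))" unfolding F_def using i(1) j(1,2) by simp
      fix w assume w: "lt (oprod b d) w (i, j)"
      then have "w \<in> Field b \<times> Field d" using lt_Field(1)[OF w] unfolding FP by blast
      then show "F z w = F z' w" using w i(3) j(3) unfolding F_def lt_oprod by auto
    qed
  qed
  then show ?thesis unfolding injects_into_def cube_def by blast
qed

lemma lt_natLeq: "lt natLeq m n \<longleftrightarrow> m < n"
  unfolding lt_def natLeq_def by auto

text \<open>\<open>x \<mapsto> (r\<^sub>n < x)\<^sub>n\<close>, where \<open>r\<^sub>n\<close> enumerates the rationals, is monotone even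
  coordinatewise.\<close>

lemma real_into_cube:
  assumes X: "lots X" "lt X p q"
  obtains \<psi> :: "real \<Rightarrow> nat \<Rightarrow> 'a" where "\<And>x. \<psi> x \<in> Field (cube X p q natLeq)" "\<And>x y. x < y \<Longrightarrow> lt (cube X p q natLeq) (\<psi> x) (\<psi> y)"
proof -
  define r where "r n = (of_rat (nat_to_rat_surj n) :: real)" for n
  define \<psi> where "\<psi> x n = (if r n < x then q else p)" for x n
  interpret L: lexprod X natLeq "\<lambda>_. lots_interval X p q" by (rule lexprod_cube[OF X(1) natLeq_Well_order])
  have P: "\<psi> x \<in> PiE (Field natLeq) (\<lambda>_. lots_interval X p q)" for x
    using lots_interval_ends[OF X(1) lt_le[OF X(2)]] unfolding \<psi>_def Field_natLeq by auto
  show ?thesis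
  proof (rule that[of \<psi>])
    show "\<psi> x \<in> Field (cube X p q natLeq)" for x unfolding cube_def L.Field_lexp by (rule P)
    fix x y :: real assume xy: "x < y"
    obtain s where s: "x < of_rat s" "of_rat s < y" using of_rat_dense[OF xy] by blast
    obtain n where "s = nat_to_rat_surj n" using surj_nat_to_rat_surj by (metis surjD)
    then have n: "x \<le> r n \<and> r n < y" using s unfolding r_def by simp
    \<comment> \<open>At the first rational that separates \<open>x\<close> from \<open>y\<close>
      the coordinates are \<open>p\<close> and \<open>q\<close>; an earlier rational lies on the
      same side of both, so earlier coordinates coincide.\<close>
    define m where "m = (LEAST n. x \<le> r n \<and> r n < y)"
    have m: "x \<le> r m \<and> r m < y" unfolding m_def by (rule LeastI[of _ n]) (rule n)
    have less: "\<not> (x \<le> r k \<and> r k < y)" if "k < m" for k using that not_less_Least unfolding m_def by blast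
    show "lt (cube X p q natLeq) (\<psi> x) (\<psi> y)" unfolding cube_def
    proof (rule L.lt_lexpI[OF P P, of m])
      show "m \<in> Field natLeq" by (simp add: Field_natLeq)
      show "lt X (\<psi> x m) (\<psi> y m)" unfolding \<psi>_def using m X(2) by simp
      show "\<psi> x k = \<psi> y k" if "lt natLeq k m" for k
        using less[of k] that xy unfolding lt_natLeq \<psi>_def by auto
    qed
  qed
qed

lemma lots_complete_cube:
  assumes "lots X" "lots_complete X" "(p, q) \<in> X" "Well_order r"
  shows "lots_complete (cube X p q r)"
  by (rule lots_completeI[OF lots_cube[OF assms(1,4)]]) (rule cube_sup[OF assms])

theorem completion_tower_bigger:
  fixes X :: "'a rel"
  assumes H: "HLOTS X" and pq: "lt X p q" and R: "R_bounded X"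
  shows "\<exists>\<theta> :: nat rel. Well_order \<theta> \<and>
           (\<forall>(\<alpha> :: 'i rel) (\<beta> :: 'j rel).
              tail_like \<alpha> \<and> tail_like \<beta> \<and> \<beta> <o \<alpha> \<and> \<theta> \<le>o \<beta> \<longrightarrow>
              bigger (lots_completion (tower X p q \<alpha>)) (lots_completion (tower X p q \<beta>)))"
proof -
  note X = HLOTS_lots[OF H] and dX = HLOTS_dense[OF H]
  obtain d :: "nat rel" where d: "Well_order d" "Field d \<noteq> {}" "injects_into X (tower real_lots (-1) 1 d)"
    using R unfolding R_bounded_def by blast
  \<comment> \<open>The larger of \<open>d\<close> and \<omega>: absorbing this one factor covers
    both the bound on \<open>X\<close> and the coding of real numbers.\<close>
  define \<delta> where "\<delta> = (if natLeq \<le>o d then d else natLeq)"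
  have \<delta>: "Well_order \<delta>" "natLeq \<le>o \<delta>" "d \<le>o \<delta>" "Field \<delta> \<noteq> {}"
  proof -
    have "natLeq \<le>o natLeq" "d \<le>o d" using natLeq_Well_order d(1) ordLeq_reflexive by blast+
    moreover have "\<not> natLeq \<le>o d \<Longrightarrow> d \<le>o natLeq" using ordLeq_total[OF natLeq_Well_order d(1)] by blast
    ultimately show "Well_order \<delta>" "natLeq \<le>o \<delta>" "d \<le>o \<delta>" "Field \<delta> \<noteq> {}"
      unfolding \<delta>_def using d natLeq_Well_order Field_natLeq by auto
  qed
  have m11: "(-1, 1) \<in> real_lots" by (simp add: real_lots_def)
  note Rl = lots_real lots_complete_real
  have "injects_into (tower real_lots (-1) 1 d) (cube real_lots (-1) 1 d)"
    by (rule tower_into_cube[OF Rl(1) real_squash d(1)])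
  moreover have "injects_into (cube real_lots (-1) 1 d) (cube real_lots (-1) 1 \<delta>)"
    by (rule cube_mono[OF Rl(1) m11 \<delta>(3) d(1) \<delta>(1)])
  ultimately have "injects_into X (cube real_lots (-1) 1 \<delta>)"
    using injects_into_trans[OF X d(3)] injects_into_trans[OF X] by blast
  then obtain \<psi> where \<psi>: "order_injection X (cube real_lots (-1) 1 \<delta>) \<psi>" unfolding injects_into_def by blast
  obtain \<phi> :: "real \<Rightarrow> nat \<Rightarrow> 'a" where \<phi>: "\<And>x. \<phi> x \<in> Field (cube X p q natLeq)"
      "\<And>x y. x < y \<Longrightarrow> lt (cube X p q natLeq) (\<phi> x) (\<phi> y)"
    by (rule real_into_cube[OF X pq]) blast
  obtain sq where sq': "\<And>x. x \<in> Field X \<Longrightarrow> sq x \<in> aboveS X p \<inter> underS X q" "\<And>x y. lt X x y \<Longrightarrow> lt X (sq x) (sq y)"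
    using HLOTS_squash[OF H pq] by blast
  have sq: "sq x \<in> lots_interval X p q" if "x \<in> Field X" for x
    using sq'(1)[OF that] unfolding lots_interval_def by (simp add: aboveS_def underS_def)
  \<comment> \<open>The threshold must be a relation on \<open>nat\<close>, so the order of finite
    sequences is transported along an enumeration of lists.\<close>
  define \<theta> where "\<theta> = dir_image (finite_seqs \<delta>) (to_nat :: nat list \<Rightarrow> nat)"
  have wof: "Well_order (finite_seqs \<delta>)" by (rule Well_order_finite_seqs[OF \<delta>(1)])
  have iso: "finite_seqs \<delta> =o \<theta>" unfolding \<theta>_def by (rule dir_image_ordIso[OF wof]) (simp add: inj_on_def)
  have "Well_order \<theta>" using iso unfolding ordIso_def by blast
  moreover have "bigger (lots_completion (tower X p q \<alpha>)) (lots_completion (tower X p q \<beta>))"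
    if "tail_like \<alpha>" "tail_like \<beta>" and ba: "\<beta> <o \<alpha>" and tb: "\<theta> \<le>o \<beta>" for \<alpha> :: "'i rel" and \<beta> :: "'j rel"
  proof -
    have wo: "Well_order \<alpha>" "Well_order \<beta>" using ba unfolding ordLess_def by auto
    have "finite_seqs \<delta> \<le>o \<beta>" using iso tb ordIso_ordLeq_trans by blast
    moreover have "Field (finite_seqs \<delta>) \<noteq> {}" unfolding Field_finite_seqs by blast
    ultimately have abs: "oprod \<beta> \<delta> \<le>o \<beta>"
      using tail_like_absorbs[OF wof _ finite_seqs_absorbs[OF \<delta>(1)] \<delta>(1,4) wo(2) tail_like_tail[OF that(2)]] by blast
    have "oprod \<beta> natLeq \<le>o oprod \<beta> \<delta>" by (rule oprod_mono[OF ordLeq_reflexive[OF wo(2)] \<delta>(2)])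
    then have abs': "oprod \<beta> natLeq \<le>o \<beta>" using abs ordLeq_transitive by blast
    let ?A = "tower X p q \<alpha>" and ?B = "tower X p q \<beta>"
    have lA: "lots ?A" "order_dense ?A" using lots_tower[OF X wo(1)] order_dense_tower[OF X wo(1) dX] by blast+
    have lB: "lots ?B" "order_dense ?B" using lots_tower[OF X wo(2)] order_dense_tower[OF X wo(2) dX] by blast+
    note cA = completion_lots[OF lA]
    have AA: "injects_into ?A (lots_completion ?A)" using cA(4) unfolding injects_into_def by blast
    have "injects_into ?B ?A" by (rule tower_into_tower[OF X lt_le[OF pq] sq sq'(2) ordLess_imp_ordLeq[OF ba]])
    then have "injects_into ?B (lots_completion ?A)" using AA injects_into_trans[OF lB(1)] by blast
    then have inj: "injects_into (lots_completion ?B) (lots_completion ?A)"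
      using completion_injects[OF lB cA(1,2)] by blast
    \<comment> \<open>Coordinates in \<open>X\<close> are expanded into real cubes of height
      \<delta>, and the product height is absorbed by \<beta>. The target is complete, so the
      embedding extends to the completion.\<close>
    have "injects_into ?B (cube X p q \<beta>)" by (rule tower_into_cube[OF X sq sq'(2) wo(2)])
    moreover have "injects_into (cube X p q \<beta>) (cube real_lots (-1) 1 (oprod \<beta> \<delta>))"
      by (rule cube_nested[OF Rl(1) X wo(2) \<delta>(1), where \<psi> = \<psi>])
        (use order_injection_Field[OF X \<psi>] order_injectionD(1)[OF \<psi>] lots_interval_Field[of X p q] in blast)+
    moreover have "injects_into (cube real_lots (-1) 1 (oprod \<beta> \<delta>)) (cube real_lots (-1) 1 \<beta>)"
      by (rule cube_mono[OF Rl(1) m11 abs Well_order_oprod[OF wo(2) \<delta>(1)] wo(2)])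
    ultimately have "injects_into ?B (cube real_lots (-1) 1 \<beta>)"
      using injects_into_trans[OF lB(1)] by metis
    then have B: "injects_into (lots_completion ?B) (cube real_lots (-1) 1 \<beta>)"
      using completion_injects[OF lB lots_cube[OF Rl(1) wo(2)] lots_complete_cube[OF Rl m11 wo(2)]] by blast
    \<comment> \<open>Conversely each real coordinate is coded by \<omega> coordinates in
      \<open>{p, q}\<close>. This is the map from the real cube to the cube over \<open>X\<close>
      required by the fixed point argument.\<close>
    have "injects_into (cube real_lots (-1) 1 \<beta>) (cube X p q (oprod \<beta> natLeq))"
      by (rule cube_nested[OF X Rl(1) wo(2) natLeq_Well_order, where \<psi> = \<phi>])
        (use \<phi> in \<open>simp_all add: lt_real_lots\<close>)
    moreover have "injects_into (cube X p q (oprod \<beta> natLeq)) (cube X p q \<beta>)"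
      by (rule cube_mono[OF X lt_le[OF pq] abs' Well_order_oprod[OF wo(2) natLeq_Well_order] wo(2)])
    ultimately have "injects_into (cube real_lots (-1) 1 \<beta>) (cube X p q \<beta>)"
      using injects_into_trans[OF lots_cube[OF Rl(1) wo(2)]] by metis
    then have "\<not> injects_into ?A (cube real_lots (-1) 1 \<beta>)"
      by (rule tower_not_into_cube[OF X pq Rl m11 ba])
    then have "\<not> injects_into (lots_completion ?A) (lots_completion ?B)"
      using injects_into_trans[OF lA(1) AA] injects_into_trans[OF lA(1) _ B] by blast
    then show ?thesis using inj unfolding bigger_def by blast
  qed
  ultimately show ?thesis by blast
qed

section \<open>Homogeneity of towers\<close>

text \<open>Serves the ordinal 1, where the tower is a relabelled copy of \<open>X\<close> on
  another type.\<close>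

lemma HLOTS_transfer:
  assumes H: "HLOTS r" and s: "lots s" and f: "f ` Field r = Field s" "\<And>x y. lt r x y \<Longrightarrow> lt s (f x) (f y)"
  shows "HLOTS s"
proof -
  note r = HLOTS_lots[OF H]
  have inj: "inj_on f (Field r)" by (rule strict_mono_inj[OF r f(2)])
  have refl: "lt r x y \<longleftrightarrow> lt s (f x) (f y)" if "x \<in> Field r" "y \<in> Field r" for x y
    using strict_mono_reflect[OF r s, of f x y] f(2) that by blast
  have cont: "continuous_map (lots_topology r) (lots_topology s) f"
    unfolding lots_topology_def[of s]
  proof (rule continuous_on_generated_topo)
    fix U assume "U \<in> {Field s} \<union> underS s ` Field s \<union> aboveS s ` Field s"
    then consider "U = Field s" | b where "b \<in> Field r" "U = underS s (f b)" | b where "b \<in> Field r" "U = aboveS s (f b)"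
      unfolding f(1)[symmetric] by blast
    then show "openin (lots_topology r) (f -` U \<inter> topspace (lots_topology r))"
    proof cases
      case 1
      then have "f -` U \<inter> topspace (lots_topology r) = topspace (lots_topology r)"
        using f(1) unfolding topspace_lots_topology by blast
      then show ?thesis by simp
    next
      case 2
      have "f -` U \<inter> topspace (lots_topology r) = underS r b"
        using refl[OF _ 2(1)] f(2)[of _ b] lt_Field(1)[of r _ b] unfolding topspace_lots_topology 2(2) by (auto simp: lt_underS)
      then show ?thesis using openin_underS[OF 2(1)] by simp
    next
      case 3
      have "f -` U \<inter> topspace (lots_topology r) = aboveS r b"
        using refl[OF 3(1)] f(2)[of b] lt_Field(2)[of r b] unfolding topspace_lots_topology 3(2) by (auto simp: lt_aboveS)
      then show ?thesis using openin_aboveS[OF 3(1)] by simp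
    qed
  qed (use f(1) in \<open>auto simp: topspace_lots_topology\<close>)
  have 1: "oiso r (Field r) s (Field s)" unfolding oiso_def using f by blast
  have "oiso s (Field s) s C" if C: "openin (lots_topology s) C" "lots_convex s C" "C \<noteq> {}" for C
  proof -
    define C' where "C' = {x\<in>Field r. f x \<in> C}"
    have CF: "C \<subseteq> Field s" using C(2) unfolding lots_convex_def by blast
    have "openin (lots_topology r) C'"
      using openin_continuous_map_preimage[OF cont C(1)] unfolding C'_def topspace_lots_topology .
    moreover have "lots_convex r C'"
    proof (rule lots_convexI[OF r])
      show "C' \<subseteq> Field r" unfolding C'_def by blast
      show "x \<in> C'" if "a \<in> C'" "b \<in> C'" "lt r a x" "lt r x b" for a b x
        using lots_convex_lt[OF C(2) _ _ f(2)[OF that(3)] f(2)[OF that(4)]] that(1,2) lt_Field(1)[OF that(4)]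
        unfolding C'_def by blast
    qed
    moreover have C'C: "f ` C' = C" using CF unfolding f(1)[symmetric] C'_def by auto
    then have "C' \<noteq> {}" using C(3) by blast
    ultimately have "oiso r (Field r) r C'" by (rule HLOTS_oiso[OF H])
    moreover have "oiso r C' s C" unfolding oiso_def using C'C f(2) by blast
    ultimately show ?thesis
      using oiso_trans[OF oiso_sym[OF r s _ 1]] oiso_trans by blast
  qed
  moreover have "\<exists>a\<in>Field s. \<exists>b\<in>Field s. \<exists>c\<in>Field s. a \<noteq> b \<and> a \<noteq> c \<and> b \<noteq> c"
  proof -
    obtain a b c where abc: "a \<in> Field r" "b \<in> Field r" "c \<in> Field r" "a \<noteq> b" "a \<noteq> c" "b \<noteq> c"
      using H unfolding HLOTS_def by blast
    then have "f a \<noteq> f b" "f a \<noteq> f c" "f b \<noteq> f c" using inj unfolding inj_on_def by blast+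
    then show ?thesis using abc f(1) by blast
  qed
  ultimately show ?thesis unfolding HLOTS_iff using s by blast
qed

section \<open>Half-open and open intervals, and reversal of towers\<close>

definition ico :: "'a rel \<Rightarrow> 'a \<Rightarrow> 'a \<Rightarrow> 'a set" where
  "ico r x y = {z. (x, z) \<in> r \<and> lt r z y}"

definition ooi :: "'a rel \<Rightarrow> 'a \<Rightarrow> 'a \<Rightarrow> 'a set" where
  "ooi r x y = {z. lt r x z \<and> lt r z y}"

lemma ico_Field: "ico r x y \<subseteq> Field r"
  using lt_Field(1)[of r] unfolding ico_def by blast

lemma ooi_Field: "ooi r x y \<subseteq> Field r"
  using lt_Field(1)[of r] unfolding ooi_def by blast

lemma ico_UN:
  fixes x :: "nat \<Rightarrow> 'a"
  assumes r: "lots r" and x: "\<And>n. (x n, x (Suc n)) \<in> r" "\<And>n. (x n, b) \<in> r" and cof: "\<And>z. lt r z b \<Longrightarrow> \<exists>n. lt r z (x n)"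
  shows "ico r (x 0) b = (\<Union>n. ico r (x n) (x (Suc n)))"
proof (intro equalityI subsetI)
  fix z assume z: "z \<in> ico r (x 0) b"
  \<comment> \<open>The block of \<open>z\<close> ends at the first term above \<open>z\<close>.
    That is not the initial term, because \<open>x 0 <= z\<close>.\<close>
  define n where "n = (LEAST n. lt r z (x n))"
  obtain k where "lt r z (x k)" using cof z unfolding ico_def by blast
  then have n: "lt r z (x n)" unfolding n_def by (rule LeastI)
  have "n \<noteq> 0" using n z lt_not_le[OF r] unfolding ico_def by (metis mem_Collect_eq)
  then obtain m where m: "n = Suc m" using not0_implies_Suc by blast
  have "\<not> lt r z (x m)" using not_less_Least[of m "\<lambda>n. lt r z (x n)"] m unfolding n_def by simp
  then have "(x m, z) \<in> r" using not_lt_le[OF r lt_Field(1)[OF n] le_Field(1)[OF x(2)]] by blast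
  then show "z \<in> (\<Union>n. ico r (x n) (x (Suc n)))" using n m unfolding ico_def by blast
next
  fix z assume "z \<in> (\<Union>n. ico r (x n) (x (Suc n)))"
  then obtain n where z: "(x n, z) \<in> r" "lt r z (x (Suc n))" unfolding ico_def by blast
  have "(x 0, x n) \<in> r"
  proof (induction n)
    case 0 show ?case using lots_refl[OF r le_Field(1)[OF x(1)]] .
  next
    case (Suc n) show ?case using lots_trans[OF r Suc x(1)] .
  qed
  then show "z \<in> ico r (x 0) b"
    using lots_trans[OF r _ z(1)] lt_le_trans[OF r z(2) x(2)] unfolding ico_def by blast
qed

lemma HLOTS_ooi_iso:
  assumes "HLOTS r" "lt r x y" "lt r x' y'" shows "oiso r (ooi r x y) r (ooi r x' y')"
proof -
  note r = HLOTS_lots[OF assms(1)]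
  have *: "oiso r (Field r) r (ooi r x y)" if xy: "lt r x y" for x y
  proof (rule HLOTS_oiso[OF assms(1)])
    have eq: "ooi r x y = aboveS r x \<inter> underS r y" unfolding ooi_def by (auto simp: lt_aboveS lt_underS)
    show "openin (lots_topology r) (ooi r x y)"
      unfolding eq by (intro openin_Int openin_aboveS openin_underS lt_Field[OF xy])
    show "lots_convex r (ooi r x y)"
      using aboveS_convex[OF r, of x] underS_convex[OF r, of y] unfolding eq lots_convex_def by blast
    show "ooi r x y \<noteq> {}" using order_denseE[OF HLOTS_dense[OF assms(1)] xy] unfolding ooi_def by blast
  qed
  show ?thesis by (rule oiso_trans[OF oiso_sym[OF r r order_refl *[OF assms(2)]] *[OF assms(3)]])
qed

text \<open>A half-open interval is an open one with a first point in front, and all open intervals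
  are copies of the whole order.\<close>

lemma HLOTS_ico_iso:
  assumes "HLOTS r" "lt r x y" "lt r x' y'" shows "oiso r (ico r x y) r (ico r x' y')"
proof -
  note r = HLOTS_lots[OF assms(1)]
  have eq: "ico r x y = {x} \<union> ooi r x y" if "lt r x y" for x y
    using that lots_refl[OF r lt_Field(1)[OF that]] lt_le[of r x] unfolding ico_def ooi_def lt_def by blast
  have "oiso r {x} r {x'}" unfolding oiso_def by (intro exI[of _ "\<lambda>_. x'"]) simp
  then show ?thesis unfolding eq[OF assms(2)] eq[OF assms(3)]
    by (intro oiso_Un[OF r]) (auto simp: ooi_def HLOTS_ooi_iso[OF assms, unfolded ooi_def])
qed

lemma tower_coord_converse: "tower_coord (X\<inverse>) q p r = tower_coord X p q r"
  unfolding tower_coord_def lots_interval_def by (rule ext) auto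

lemma lexp_converse: "lexp (X\<inverse>) r S = (lexp X r S)\<inverse>"
proof -
  have "(\<exists>i\<in>Field r. x i \<noteq> y i \<and> (\<forall>j\<in>underS r i. x j = y j) \<and> (x i, y i) \<in> X\<inverse>) \<longleftrightarrow>
    (\<exists>i\<in>Field r. y i \<noteq> x i \<and> (\<forall>j\<in>underS r i. y j = x j) \<and> (y i, x i) \<in> X)" for x y
    unfolding converse_iff by (intro bex_cong refl conj_cong ball_cong) auto
  then show ?thesis unfolding lexp_def lex_power_def by auto
qed

lemma ico_Un: "lots r \<Longrightarrow> lt r a b \<Longrightarrow> lt r b c \<Longrightarrow> ico r a c = ico r a b \<union> ico r b c"
proof (intro equalityI subsetI)
  fix z assume r: "lots r" "lt r a b" "lt r b c"
  { assume z: "z \<in> ico r a c"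
    then show "z \<in> ico r a b \<union> ico r b c"
      using not_lt_le[OF r(1) lt_Field(1)[of r z c] lt_Field(1)[OF r(3)]] unfolding ico_def by blast }
  { assume z: "z \<in> ico r a b \<union> ico r b c"
    then show "z \<in> ico r a c"
      using lt_trans[OF r(1) _ r(3)] lots_trans[OF r(1) lt_le[OF r(2)]] unfolding ico_def by blast }
qed

lemma ico_lt: "lots r \<Longrightarrow> (b, c) \<in> r \<Longrightarrow> x \<in> ico r a b \<Longrightarrow> y \<in> ico r c d \<Longrightarrow> lt r x y"
  using lt_le_trans[of r x b c] lt_le_trans[of r x c y] unfolding ico_def by blast

lemma ico_converse: "ico (r\<inverse>) a b = {z. lt r b z \<and> (z, a) \<in> r}"
  unfolding ico_def by auto

text \<open>Tail-like ordinals without a last index; the remaining one, the ordinal 1, is treated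
  separately. All hypotheses survive reversing \<open>X\<close> and exchanging \<open>p\<close> and
  \<open>q\<close>, so every result inside has a mirror image.\<close>

locale long_tower =
  fixes X :: "'a rel" and p q :: 'a and r :: "'i rel"
  assumes HX: "HLOTS X" and pq: "lt X p q" and wo: "Well_order r" and ne: "Field r \<noteq> {}"
    and tl: "\<And>i. i \<in> Field r \<Longrightarrow> r \<le>o tail r i" and nomax: "\<And>i. i \<in> Field r \<Longrightarrow> \<exists>j. lt r i j"
    and countable: "countable (Field r)"
begin

lemmas lX = HLOTS_lots[OF HX]
lemmas dX = HLOTS_dense[OF HX]
lemmas lr = wo_lots[OF wo]

abbreviation "J \<equiv> lots_interval X p q"
abbreviation "T \<equiv> tower_coord X p q r"
abbreviation "PP \<equiv> PiE (Field r) T"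

sublocale L: lexprod X r T
  by (rule lexprod_tower[OF lX wo])

abbreviation "Y \<equiv> lexp X r T"

lemmas lY = L.lots_lexp
lemmas FY = L.Field_lexp

lemma dual: "long_tower (X\<inverse>) q p r"
  using HLOTS_converse[OF HX] pq wo ne tl nomax countable by unfold_locales auto

lemma T_pos: "lt r k i \<Longrightarrow> T i = J"
  unfolding tower_coord_def by auto

lemma J_T: "J \<subseteq> T i"
  by (rule interval_tower_coord)

lemma pJ: "p \<in> J" "q \<in> J"
  using lots_interval_ends[OF lX lt_le[OF pq]] by blast+

lemma T_ico:
  assumes "x \<in> T i" "y \<in> T i" shows "ico X x y \<subseteq> T i"
proof (cases "\<exists>k. lt r k i")
  case True
  then have "(p, x) \<in> X" "(y, q) \<in> X" using assms unfolding tower_coord_def lots_interval_def by auto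
  then have "(p, z) \<in> X \<and> (z, q) \<in> X" if "z \<in> ico X x y" for z
    using that lots_trans[OF lX _ lt_le[of X z y]] lots_trans[OF lX, of p x z] lots_trans[OF lX, of z y q]
      lt_le[of X z y] unfolding ico_def by blast
  then show ?thesis using True unfolding tower_coord_def lots_interval_def by auto
next
  case False
  then show ?thesis using ico_Field[of X x y] unfolding tower_coord_def by auto
qed

lemma PP_T: "z \<in> PP \<Longrightarrow> i \<in> Field r \<Longrightarrow> z i \<in> T i"
  by blast

lemma PP_J: "z \<in> PP \<Longrightarrow> lt r k i \<Longrightarrow> z i \<in> J"
  using PP_T[of z i] T_pos[of k i] lt_Field(2)[of r k i] by simp

lemma lt_YI:
  assumes "x \<in> PP" "y \<in> PP" "lt X (x i) (y i)" "\<And>k. lt r k i \<Longrightarrow> x k = y k" "i \<in> Field r"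
  shows "lt Y x y"
  by (rule L.lt_lexpI[OF assms(1,2,5,3,4)])

text \<open>A final segment embeds into \<open>r\<close>, and the tail condition gives the opposite
  comparison, so all final segments are isomorphic to \<open>r\<close> and to each other. Such an
  isomorphism takes the least index to the least index.\<close>

lemma tail_iso:
  assumes "i \<in> Field r" "i' \<in> Field r"
  obtains \<sigma> where "bij_betw \<sigma> {k. (i, k) \<in> r} {k. (i', k) \<in> r}"
    "\<And>j k. lt r j k \<Longrightarrow> (i, j) \<in> r \<Longrightarrow> lt r (\<sigma> j) (\<sigma> k)" "\<sigma> i = i'"
proof -
  have inc: "tail r j \<le>o r" for j
    by (rule strict_mono_ordLeq[OF Well_order_tail[OF wo] wo, of j "\<lambda>x. x"])
      (auto simp: Field_tail[OF wo] lt_tail le_Field(2))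
  have "tail r i \<le>o tail r i'" "tail r i' \<le>o tail r i"
    using ordLeq_transitive[OF inc tl] assms by blast+
  then have "tail r i =o tail r i'" using ordIso_iff_ordLeq by blast
  then obtain \<sigma> where \<sigma>: "iso (tail r i) (tail r i') \<sigma>" unfolding ordIso_def by blast
  have emb: "embed (tail r i) (tail r i') \<sigma>" and bij: "bij_betw \<sigma> {k. (i, k) \<in> r} {k. (i', k) \<in> r}"
    using \<sigma> unfolding iso_def Field_tail[OF wo] by blast+
  have inj: "order_injection (tail r i) (tail r i') \<sigma>" unfolding order_injection_def
    using embed_compat[OF emb] bij by (simp add: bij_betw_def Field_tail[OF wo])
  have mono: "lt r (\<sigma> j) (\<sigma> k)" if "lt r j k" "(i, j) \<in> r" for j k
    using order_injectionD(1)[OF inj, of j k] that lots_trans[OF lr that(2) lt_le[OF that(1)]] unfolding lt_tail by blast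
  have "\<sigma> i = i'"
  proof -
    have ii: "(i, i) \<in> r" "(i', i') \<in> r" using lots_refl[OF lr] assms by blast+
    then have "\<sigma> i \<in> {k. (i', k) \<in> r}" "i' \<in> \<sigma> ` {k. (i, k) \<in> r}" using bij unfolding bij_betw_def by blast+
    then obtain k where k: "(i, k) \<in> r" "\<sigma> k = i'" "(i', \<sigma> i) \<in> r" by blast
    show ?thesis
    proof (cases "i = k")
      case False
      then have "lt r (\<sigma> i) (\<sigma> k)" using mono[OF _ ii(1)] k(1) unfolding lt_def by blast
      then show ?thesis using k lt_not_le[OF lr] by blast
    qed (use k in simp)
  qed
  then show ?thesis using that bij mono by blast
qed

section \<open>Cells: cylinders with prescribed prefix and one restricted coordinate\<close>

definition cell :: "('i \<Rightarrow> 'a) \<Rightarrow> 'i \<Rightarrow> 'a set \<Rightarrow> ('i \<Rightarrow> 'a) set" where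
  "cell u i B = {z\<in>PP. (\<forall>k. lt r k i \<longrightarrow> z k = u k) \<and> z i \<in> B}"

lemma cell_lt:
  assumes "i \<in> Field r" "\<And>x y. x \<in> B \<Longrightarrow> y \<in> B' \<Longrightarrow> lt X x y" "z \<in> cell u i B" "w \<in> cell u i B'"
  shows "lt Y z w"
  using assms(2-4) unfolding cell_def by (intro lt_YI[OF _ _ _ _ assms(1)]) auto

lemma cell_UN: "cell u i (\<Union>n\<in>I. B n) = (\<Union>n\<in>I. cell u i (B n))"
  unfolding cell_def by blast

lemma cell_Un: "cell u i (B \<union> B') = cell u i B \<union> cell u i B'"
  unfolding cell_def by blast

text \<open>The prefix \<open>u\<close> is exchanged for \<open>u'\<close>, the coordinate at
  \<open>i\<close> is moved by \<open>\<phi>\<close>, and later coordinates are shifted along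
  \<open>\<sigma>\<close>, an isomorphism of the final segments. The shift respects ranges, since
  coordinates after the first one all lie in the interval \<open>J\<close>.\<close>

lemma cell_iso:
  assumes u: "u \<in> PP" "u' \<in> PP" and i: "i \<in> Field r" "i' \<in> Field r" and B: "B \<subseteq> T i" "B' \<subseteq> T i'" "oiso X B X B'"
  shows "oiso Y (cell u i B) Y (cell u' i' B')"
proof -
  obtain \<sigma> where \<sigma>: "bij_betw \<sigma> {k. (i', k) \<in> r} {k. (i, k) \<in> r}"
    "\<And>j k. lt r j k \<Longrightarrow> (i', j) \<in> r \<Longrightarrow> lt r (\<sigma> j) (\<sigma> k)" "\<sigma> i' = i"
    by (rule tail_iso[OF i(2,1)]) blast
  obtain \<phi> where \<phi>: "\<phi> ` B = B'" "\<And>x y. x \<in> B \<Longrightarrow> y \<in> B \<Longrightarrow> lt X x y \<Longrightarrow> lt X (\<phi> x) (\<phi> y)"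
    using B(3) unfolding oiso_def by blast
  have refl: "(i', i') \<in> r" "(i, i) \<in> r" using lots_refl[OF lr] i by blast+
  have \<sigma>gt: "lt r i (\<sigma> k)" if "lt r i' k" for k using \<sigma>(2)[OF that refl(1)] \<sigma>(3) by simp
  have tri: "lt r k j \<or> k = j \<or> lt r j k" if "k \<in> Field r" "j \<in> Field r" for k j
    using lt_cases[OF lr that] by blast
  have as: "\<not> lt r j k" if "lt r k j" for j k using lt_asym[OF lr that] .
  define g where "g z = (\<lambda>k\<in>Field r. if lt r k i' then u' k else if k = i' then \<phi> (z i) else z (\<sigma> k))" for z
  have g1: "g z k = u' k" if "lt r k i'" for z k using that lt_Field(1)[OF that] unfolding g_def by simp
  have g2: "g z i' = \<phi> (z i)" for z using i(2) unfolding g_def by simp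
  have g3: "g z k = z (\<sigma> k)" if "lt r i' k" for z k
    using that lt_Field(2)[OF that] as[OF that] unfolding g_def by auto
  have gcell: "g z \<in> cell u' i' B'" if z: "z \<in> cell u i B" for z
  proof -
    have zP: "z \<in> PP" "z i \<in> B" using z unfolding cell_def by blast+
    have "g z k \<in> T k" if k: "k \<in> Field r" for k
    proof -
      consider "lt r k i'" | "k = i'" | "lt r i' k" using tri[OF k i(2)] by blast
      then show ?thesis
      proof cases
        case 1 then show ?thesis using g1 PP_T[OF u(2) k] by simp
      next
        case 2 then show ?thesis using g2 zP(2) \<phi>(1) B(2) by auto
      next
        case 3 then show ?thesis using g3 PP_J[OF zP(1) \<sigma>gt[OF 3]] J_T by auto
      qed
    qed
    then have "g z \<in> PP" unfolding g_def by (simp add: PiE_def Pi_def)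
    then show ?thesis using g1 g2 zP(2) \<phi>(1) unfolding cell_def by auto
  qed
  show ?thesis unfolding oiso_def
  proof (intro exI[of _ g] conjI ballI impI equalityI subsetI)
    show "w \<in> cell u' i' B'" if "w \<in> g ` cell u i B" for w using that gcell by blast
  next
    fix z w assume zw: "z \<in> cell u i B" "w \<in> cell u i B" "lt Y z w"
    obtain m where m: "m \<in> Field r" "lt X (z m) (w m)" "\<And>k. lt r k m \<Longrightarrow> z k = w k" by (rule L.lt_lexpE[OF zw(3)]) blast
    have P: "g z \<in> PP" "g w \<in> PP" using gcell zw unfolding cell_def by blast+
    have zwB: "z i \<in> B" "w i \<in> B" "\<And>k. lt r k i \<Longrightarrow> z k = w k" using zw unfolding cell_def by auto
    have "\<not> lt r m i" using zwB(3)[of m] m(2) by auto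
    then consider "m = i" | "lt r i m" using tri[OF m(1) i(1)] by blast
    then show "lt Y (g z) (g w)"
    proof cases
      case 1
      show ?thesis
        by (rule lt_YI[OF P _ _ i(2)]) (use g1 g2 \<phi>(2)[OF zwB(1,2)] m(2) 1 in auto)
    next
      case 2
      have "m \<in> \<sigma> ` {k. (i', k) \<in> r}" using \<sigma>(1) lt_le[OF 2] unfolding bij_betw_def by blast
      then obtain k where k: "(i', k) \<in> r" "m = \<sigma> k" by blast
      then have k': "lt r i' k" using 2 \<sigma>(3) unfolding lt_def by auto
      show ?thesis
      proof (rule lt_YI[OF P _ _ lt_Field(2)[OF k']])
        show "lt X (g z k) (g w k)" using g3[OF k'] m(2) k(2) by simp
        fix j assume j: "lt r j k"
        consider "lt r j i'" | "j = i'" | "lt r i' j" using tri[OF lt_Field(1)[OF j] i(2)] by blast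
        then show "g z j = g w j"
        proof cases
          case 1 then show ?thesis using g1 by simp
        next
          case c: 2 then show ?thesis using g2 m(3)[OF 2] by simp
        next
          case 3 then show ?thesis using g3[OF 3] m(3) \<sigma>(2)[OF j lt_le[OF 3]] k(2) by simp
        qed
      qed
    qed
  next
    fix w assume w: "w \<in> cell u' i' B'"
    then have wP: "w \<in> PP" "\<And>k. lt r k i' \<Longrightarrow> w k = u' k" "w i' \<in> B'" unfolding cell_def by blast+
    have "w i' \<in> \<phi> ` B" using wP(3) \<phi>(1) by simp
    then obtain b where b: "b \<in> B" "\<phi> b = w i'" by auto
    define \<tau> where "\<tau> = inv_into {k. (i', k) \<in> r} \<sigma>"
    have \<tau>\<sigma>: "\<tau> (\<sigma> k) = k" if "(i', k) \<in> r" for k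
      using \<sigma>(1) that unfolding \<tau>_def bij_betw_def by (simp add: inv_into_f_f)
    have \<sigma>\<tau>: "(i', \<tau> k) \<in> r" "\<sigma> (\<tau> k) = k" if "(i, k) \<in> r" for k
    proof -
      have "k \<in> \<sigma> ` {k. (i', k) \<in> r}" using \<sigma>(1) that unfolding bij_betw_def by blast
      then show "(i', \<tau> k) \<in> r" "\<sigma> (\<tau> k) = k"
        using inv_into_into[of k \<sigma> "{k. (i', k) \<in> r}"] f_inv_into_f[of k \<sigma> "{k. (i', k) \<in> r}"] unfolding \<tau>_def by auto
    qed
    have \<tau>gt: "lt r i' (\<tau> k)" if "lt r i k" for k
      using \<sigma>\<tau>[OF lt_le[OF that]] \<sigma>(3) that unfolding lt_def by auto
    define z where "z = (\<lambda>k\<in>Field r. if lt r k i then u k else if k = i then b else w (\<tau> k))"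
    have z1: "z k = u k" if "lt r k i" for k using that lt_Field(1)[OF that] unfolding z_def by simp
    have z2: "z i = b" using i(1) unfolding z_def by simp
    have z3: "z k = w (\<tau> k)" if "lt r i k" for k
      using that lt_Field(2)[OF that] as[OF that] unfolding z_def by auto
    have "z k \<in> T k" if k: "k \<in> Field r" for k
    proof -
      consider "lt r k i" | "k = i" | "lt r i k" using tri[OF k i(1)] by blast
      then show ?thesis
      proof cases
        case 1 then show ?thesis using z1 PP_T[OF u(1) k] by simp
      next
        case 2 then show ?thesis using z2 b(1) B(1) by auto
      next
        case 3 then show ?thesis using z3 PP_J[OF wP(1) \<tau>gt[OF 3]] J_T by auto
      qed
    qed
    then have "z \<in> PP" unfolding z_def by (simp add: PiE_def Pi_def)
    then have zc: "z \<in> cell u i B" using z1 z2 b(1) unfolding cell_def by auto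
    have "g z = w"
    proof (rule PiE_ext)
      show "g z \<in> PP" using gcell[OF zc] unfolding cell_def by blast
      show "w \<in> PP" by (rule wP(1))
      fix k assume k: "k \<in> Field r"
      consider "lt r k i'" | "k = i'" | "lt r i' k" using tri[OF k i(2)] by blast
      then show "g z k = w k"
      proof cases
        case 1 then show ?thesis using g1 wP(2) by simp
      next
        case 2 then show ?thesis using g2 z2 b(2) by simp
      next
        case 3 then show ?thesis using g3[OF 3] z3[OF \<sigma>gt[OF 3]] \<tau>\<sigma>[OF lt_le[OF 3]] by simp
      qed
    qed
    then show "w \<in> g ` cell u i B" using zc by blast
  qed
qed

lemma cell_sub: "cell u i B \<subseteq> Field Y"
  unfolding cell_def FY by blast

text \<open>Since \<open>r\<close> is tail-like, the final segments of \<open>r\<close> are isomorphic to \<open>r\<close>, and hence all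
  half-open cells are isomorphic, wherever they occur.\<close>

definition isK :: "('i \<Rightarrow> 'a) set \<Rightarrow> bool" where
  "isK E \<longleftrightarrow> E \<subseteq> Field Y \<and> (\<exists>u\<in>PP. \<exists>i\<in>Field r. \<exists>x\<in>T i. \<exists>y\<in>T i. lt X x y \<and> oiso Y E Y (cell u i (ico X x y)))"

lemma isK_cell:
  assumes "u \<in> PP" "i \<in> Field r" "x \<in> T i" "y \<in> T i" "lt X x y"
  shows "isK (cell u i (ico X x y))"
  using assms oiso_refl cell_sub unfolding isK_def by blast

lemma isK_oiso_cell:
  assumes E: "isK E" and u: "u \<in> PP" "i \<in> Field r" "x \<in> T i" "y \<in> T i" "lt X x y"
  shows "oiso Y E Y (cell u i (ico X x y))"
proof -
  obtain u' i' x' y' where *: "u' \<in> PP" "i' \<in> Field r" "x' \<in> T i'" "y' \<in> T i'" "lt X x' y'" "oiso Y E Y (cell u' i' (ico X x' y'))"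
    using E unfolding isK_def by blast
  show ?thesis
    by (rule oiso_trans[OF *(6) cell_iso[OF *(1) u(1) *(2) u(2) T_ico[OF *(3,4)] T_ico[OF u(3,4)] HLOTS_ico_iso[OF HX *(5) u(5)]]])
qed

lemma isK_iso: "isK E \<Longrightarrow> isK F \<Longrightarrow> oiso Y E Y F"
proof -
  assume E: "isK E" and F: "isK F"
  obtain u i x y where *: "u \<in> PP" "i \<in> Field r" "x \<in> T i" "y \<in> T i" "lt X x y" "oiso Y F Y (cell u i (ico X x y))"
    using F unfolding isK_def by blast
  have "F \<subseteq> Field Y" using F unfolding isK_def by blast
  then show ?thesis using oiso_trans[OF isK_oiso_cell[OF E *(1-5)] oiso_sym[OF lY lY _ *(6)]] by blast
qed

lemma isK_trans:
  assumes "E \<subseteq> Field Y" "oiso Y E Y F" "isK F" shows "isK E"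
  using assms oiso_trans[OF assms(2)] unfolding isK_def by blast

text \<open>Split a half-open interval at an inner point \<open>m\<close>: one summand is matched
  with the cell over the left part, the other with the cell over the right part.\<close>

lemma isK_Un:
  assumes E: "isK E" "isK F" "\<And>x y. x \<in> E \<Longrightarrow> y \<in> F \<Longrightarrow> lt Y x y"
  shows "isK (E \<union> F)"
proof -
  obtain u i x y where *: "u \<in> PP" "i \<in> Field r" "x \<in> T i" "y \<in> T i" "lt X x y"
    using E unfolding isK_def by blast
  obtain m where m: "lt X x m" "lt X m y" using order_denseE[OF dX *(5)] .
  have mT: "m \<in> T i" using T_ico[OF *(3,4)] m lt_le[OF m(1)] unfolding ico_def by blast
  have eq: "ico X x y = ico X x m \<union> ico X m y"
  proof -
    have "z \<in> ico X x m \<union> ico X m y" if z: "z \<in> ico X x y" for z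
      using z not_lt_le[OF lX lt_Field(1)[of X z y] lt_Field(2)[OF m(1)]] unfolding ico_def by blast
    moreover have "ico X x m \<union> ico X m y \<subseteq> ico X x y"
      using lt_trans[OF lX _ m(2)] lots_trans[OF lX lt_le[OF m(1)]] unfolding ico_def by blast
    ultimately show ?thesis by blast
  qed
  have "oiso Y (E \<union> F) Y (cell u i (ico X x m) \<union> cell u i (ico X m y))"
  proof (rule oiso_Un[OF lY E(3) _ isK_oiso_cell[OF E(1) *(1,2,3) mT m(1)] isK_oiso_cell[OF E(2) *(1,2) mT *(4) m(2)]])
    fix z w assume "z \<in> cell u i (ico X x m)" "w \<in> cell u i (ico X m y)"
    then show "lt Y z w" by (rule cell_lt[OF *(2), rotated]) (use lt_le_trans[OF lX] in \<open>auto simp: ico_def\<close>)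
  qed
  then have "oiso Y (E \<union> F) Y (cell u i (ico X x y))" unfolding eq cell_Un .
  moreover have "E \<union> F \<subseteq> Field Y" using E unfolding isK_def by blast
  ultimately show ?thesis using * unfolding isK_def by blast
qed

text \<open>Countable cofinality of \<open>X\<close> splits one half-open interval into \<omega>
  consecutive ones, whose cells are matched with the given pieces.\<close>

lemma isK_UN:
  fixes E :: "nat \<Rightarrow> ('i \<Rightarrow> 'a) set"
  assumes E: "\<And>n. isK (E n)" "\<And>m n x y. m < n \<Longrightarrow> x \<in> E m \<Longrightarrow> y \<in> E n \<Longrightarrow> lt Y x y"
  shows "isK (\<Union>n. E n)"
proof -
  obtain u i x y where *: "u \<in> PP" "i \<in> Field r" "x \<in> T i" "y \<in> T i" "lt X x y"
    using E(1)[of 0] unfolding isK_def by blast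
  have nm: "\<exists>b\<in>ico X x y. lt X a b" if "a \<in> ico X x y" for a
  proof -
    have a: "(x, a) \<in> X" "lt X a y" using that unfolding ico_def by blast+
    obtain b where b: "lt X a b" "lt X b y" using order_denseE[OF dX a(2)] .
    then show ?thesis using lots_trans[OF lX a(1) lt_le[OF b(1)]] unfolding ico_def by blast
  qed
  have x0: "x \<in> ico X x y" using *(5) lots_refl[OF lX lt_Field(1)[OF *(5)]] unfolding ico_def by blast
  obtain s :: "nat \<Rightarrow> 'a" where s: "s 0 = x" "\<And>n. s n \<in> ico X x y" "\<And>n. lt X (s n) (s (Suc n))"
      "\<And>a. a \<in> ico X x y \<Longrightarrow> \<exists>n. lt X a (s n)"
    by (rule ccof_seq[OF lX HLOTS_ccof[OF HX] ico_Field nm x0]) blast+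
  have sy: "lt X (s n) y" for n using s(2)[of n] unfolding ico_def by blast
  have eq: "ico X x y = (\<Union>n. ico X (s n) (s (Suc n)))"
  proof -
    have "\<exists>n. lt X z (s n)" if z: "lt X z y" for z
    proof (cases "(x, z) \<in> X")
      case True then show ?thesis using s(4) z unfolding ico_def by blast
    next
      case False
      then have "lt X z (s 0)" using not_le_lt[OF lX lt_Field(1)[OF *(5)] lt_Field(1)[OF z]] s(1) by simp
      then show ?thesis by blast
    qed
    then have "ico X (s 0) y = (\<Union>n. ico X (s n) (s (Suc n)))"
      by (intro ico_UN lX lt_le s(3) sy)
    then show ?thesis using s(1) by simp
  qed
  have sT: "s n \<in> T i" for n using s(2) T_ico[OF *(3,4)] by blast
  have "oiso Y (\<Union>n. E n) Y (\<Union>n. cell u i (ico X (s n) (s (Suc n))))"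
  proof (rule oiso_UN[OF lY E(2) _ isK_oiso_cell[OF E(1) *(1,2) sT sT s(3)]])
    fix m n :: nat and z w assume mn: "m < n" and z: "z \<in> cell u i (ico X (s m) (s (Suc m)))" "w \<in> cell u i (ico X (s n) (s (Suc n)))"
    have le: "(s (Suc m), s n) \<in> X"
      using mn lt_le[OF lt_chain[of X s "Suc m" n, OF lX s(3)]] lots_refl[OF lX lt_Field(1)[OF sy]]
      by (cases "Suc m = n") auto
    show "lt Y z w"
    proof (rule cell_lt[OF *(2) _ z])
      fix a b assume "a \<in> ico X (s m) (s (Suc m))" "b \<in> ico X (s n) (s (Suc n))"
      then show "lt X a b" using lt_le_trans[OF lX lt_le_trans[OF lX _ le]] unfolding ico_def by blast
    qed
  qed auto
  then have "oiso Y (\<Union>n. E n) Y (cell u i (ico X x y))" unfolding eq cell_UN .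
  moreover have "(\<Union>n. E n) \<subseteq> Field Y" using E(1) unfolding isK_def by blast
  ultimately show ?thesis using * unfolding isK_def by blast
qed

definition step :: "('i \<Rightarrow> 'a) \<Rightarrow> ('i \<Rightarrow> 'a) \<Rightarrow> bool" where
  "step a b \<longleftrightarrow> a \<in> PP \<and> (a = b \<or> lt Y a b \<and> isK (ico Y a b))"

lemma step_le: "step a b \<Longrightarrow> (a, b) \<in> Y"
  using lots_refl[OF lY] lt_le[of Y a b] FY unfolding step_def by blast

lemma step_trans: "step a b \<Longrightarrow> step b c \<Longrightarrow> step a c"
proof -
  assume s: "step a b" "step b c"
  show ?thesis
  proof (cases "a = b \<or> b = c")
    case False
    then have l: "lt Y a b" "lt Y b c" "isK (ico Y a b)" "isK (ico Y b c)" using s unfolding step_def by blast+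
    have "isK (ico Y a b \<union> ico Y b c)"
      by (rule isK_Un[OF l(3,4)]) (rule ico_lt[OF lY lots_refl[OF lY lt_Field(1)[OF l(2)]]])
    then show ?thesis using lt_trans[OF lY l(1,2)] s(1) ico_Un[OF lY l(1,2)] unfolding step_def by simp
  qed (use s in auto)
qed

text \<open>If the sequence becomes constant, its value is \<open>b\<close> by cofinality. Otherwise
  a strictly increasing subsequence cuts the interval up to \<open>b\<close> into \<omega>
  consecutive cells, to which \<open>isK_UN\<close> applies.\<close>

lemma step_sup:
  fixes a :: "nat \<Rightarrow> 'i \<Rightarrow> 'a"
  assumes st: "\<And>n. step (a n) (a (Suc n))" and le: "\<And>n. (a n, b) \<in> Y" and cof: "\<And>z. lt Y z b \<Longrightarrow> \<exists>n. lt Y z (a n)"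
  shows "step (a 0) b"
proof -
  have aP: "a n \<in> PP" for n using st unfolding step_def by blast
  have stn: "step (a m) (a (m + k))" for m k
  proof (induction k)
    case 0 show ?case using aP unfolding step_def by simp
  next
    case (Suc k) show ?case using step_trans[OF Suc st] by simp
  qed
  have stmn: "step (a m) (a n)" if "m \<le> n" for m n using stn[of m "n - m"] that by simp
  show ?thesis
  proof (cases "\<exists>N. \<forall>n\<ge>N. a n = a N")
    case True
    then obtain N where N: "\<And>n. n \<ge> N \<Longrightarrow> a n = a N" by blast
    have "\<not> lt Y (a N) (a n)" for n
    proof (cases "N \<le> n")
      case True then show ?thesis using N[OF True] lt_irrefl by metis
    next
      case False
      then have "(a n, a N) \<in> Y" using step_le[OF stmn] by simp
      then show ?thesis using lt_not_le[OF lY] by blast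
    qed
    then have "\<not> lt Y (a N) b" using cof by blast
    then have "a N = b" using le[of N] unfolding lt_def by blast
    then show ?thesis using stmn[of 0 N] by simp
  next
    case False
    then have ex: "\<exists>m>k. a m \<noteq> a k" for k by (metis le_neq_implies_less)
    have "\<exists>k. \<forall>n. (n = 0 \<longrightarrow> k n = (0::nat)) \<and> (k n < k (Suc n) \<and> a (k (Suc n)) \<noteq> a (k n))"
      by (rule dependent_nat_choice) (use ex in auto)
    then obtain k where k: "k 0 = (0::nat)" "\<And>n. k n < k (Suc n)" "\<And>n. a (k (Suc n)) \<noteq> a (k n)" by blast
    define c where "c n = a (k n)" for n
    have "step (c n) (c (Suc n))" for n unfolding c_def by (rule stmn) (use k(2)[of n] in simp)
    then have lc: "lt Y (c n) (c (Suc n))" "isK (ico Y (c n) (c (Suc n)))" for n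
      using k(3)[of n] unfolding step_def c_def by metis+
    have ge: "n \<le> k n" for n
    proof (induction n)
      case (Suc n) then show ?case using k(2)[of n] by simp
    qed simp
    have cofc: "\<exists>n. lt Y z (c n)" if z: "lt Y z b" for z
    proof -
      obtain n where "lt Y z (a n)" using cof[OF z] by blast
      then have "lt Y z (c n)" unfolding c_def by (rule lt_le_trans[OF lY _ step_le[OF stmn[OF ge]]])
      then show ?thesis by blast
    qed
    have "ico Y (c 0) b = (\<Union>n. ico Y (c n) (c (Suc n)))"
      by (rule ico_UN[OF lY]) (use lt_le[OF lc(1)] le cofc in \<open>auto simp: c_def\<close>)
    moreover have "isK (\<Union>n. ico Y (c n) (c (Suc n)))"
    proof (rule isK_UN[OF lc(2)])
      fix m n :: nat and x y assume mn: "m < n" and xy: "x \<in> ico Y (c m) (c (Suc m))" "y \<in> ico Y (c n) (c (Suc n))"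
      have "(c (Suc m), c n) \<in> Y"
        unfolding c_def by (rule step_le[OF stmn]) (use mn lift_Suc_mono_le[of k "Suc m" n] k(2) in \<open>simp add: less_imp_le\<close>)
      then show "lt Y x y" using ico_lt[OF lY _ xy] by blast
    qed
    moreover have "lt Y (c 0) b" using lt_le_trans[OF lY lc(1)] le unfolding c_def by blast
    ultimately show ?thesis using aP k(1) unfolding step_def c_def by simp
  qed
qed

text \<open>For \<open>v\<close> in the tower and \<open>i\<close> not the least index, this is the
  least point of the block of all points that agree with \<open>v\<close> below
  \<open>i\<close>.\<close>

definition down :: "('i \<Rightarrow> 'a) \<Rightarrow> 'i \<Rightarrow> 'i \<Rightarrow> 'a" where
  "down v i = (\<lambda>k\<in>Field r. if lt r k i then v k else p)"

lemma down_less: "lt r k i \<Longrightarrow> down v i k = v k"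
  using lt_Field(1)[of r k i] unfolding down_def by simp

lemma down_ge: "k \<in> Field r \<Longrightarrow> \<not> lt r k i \<Longrightarrow> down v i k = p"
  unfolding down_def by simp

lemma down_PP: "v \<in> PP \<Longrightarrow> lt r j i \<Longrightarrow> down v i \<in> PP"
proof
  fix k assume v: "v \<in> PP" "lt r j i" and k: "k \<in> Field r"
  show "down v i k \<in> T k"
    using PP_T[OF v(1) k] pJ J_T[of k] down_less[of k i v] down_ge[OF k, of i v] by (cases "lt r k i") auto
qed (simp add: down_def)

text \<open>From \<open>i\<close> on, coordinates lie in \<open>J\<close> and cannot drop below
  \<open>p\<close>; a point below the truncation must therefore branch off below \<open>v\<close>
  before \<open>i\<close>.\<close>

lemma lt_down:
  assumes "v \<in> PP" "z \<in> PP" "lt r j i"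
  shows "lt Y z (down v i) \<longleftrightarrow> (\<exists>m. lt r m i \<and> lt X (z m) (v m) \<and> (\<forall>k. lt r k m \<longrightarrow> z k = v k))"
proof
  assume "lt Y z (down v i)"
  then obtain m where m: "m \<in> Field r" "lt X (z m) (down v i m)" "\<And>k. lt r k m \<Longrightarrow> z k = down v i k"
    by (rule L.lt_lexpE) blast
  have mi: "lt r m i"
  proof (rule ccontr)
    assume n: "\<not> lt r m i"
    then have "(i, m) \<in> r" using not_lt_le[OF lr m(1) lt_Field(2)[OF assms(3)]] by blast
    then have "z m \<in> J" using PP_J[OF assms(2)] lt_le_trans[OF lr assms(3)] by blast
    then have "(p, z m) \<in> X" unfolding lots_interval_def by blast
    then show False using m(2) down_ge[OF m(1) n] lt_not_le[OF lX] by metis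
  qed
  have "z k = v k" if "lt r k m" for k using m(3)[OF that] down_less[OF lt_trans[OF lr that mi]] by metis
  then show "\<exists>m. lt r m i \<and> lt X (z m) (v m) \<and> (\<forall>k. lt r k m \<longrightarrow> z k = v k)"
    using mi m(2) down_less[OF mi, of v] by metis
next
  assume "\<exists>m. lt r m i \<and> lt X (z m) (v m) \<and> (\<forall>k. lt r k m \<longrightarrow> z k = v k)"
  then obtain m where m: "lt r m i" "lt X (z m) (v m)" "\<And>k. lt r k m \<Longrightarrow> z k = v k" by blast
  show "lt Y z (down v i)"
  proof (rule lt_YI[OF assms(2) down_PP[OF assms(1,3)] _ _ lt_Field(1)[OF m(1)]])
    show "lt X (z m) (down v i m)" using m(2) down_less[OF m(1)] by metis
    show "z k = down v i k" if "lt r k m" for k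
      using m(3)[OF that] down_less[OF lt_trans[OF lr that m(1)]] by metis
  qed
qed

lemma down_le:
  assumes "v \<in> PP" "z \<in> PP" "lt r j i" "\<And>k. lt r k i \<Longrightarrow> z k = v k"
  shows "(down v i, z) \<in> Y"
proof -
  have "\<not> lt Y z (down v i)" unfolding lt_down[OF assms(1-3)] using assms(4) by (metis lt_irrefl)
  then show ?thesis using not_lt_le[OF lY] assms(2) down_PP[OF assms(1,3)] FY by blast
qed

lemma down_mono:
  assumes "v \<in> PP" "lt r k i" "(i, j) \<in> r"
  shows "(down v i, down v j) \<in> Y"
  by (rule down_le[OF assms(1) down_PP[OF assms(1) lt_le_trans[OF lr assms(2,3)]] assms(2)])
    (rule down_less[OF lt_le_trans[OF lr _ assms(3)]])

text \<open>Here \<open>j\<close> is the successor of \<open>i\<close>. The points between the two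
  truncations agree with \<open>v\<close> below \<open>i\<close> and have their \<open>i\<close>-th
  coordinate in the half-open interval from \<open>p\<close> to \<open>v i\<close>: a single cell,
  or nothing if \<open>v i = p\<close>.\<close>

lemma step_successor:
  assumes v: "v \<in> PP" and i: "lt r k0 i" and j: "\<And>k. lt r k j \<longleftrightarrow> (k, i) \<in> r"
  shows "step (down v i) (down v j)"
proof (cases "v i = p")
  case True
  have iF: "i \<in> Field r" using lt_Field(2)[OF i] .
  have "down v i k = down v j k" if "k \<in> Field r" for k
    using True le_iff_lt[OF lr, of k i] that unfolding down_def j by auto
  then have "down v i = down v j" unfolding down_def by (intro ext) (auto simp: restrict_def)
  then show ?thesis using down_PP[OF v i] unfolding step_def by simp
next
  case False
  have iF: "i \<in> Field r" using lt_Field(2)[OF i] .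
  have ij: "lt r i j" using j lots_refl[OF lr iF] by blast
  have pv: "lt X p (v i)" using PP_J[OF v i] False unfolding lots_interval_def lt_def by blast
  note dP = down_PP[OF v i] down_PP[OF v ij]
  have dd: "lt Y (down v i) (down v j)"
  proof (rule lt_YI[OF dP _ _ iF])
    show "lt X (down v i i) (down v j i)" using pv down_less[OF ij, of v] down_ge[OF iF, of i v] by simp
    show "down v i k = down v j k" if "lt r k i" for k
      using down_less[OF that] down_less[OF lt_trans[OF lr that ij]] by metis
  qed
  have "ico Y (down v i) (down v j) = cell v i (ico X p (v i))"
  proof (intro equalityI subsetI)
    fix z assume z: "z \<in> ico Y (down v i) (down v j)"
    then have zP: "z \<in> PP" using lt_Field(1)[of Y] unfolding ico_def FY by blast
    have "lt Y z (down v j)" "\<not> lt Y z (down v i)" using z lt_not_le[OF lY] unfolding ico_def by blast+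
    then obtain m where m: "lt r m j" "lt X (z m) (v m)" "\<forall>k. lt r k m \<longrightarrow> z k = v k" "\<not> lt r m i"
      unfolding lt_down[OF v zP ij] lt_down[OF v zP i] by blast
    then have "m = i" using j[of m] unfolding lt_def by blast
    moreover have "(p, z i) \<in> X" using PP_J[OF zP i] unfolding lots_interval_def by blast
    ultimately show "z \<in> cell v i (ico X p (v i))" using zP m unfolding cell_def ico_def by blast
  next
    fix z assume z: "z \<in> cell v i (ico X p (v i))"
    then have zP: "z \<in> PP" and zi: "\<And>k. lt r k i \<Longrightarrow> z k = v k" "lt X (z i) (v i)" unfolding cell_def ico_def by auto
    have "lt Y z (down v j)" unfolding lt_down[OF v zP ij] using zi ij by blast
    then show "z \<in> ico Y (down v i) (down v j)" using down_le[OF v zP i zi(1)] unfolding ico_def by blast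
  qed
  moreover have "isK (cell v i (ico X p (v i)))"
    by (rule isK_cell[OF v iF _ PP_T[OF v iF] pv]) (use pJ J_T in blast)
  ultimately show ?thesis using dP dd unfolding step_def by simp
qed

text \<open>Transfinite induction on \<open>j\<close>: successor steps append a half-open cell, and a limit has
  countable cofinality, so that it is an increasing union of countably many half-open cells.\<close>

lemma step_down:
  assumes v: "v \<in> PP" and i: "lt r k0 i" and ij: "(i, j) \<in> r"
  shows "step (down v i) (down v j)"
proof -
  \<comment> \<open>The starting index is quantified inside the induction: at a limit the hypothesis
    is applied between consecutive terms of a cofinal sequence.\<close>
  have "\<forall>i. (\<exists>k. lt r k i) \<and> (i, j) \<in> r \<longrightarrow> step (down v i) (down v j)"
    using wo le_Field(2)[OF ij]
  proof (induction j rule: wo_induct)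
    case (less j)
    show ?case
    proof (intro allI impI)
      fix i assume "(\<exists>k. lt r k i) \<and> (i, j) \<in> r"
      then obtain k0 where i: "lt r k0 i" "(i, j) \<in> r" by blast
      note iF = lt_Field(2)[OF i(1)]
      show "step (down v i) (down v j)"
      proof (cases "i = j")
        case True
        then show ?thesis using down_PP[OF v i(1)] unfolding step_def by blast
      next
        case False
        then have ij: "lt r i j" using i(2) unfolding lt_def by blast
        show ?thesis
        proof (cases "\<exists>m. lt r m j \<and> (\<forall>k. lt r k j \<longrightarrow> (k, m) \<in> r)")
          case True
          then obtain m where m: "lt r m j" "\<And>k. lt r k j \<Longrightarrow> (k, m) \<in> r" by blast
          have im: "(i, m) \<in> r" using m(2)[OF ij] .
          have "step (down v i) (down v m)" using less.IH[OF m(1)] i(1) im by blast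
          moreover have "step (down v m) (down v j)"
            by (rule step_successor[OF v lt_le_trans[OF lr i(1) im]]) (use m le_lt_trans[OF lr _ m(1)] in blast)
          ultimately show ?thesis by (rule step_trans)
        next
          case lim: False
          define A where "A = {k. lt r k j \<and> (i, k) \<in> r}"
          have AF: "A \<subseteq> Field r" using lt_Field(1)[of r] unfolding A_def by blast
          have gt: "\<exists>k'. lt r k' j \<and> lt r k k'" if k: "lt r k j" for k
          proof -
            obtain k' where "lt r k' j" "(k', k) \<notin> r" using lim k by blast
            then show ?thesis using not_le_lt[OF lr lt_Field(1)[of r k' j] lt_Field(1)[OF k]] by blast
          qed
          have nm: "\<exists>b\<in>A. lt r a b" if a: "a \<in> A" for a
          proof -
            have "lt r a j" "(i, a) \<in> r" using a unfolding A_def by blast+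
            then obtain b where "lt r b j" "lt r a b" using gt by blast
            then show ?thesis using lots_trans[OF lr \<open>(i, a) \<in> r\<close> lt_le[of r a b]] unfolding A_def by blast
          qed
          have iA: "i \<in> A" unfolding A_def using ij lots_refl[OF lr iF] by blast
          have cA: "countable A" by (rule countable_subset[OF AF countable])
          have re: "\<exists>b\<in>A. (a, b) \<in> r" if "a \<in> A" for a using that AF lots_refl[OF lr] by blast
          obtain x :: "nat \<Rightarrow> 'i" where x: "x 0 = i" "\<And>n. x n \<in> A" "\<And>n. lt r (x n) (x (Suc n))" "\<And>a. a \<in> A \<Longrightarrow> \<exists>n. lt r a (x n)"
            by (rule cofinal_seq[OF lr AF nm iA order_refl cA re]) blast+
          have xj: "lt r (x n) j" "(i, x n) \<in> r" for n using x(2)[of n] unfolding A_def by blast+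
          have lo: "lt r k0 (x n)" for n by (rule lt_le_trans[OF lr i(1) xj(2)])
          have "step (down v (x 0)) (down v j)"
          proof (rule step_sup[of "\<lambda>n. down v (x n)"])
            show "step (down v (x n)) (down v (x (Suc n)))" for n
              using less.IH[OF xj(1)[of "Suc n"]] lo[of n] lt_le[OF x(3)[of n]] by blast
            show "(down v (x n), down v j) \<in> Y" for n by (rule down_mono[OF v lo lt_le[OF xj(1)]])
            fix z assume z: "lt Y z (down v j)"
            then have zP: "z \<in> PP" using lt_Field(1)[OF z] unfolding FY by blast
            have k0j: "lt r k0 j" by (rule lt_le_trans[OF lr i])
            obtain m where m: "lt r m j" "lt X (z m) (v m)" "\<forall>k. lt r k m \<longrightarrow> z k = v k"
              using z unfolding lt_down[OF v zP k0j] by blast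
            \<comment> \<open>A point below \<open>down v j\<close> branches off below
              \<open>v\<close> at some \<open>m < j\<close>. As soon as \<open>x n\<close> passes
              \<open>m\<close>, it is also below \<open>down v (x n)\<close>.\<close>
            have "\<exists>n. lt r m (x n)"
            proof (cases "(i, m) \<in> r")
              case True then show ?thesis using x(4)[of m] m(1) unfolding A_def by blast
            next
              case False
              then have "lt r m (x 0)" using not_le_lt[OF lr iF lt_Field(1)[OF m(1)]] x(1) by blast
              then show ?thesis by blast
            qed
            then obtain n where n: "lt r m (x n)" by blast
            have "lt Y z (down v (x n))" unfolding lt_down[OF v zP lo] using m n by blast
            then show "\<exists>n. lt Y z (down v (x n))" by blast
          qed
          then show ?thesis using x(1) by simp
        qed
      qed
    qed
  qed
  then show ?thesis using i ij by blast
qed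

definition up :: "('i \<Rightarrow> 'a) \<Rightarrow> 'i \<Rightarrow> 'i \<Rightarrow> 'a" where
  "up v i = (\<lambda>k\<in>Field r. if lt r k i then v k else q)"

text \<open>The mirror image of \<open>isK\<close>: the type of the cells over intervals that are
  open on the left and closed on the right.\<close>

abbreviation isM :: "('i \<Rightarrow> 'a) set \<Rightarrow> bool" where
  "isM \<equiv> long_tower.isK (X\<inverse>) q p r"

text \<open>In the reversed tower \<open>p\<close> and \<open>q\<close> change roles, and
  \<open>down\<close> there is \<open>up\<close> here. Each fact is its counterpart for the reversed
  order, translated back.\<close>

lemma dual_facts:
  shows up_less: "lt r k i \<Longrightarrow> up v i k = v k"
    and up_PP: "v \<in> PP \<Longrightarrow> lt r j i \<Longrightarrow> up v i \<in> PP"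
    and up_lt: "v \<in> PP \<Longrightarrow> z \<in> PP \<Longrightarrow> lt r j i \<Longrightarrow>
      lt Y (up v i) z \<longleftrightarrow> (\<exists>m. lt r m i \<and> lt X (v m) (z m) \<and> (\<forall>k. lt r k m \<longrightarrow> z k = v k))"
    and le_up: "v \<in> PP \<Longrightarrow> z \<in> PP \<Longrightarrow> lt r j i \<Longrightarrow> (\<And>k. lt r k i \<Longrightarrow> z k = v k) \<Longrightarrow> (z, up v i) \<in> Y"
    and up_step: "v \<in> PP \<Longrightarrow> lt r k0 i \<Longrightarrow> (i, j) \<in> r \<Longrightarrow>
      up v i = up v j \<or> lt Y (up v j) (up v i) \<and> isM {z. lt Y (up v j) z \<and> (z, up v i) \<in> Y}"
    and isM_iso: "isM E \<Longrightarrow> isM F \<Longrightarrow> oiso Y E Y F"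
    and isM_Un: "isM E \<Longrightarrow> isM F \<Longrightarrow> (\<And>x y. x \<in> E \<Longrightarrow> y \<in> F \<Longrightarrow> lt Y y x) \<Longrightarrow> isM (E \<union> F)"
    and isM_cell: "u \<in> PP \<Longrightarrow> i \<in> Field r \<Longrightarrow> x \<in> T i \<Longrightarrow> y \<in> T i \<Longrightarrow> lt X x y \<Longrightarrow>
      isM (cell u i {z. lt X x z \<and> (z, y) \<in> X})"
proof -
  interpret D: long_tower "X\<inverse>" q p r by (rule dual)
  have TT: "tower_coord (X\<inverse>) q p r = T" by (rule tower_coord_converse)
  have YY: "lexp (X\<inverse>) r S = (lexp X r S)\<inverse>" for S by (rule lexp_converse)
  have uu: "D.down = up" unfolding D.down_def up_def ..
  have cc: "D.cell = cell" unfolding D.cell_def cell_def TT ..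
  show "lt r k i \<Longrightarrow> up v i k = v k" using D.down_less unfolding uu .
  show "v \<in> PP \<Longrightarrow> lt r j i \<Longrightarrow> up v i \<in> PP" using D.down_PP unfolding uu TT .
  show "v \<in> PP \<Longrightarrow> z \<in> PP \<Longrightarrow> lt r j i \<Longrightarrow>
      lt Y (up v i) z \<longleftrightarrow> (\<exists>m. lt r m i \<and> lt X (v m) (z m) \<and> (\<forall>k. lt r k m \<longrightarrow> z k = v k))"
    using D.lt_down unfolding uu TT YY lt_converse .
  show "v \<in> PP \<Longrightarrow> z \<in> PP \<Longrightarrow> lt r j i \<Longrightarrow> (\<And>k. lt r k i \<Longrightarrow> z k = v k) \<Longrightarrow> (z, up v i) \<in> Y"
    using D.down_le unfolding uu TT YY converse_iff .
  show "v \<in> PP \<Longrightarrow> lt r k0 i \<Longrightarrow> (i, j) \<in> r \<Longrightarrow>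
      up v i = up v j \<or> lt Y (up v j) (up v i) \<and> isM {z. lt Y (up v j) z \<and> (z, up v i) \<in> Y}"
    using D.step_down unfolding uu TT YY D.step_def lt_converse ico_converse by blast
  show "isM E \<Longrightarrow> isM F \<Longrightarrow> oiso Y E Y F" using D.isK_iso unfolding TT YY oiso_converse .
  show "isM E \<Longrightarrow> isM F \<Longrightarrow> (\<And>x y. x \<in> E \<Longrightarrow> y \<in> F \<Longrightarrow> lt Y y x) \<Longrightarrow> isM (E \<union> F)"
    using D.isK_Un unfolding TT YY lt_converse .
  show "u \<in> PP \<Longrightarrow> i \<in> Field r \<Longrightarrow> x \<in> T i \<Longrightarrow> y \<in> T i \<Longrightarrow> lt X x y \<Longrightarrow>
      isM (cell u i {z. lt X x z \<and> (z, y) \<in> X})"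
    using D.isK_cell[of u i y x] unfolding TT lt_converse ico_converse cc by blast
qed

text \<open>A first disagreement with \<open>u\<close> before \<open>i\<close> would place
  \<open>z\<close> below or above the whole block of \<open>u\<close> at \<open>i\<close>, whose
  extreme points are \<open>down u i\<close> and \<open>up u i\<close>.\<close>

lemma agree_below:
  assumes "u \<in> PP" "z \<in> PP" "lt r j i" "\<not> lt Y z (down u i)" "\<not> lt Y (up u i) z" "lt r k i"
  shows "z k = u k"
  using wo lt_Field(1)[OF assms(6)] assms(6)
proof (induction rule: wo_induct)
  case (less k)
  have eq: "z m = u m" if "lt r m k" for m using less(2)[OF that lt_trans[OF lr that less(3)]] .
  have "\<not> lt X (z k) (u k)" "\<not> lt X (u k) (z k)"
    using assms(4,5) eq less(3) unfolding lt_down[OF assms(1,2,3)] up_lt[OF assms(1,2,3)] by blast+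
  then show ?case using lt_cases[OF lX L.coord[OF assms(2) less(1)] L.coord[OF assms(1) less(1)]] by blast
qed

text \<open>As there is no last index, every index has a successor. Truncating there keeps the
  coordinate at \<open>k\<close> and discards all later ones.\<close>

lemma successor:
  assumes "k \<in> Field r"
  obtains s where "\<And>m. lt r m s \<longleftrightarrow> (m, k) \<in> r" "lt r k s"
proof -
  have "{j. lt r k j} \<noteq> {}" "{j. lt r k j} \<subseteq> Field r" using nomax[OF assms] lt_Field(2)[of r k] by blast+
  then obtain s where s: "lt r k s" "\<And>j. lt r k j \<Longrightarrow> (s, j) \<in> r" using wo_least[OF wo] by (metis mem_Collect_eq)
  have "lt r m s \<longleftrightarrow> (m, k) \<in> r" for m
  proof
    assume m: "lt r m s"
    show "(m, k) \<in> r"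
    proof (rule ccontr)
      assume "(m, k) \<notin> r"
      then have "lt r k m" using not_le_lt[OF lr lt_Field(1)[OF m] assms] by blast
      then show False using s(2) lt_not_le[OF lr m] by blast
    qed
  qed (use le_lt_trans[OF lr _ s(1)] in blast)
  then show ?thesis using that s(1) by blast
qed

text \<open>Where \<open>u\<close> and \<open>v\<close> branch, at the coordinate \<open>k\<close>, there is the open cell of the points
  that lie strictly between. It is preceded by the block of \<open>u\<close> at \<open>i\<close> and the part of the block of
  \<open>u\<close> above it, and followed by the part of the block of \<open>v\<close> below \<open>down v j\<close>.\<close>

lemma isK_ico_down:
  assumes u: "u \<in> PP" and v: "v \<in> PP" and xy: "lt X (u k) (v k)" and uv: "\<And>m. lt r m k \<Longrightarrow> u m = v m"
    and i: "lt r k i" and j: "lt r k j"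
  shows "isK (ico Y (down u i) (down v j))"
proof -
  have kF: "k \<in> Field r" and iF: "i \<in> Field r" and jF: "j \<in> Field r" using lt_Field[OF i] lt_Field[OF j] by blast+
  \<comment> \<open>A block at the successor \<open>s\<close> of \<open>k\<close> is a cell over a
    single \<open>k\<close>-th coordinate: \<open>P1\<close> and \<open>P2\<close> will lie over
    \<open>u k\<close>, \<open>P4\<close> over \<open>v k\<close>, and \<open>P3\<close> strictly in
    between.\<close>
  obtain s where s: "\<And>m. lt r m s \<longleftrightarrow> (m, k) \<in> r" and ks: "lt r k s" by (rule successor[OF kF]) blast
  have sF: "s \<in> Field r" using lt_Field(2)[OF ks] .
  have si: "(s, i) \<in> r" using s[of i] lt_not_le[OF lr i] not_lt_le[OF lr iF sF] by blast
  have sj: "(s, j) \<in> r" using s[of j] lt_not_le[OF lr j] not_lt_le[OF lr jF sF] by blast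
  have ms: "lt r m s \<longleftrightarrow> lt r m k \<or> m = k" for m using s le_iff_lt[OF lr, of m k] kF by blast
  let ?x = "u k" and ?y = "v k"
  note T1 = PP_T[OF u kF] PP_T[OF v kF]
  note PPs = down_PP[OF u i] down_PP[OF v j] down_PP[OF v ks] up_PP[OF u i] up_PP[OF u ks]
  define P1 where "P1 = cell u i (T i)"
  define P2 where "P2 = {z. lt Y (up u i) z \<and> (z, up u s) \<in> Y}"
  define P3 where "P3 = cell u k (ooi X ?x ?y)"
  define P4 where "P4 = ico Y (down v s) (down v j)"
  have P1: "z \<in> P1 \<longleftrightarrow> z \<in> PP \<and> (\<forall>m. lt r m i \<longrightarrow> z m = u m)" for z
    unfolding P1_def cell_def using PP_T[OF _ iF] by blast
  have inP: "z \<in> PP" if "(z, w) \<in> Y" for z w using le_Field(1)[OF that] unfolding FY .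
  have P1k: "z \<in> cell u k {?x}" if "z \<in> P1" for z
    using that i lt_trans[OF lr _ i] unfolding P1 cell_def by blast
  have du: "(down u i, up u i) \<in> Y" by (rule down_le[OF u up_PP[OF u i] i]) (rule up_less)
  have P2k: "z \<in> cell u k {?x}" if z: "z \<in> P2" for z
  proof -
    have zP: "z \<in> PP" using z inP unfolding P2_def by blast
    have "\<not> lt Y z (down u s)"
    proof
      assume "lt Y z (down u s)"
      then have "lt Y z (down u i)"
        using lt_le_trans[OF lr _ si] unfolding lt_down[OF u zP ks] lt_down[OF u zP i] by blast
      then have "lt Y z (up u i)" using lt_le_trans[OF lY _ du] by blast
      then show False using z lt_asym[OF lY] unfolding P2_def by blast
    qed
    moreover have "\<not> lt Y (up u s) z" using z lt_not_le[OF lY] unfolding P2_def by blast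
    ultimately have "z m = u m" if "lt r m s" for m using agree_below[OF u zP ks _ _ that] by blast
    then show ?thesis using zP unfolding ms cell_def by blast
  qed
  have P4k: "z \<in> cell u k {?y}" if z: "z \<in> P4" for z
  proof -
    have zz: "(down v s, z) \<in> Y" "lt Y z (down v j)" using z unfolding P4_def ico_def by blast+
    have zP: "z \<in> PP" using inP[OF lt_le[OF zz(2)]] .
    have "(down v j, up v s) \<in> Y"
      by (rule le_up[OF v down_PP[OF v j] ks]) (rule down_less[OF lt_le_trans[OF lr _ sj]])
    then have "\<not> lt Y (up v s) z" using lt_asym[OF lY lt_le_trans[OF lY zz(2)]] by blast
    moreover have "\<not> lt Y z (down v s)" using zz(1) lt_not_le[OF lY] by blast
    ultimately have "z m = v m" if "lt r m s" for m using agree_below[OF v zP ks _ _ that] by blast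
    then show ?thesis using zP uv unfolding ms cell_def by auto
  qed
  have eq: "ico Y (down u i) (down v j) = P1 \<union> P2 \<union> P3 \<union> P4"
  proof (intro equalityI subsetI)
    fix z assume z: "z \<in> ico Y (down u i) (down v j)"
    then have zz: "\<not> lt Y z (down u i)" "lt Y z (down v j)" using lt_not_le[OF lY] unfolding ico_def by blast+
    have zP: "z \<in> PP" using inP[OF lt_le[OF zz(2)]] .
    show "z \<in> P1 \<union> P2 \<union> P3 \<union> P4"
    proof (rule ccontr)
      assume no: "z \<notin> P1 \<union> P2 \<union> P3 \<union> P4"
      then have "\<not> (down v s, z) \<in> Y" using zz(2) unfolding P4_def ico_def by blast
      then have "lt Y z (down v s)" using not_le_lt[OF lY] PPs(3) zP FY by blast
      then obtain m where m: "lt r m s" "lt X (z m) (v m)" "\<forall>n. lt r n m \<longrightarrow> z n = v n"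
        unfolding lt_down[OF v zP ks] by blast
      have "\<not> lt r m k"
      proof
        assume mk: "lt r m k"
        then have "lt X (z m) (u m)" "\<forall>n. lt r n m \<longrightarrow> z n = u n" using m uv lt_trans[OF lr _ mk] by auto
        then show False using zz(1) lt_trans[OF lr mk i] unfolding lt_down[OF u zP i] by blast
      qed
      then have mk: "m = k" using m(1) ms by blast
      have zu: "\<forall>n. lt r n k \<longrightarrow> z n = u n" using m(3) uv unfolding mk by simp
      have "\<not> lt X (z k) ?x" using zz(1) i zu unfolding lt_down[OF u zP i] by blast
      moreover have "\<not> lt X ?x (z k)" using no m(2) zu zP unfolding mk P3_def cell_def ooi_def by blast
      ultimately have zk: "z k = ?x" using lt_cases[OF lX L.coord[OF zP kF] L.coord[OF u kF]] by blast
      have "\<not> lt Y (up u s) z" unfolding up_lt[OF u zP ks] ms using zu zk by auto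
      then have "(z, up u s) \<in> Y" using not_lt_le[OF lY] PPs(5) zP FY by blast
      then have "\<not> lt Y (up u i) z" using no unfolding P2_def by blast
      then have "z \<in> P1" using agree_below[OF u zP i zz(1)] zP unfolding P1 by blast
      then show False using no by blast
    qed
  next
    fix z assume "z \<in> P1 \<union> P2 \<union> P3 \<union> P4"
    then consider "z \<in> P1" | "z \<in> P2" | "z \<in> P3" | "z \<in> P4" by blast
    then show "z \<in> ico Y (down u i) (down v j)"
    proof cases
      case 1
      have zP: "z \<in> PP" using 1 unfolding P1 by blast
      have "(down u i, z) \<in> Y" by (rule down_le[OF u zP i]) (use 1 P1 in blast)
      moreover have "z k = ?x" "\<forall>m. lt r m k \<longrightarrow> z m = v m" using P1k[OF 1] uv unfolding cell_def by auto
      then have "lt Y z (down v j)" unfolding lt_down[OF v zP j] using j xy by auto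
      ultimately show ?thesis unfolding ico_def by blast
    next
      case 2
      have zP: "z \<in> PP" using P2k[OF 2] unfolding cell_def by blast
      have "lt Y (up u i) z" using 2 unfolding P2_def by blast
      then have "(down u i, z) \<in> Y" by (rule lots_trans[OF lY du lt_le])
      moreover have "z k = ?x" "\<forall>m. lt r m k \<longrightarrow> z m = v m" using P2k[OF 2] uv unfolding cell_def by auto
      then have "lt Y z (down v j)" unfolding lt_down[OF v zP j] using j xy by auto
      ultimately show ?thesis unfolding ico_def by blast
    next
      case 3
      then have z: "z \<in> PP" "\<And>m. lt r m k \<Longrightarrow> z m = u m" "lt X ?x (z k)" "lt X (z k) ?y"
        unfolding P3_def cell_def ooi_def by auto
      have "lt Y (down u i) z"
      proof (rule lt_YI[OF PPs(1) z(1) _ _ kF])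
        show "lt X (down u i k) (z k)" using z(3) down_less[OF i] by metis
        show "down u i m = z m" if "lt r m k" for m using z(2)[OF that] down_less[OF lt_trans[OF lr that i]] by metis
      qed
      moreover have "lt Y z (down v j)" unfolding lt_down[OF v z(1) j] using j z(2,4) uv by metis
      ultimately show ?thesis using lt_le[of Y "down u i" z] unfolding ico_def by blast
    next
      case 4
      have "lt Y (down u i) (down v s)"
        unfolding lt_down[OF v PPs(1) ks]
      proof (intro exI[of _ k] conjI allI impI)
        show "lt X (down u i k) (v k)" using xy down_less[OF i] by metis
        show "down u i m = v m" if "lt r m k" for m using uv[OF that] down_less[OF lt_trans[OF lr that i]] by metis
      qed (rule ks)
      then show ?thesis using 4 lots_trans[OF lY lt_le[of Y "down u i" "down v s"], of z] unfolding P4_def ico_def by blast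
    qed
  qed
  \<comment> \<open>Two cut points are taken because \<open>P2\<close> has the type of cells closed
    on the right and \<open>P4\<close> of cells closed on the left; each gets a neighbour of its own
    type, with an open part between.\<close>
  obtain m1 where m1: "lt X ?x m1" "lt X m1 ?y" using order_denseE[OF dX xy] .
  obtain m2 where m2: "lt X m1 m2" "lt X m2 ?y" using order_denseE[OF dX m1(2)] .
  have xm2: "lt X ?x m2" using lt_trans[OF lX m1(1) m2(1)] .
  have mT: "m1 \<in> T k" "m2 \<in> T k" using T_ico[OF T1] m1 m2(2) lt_le[OF m1(1)] lt_le[OF xm2] unfolding ico_def by blast+
  define Q2 where "Q2 = {z. lt X ?x z \<and> (z, m1) \<in> X}"
  define Q3 where "Q3 = ooi X m1 m2"
  define Q4 where "Q4 = ico X m2 ?y"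
  have ooi_eq: "ooi X ?x ?y = Q2 \<union> Q3 \<union> Q4"
  proof (intro equalityI subsetI)
    fix z assume z: "z \<in> ooi X ?x ?y"
    then have zF: "z \<in> Field X" using ooi_Field[of X ?x ?y] by blast
    show "z \<in> Q2 \<union> Q3 \<union> Q4"
      using z not_le_lt[OF lX zF lt_Field(2)[OF m1(1)]] not_le_lt[OF lX lt_Field(2)[OF m2(1)] zF]
      unfolding Q2_def Q3_def Q4_def ooi_def ico_def by blast
  next
    fix z assume "z \<in> Q2 \<union> Q3 \<union> Q4"
    then show "z \<in> ooi X ?x ?y"
      using lt_trans[OF lX m1(1), of z] lt_trans[OF lX _ m2(2), of z] lt_le_trans[OF lX xm2, of z] le_lt_trans[OF lX _ m1(2), of z]
      unfolding Q2_def Q3_def Q4_def ooi_def ico_def by blast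
  qed
  have ico_eq: "ico X ?x ?y = {?x} \<union> (Q2 \<union> (Q3 \<union> Q4))"
  proof -
    have "ico X ?x ?y = {?x} \<union> ooi X ?x ?y"
      using xy le_iff_lt[OF lX, of ?x] lt_Field(1)[OF xy] unfolding ico_def ooi_def by auto
    then show ?thesis unfolding ooi_eq by blast
  qed
  have B1: "lt X a b" if "a \<in> {?x}" "b \<in> Q2 \<union> (Q3 \<union> Q4)" for a b
    using that ooi_eq unfolding ooi_def by blast
  have B2: "lt X a b" if "a \<in> Q2" "b \<in> Q3 \<union> Q4" for a b
  proof -
    have "lt X m1 b" using that(2) lt_le_trans[OF lX m2(1)] unfolding Q3_def Q4_def ooi_def ico_def by blast
    then show ?thesis using that(1) le_lt_trans[OF lX] unfolding Q2_def by blast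
  qed
  have B3: "lt X a b" if "a \<in> Q3" "b \<in> Q4" for a b
    using that lt_le_trans[OF lX] unfolding Q3_def Q4_def ooi_def ico_def by blast
  have B4: "lt X a b" if "a \<in> {?x} \<union> (Q2 \<union> (Q3 \<union> Q4))" "b \<in> {?y}" for a b
    using that unfolding ico_eq[symmetric] ico_def by blast
  note clt = cell_lt[OF kF]
  \<comment> \<open>\<open>P2\<close> is absorbed into the cell above it and \<open>P4\<close> into the cell below it.\<close>
  have I1: "oiso Y P1 Y (cell u k {?x})"
  proof -
    \<comment> \<open>A block is the cell with full range at its first free index. At
      \<open>i\<close> and at \<open>s\<close> that range is the interval \<open>J\<close>, so the
      two blocks are isomorphic.\<close>
    have "cell u k {?x} = cell u s (T s)"
      unfolding cell_def ms using PP_T[OF _ sF] by auto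
    moreover have "T i = T s" using T_pos[OF i] T_pos[OF ks] by simp
    then have "oiso Y P1 Y (cell u s (T s))"
      unfolding P1_def using cell_iso[OF u u iF sF, of "T i" "T s"] oiso_refl[of X "T s"] by simp
    ultimately show ?thesis by simp
  qed
  have MQ2: "isM (cell u k Q2)" unfolding Q2_def by (rule isM_cell[OF u kF T1(1) mT(1) m1(1)])
  have I2: "oiso Y (P2 \<union> cell u k Q2) Y (cell u k Q2)"
  proof -
    consider "P2 = {}" | "isM P2"
    proof -
      have "up u s = up u i \<or> isM P2" using up_step[OF u ks si] unfolding P2_def by blast
      moreover have "P2 = {}" if "up u s = up u i" using that lt_not_le[OF lY] unfolding P2_def by auto
      ultimately show ?thesis using that by blast
    qed
    then show ?thesis
    proof cases
      case 1 then show ?thesis using oiso_refl by simp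
    next
      case 2
      have "isM (cell u k Q2 \<union> P2)"
      proof (rule isM_Un[OF MQ2 2])
        show "lt Y w z" if "z \<in> cell u k Q2" "w \<in> P2" for z w
          by (rule clt[OF _ P2k[OF that(2)] that(1)]) (use B1 in blast)
      qed
      then show ?thesis using isM_iso[OF _ MQ2] by (simp add: Un_commute)
    qed
  qed
  have KQ4: "isK (cell u k Q4)" unfolding Q4_def by (rule isK_cell[OF u kF mT(2) T1(2) m2(2)])
  have I4: "oiso Y (cell u k Q4 \<union> P4) Y (cell u k Q4)"
  proof -
    have "down v s = down v j \<or> isK P4" using step_down[OF v ks sj] unfolding P4_def step_def by blast
    moreover have "P4 = {}" if "down v s = down v j" using that lt_not_le[OF lY] unfolding P4_def ico_def by auto
    ultimately consider "P4 = {}" | "isK P4" by blast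
    then show ?thesis
    proof cases
      case 1 then show ?thesis using oiso_refl by simp
    next
      case 2
      have "isK (cell u k Q4 \<union> P4)"
      proof (rule isK_Un[OF KQ4 2])
        show "lt Y z w" if "z \<in> cell u k Q4" "w \<in> P4" for z w
          by (rule clt[OF _ that(1) P4k[OF that(2)]]) (use B4 in blast)
      qed
      then show ?thesis using isK_iso[OF _ KQ4] by blast
    qed
  qed
  have I34: "oiso Y (cell u k Q3 \<union> (cell u k Q4 \<union> P4)) Y (cell u k Q3 \<union> cell u k Q4)"
  proof (rule oiso_Un[OF lY _ _ oiso_refl I4])
    show "lt Y z w" if "z \<in> cell u k Q3" "w \<in> cell u k Q4" for z w by (rule clt[OF B3 that])
    show "lt Y z w" if zw: "z \<in> cell u k Q3" "w \<in> cell u k Q4 \<union> P4" for z w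
    proof (cases "w \<in> P4")
      case True show ?thesis by (rule clt[OF _ zw(1) P4k[OF True]]) (use B4 in blast)
    next
      case False
      then have wQ: "w \<in> cell u k Q4" using zw(2) by blast
      show ?thesis by (rule clt[OF B3 zw(1) wQ])
    qed
  qed
  have I234: "oiso Y ((P2 \<union> cell u k Q2) \<union> (cell u k Q3 \<union> (cell u k Q4 \<union> P4))) Y (cell u k Q2 \<union> (cell u k Q3 \<union> cell u k Q4))"
  proof (rule oiso_Un[OF lY _ _ I2 I34])
    show "lt Y z w" if zw: "z \<in> cell u k Q2" "w \<in> cell u k Q3 \<union> cell u k Q4" for z w
      by (rule clt[OF B2 zw[folded cell_Un]])
    show "lt Y z w" if z: "z \<in> P2 \<union> cell u k Q2" and w: "w \<in> cell u k Q3 \<union> (cell u k Q4 \<union> P4)" for z w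
    proof -
      have z': "z \<in> cell u k ({?x} \<union> Q2)" using z P2k unfolding cell_Un by blast
      have w': "w \<in> cell u k (Q3 \<union> Q4 \<union> {?y})" using w P4k unfolding cell_Un by blast
      show ?thesis by (rule clt[OF _ z' w']) (use B1 B2 B4 in blast)
    qed
  qed
  \<comment> \<open>The block \<open>P1\<close> takes the place of the cell over the end point
    \<open>u k\<close>; with the absorbed pieces this is the half-open cell at
    \<open>k\<close>.\<close>
  have "oiso Y (P1 \<union> ((P2 \<union> cell u k Q2) \<union> (cell u k Q3 \<union> (cell u k Q4 \<union> P4)))) Y
     (cell u k {?x} \<union> (cell u k Q2 \<union> (cell u k Q3 \<union> cell u k Q4)))"
  proof (rule oiso_Un[OF lY _ _ I1 I234])
    show "lt Y z w" if zw: "z \<in> cell u k {?x}" "w \<in> cell u k Q2 \<union> (cell u k Q3 \<union> cell u k Q4)" for z w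
      by (rule clt[OF B1 zw[folded cell_Un]])
    show "lt Y z w" if z: "z \<in> P1" and w: "w \<in> (P2 \<union> cell u k Q2) \<union> (cell u k Q3 \<union> (cell u k Q4 \<union> P4))" for z w
    proof (cases "w \<in> P2")
      case True
      have "(z, up u i) \<in> Y" by (rule le_up[OF u _ i]) (use z P1 in blast)+
      then show ?thesis using True le_lt_trans[OF lY] unfolding P2_def by blast
    next
      case False
      then have w': "w \<in> cell u k (Q2 \<union> (Q3 \<union> Q4) \<union> {?y})" using w P4k unfolding cell_Un by blast
      show ?thesis by (rule clt[OF _ P1k[OF z] w']) (use B1 B4 in blast)
    qed
  qed
  then have "oiso Y (P1 \<union> P2 \<union> P3 \<union> P4) Y (cell u k (ico X ?x ?y))"
    unfolding P3_def ooi_eq ico_eq cell_Un by (simp only: Un_assoc)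
  then show ?thesis
    unfolding eq[symmetric] using isK_trans[OF ico_Field _ isK_cell[OF u kF T1 xy]] by blast
qed

text \<open>The points that are eventually \<open>p\<close>.\<close>

definition tails :: "('i \<Rightarrow> 'a) set" where
  "tails = {d\<in>PP. \<exists>i. (\<exists>j. lt r j i) \<and> d = down d i}"

text \<open>The truncation index can be raised beyond any \<open>k\<close>, since past the original
  one all coordinates equal \<open>p\<close> already.\<close>

lemma tailsE:
  assumes "d \<in> tails" "k \<in> Field r"
  obtains i where "lt r k i" "d = down d i"
proof -
  obtain i j where i: "d \<in> PP" "lt r j i" "d = down d i" using assms(1) unfolding tails_def by blast
  obtain s where s: "\<And>m. lt r m s \<longleftrightarrow> (m, k) \<in> r" "lt r k s" by (rule successor[OF assms(2)]) blast
  show ?thesis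
  proof (cases "lt r k i")
    case True then show ?thesis using that i(3) by blast
  next
    case False
    then have "(i, k) \<in> r" using not_lt_le[OF lr assms(2) lt_Field(2)[OF i(2)]] by blast
    then have i_s: "lt r i s" using s by blast
    have "d m = down d s m" if m: "m \<in> Field r" for m
    proof (cases "lt r m s")
      case True then show ?thesis using down_less[OF True] by metis
    next
      case False
      then have "\<not> lt r m i" using lt_trans[OF lr _ i_s] by blast
      then show ?thesis using down_ge[OF m, of i d] down_ge[OF m False, of d] i(3) by metis
    qed
    then have "d = down d s"
      by (intro PiE_ext[OF i(1) down_PP[OF i(1) s(2)]]) blast
    then show ?thesis using that s(2) by blast
  qed
qed

lemma isK_tails:
  assumes "d \<in> tails" "d' \<in> tails" "lt Y d d'"
  shows "isK (ico Y d d')"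
proof -
  have P: "d \<in> PP" "d' \<in> PP" using assms unfolding tails_def by blast+
  obtain k where k: "k \<in> Field r" "lt X (d k) (d' k)" "\<And>m. lt r m k \<Longrightarrow> d m = d' m"
    by (rule L.lt_lexpE[OF assms(3)]) blast
  obtain i where i: "lt r k i" "d = down d i" by (rule tailsE[OF assms(1) k(1)])
  obtain j where j: "lt r k j" "d' = down d' j" by (rule tailsE[OF assms(2) k(1)])
  show ?thesis using isK_ico_down[OF P k(2,3) i(1) j(1)] i(2) j(2) by metis
qed

text \<open>The comparison of \<open>a\<close> and \<open>b\<close> is decided at one coordinate
  \<open>k\<close>; with an intermediate value placed there, the later coordinates can be filled
  with \<open>p\<close>.\<close>

lemma tails_dense:
  assumes "lt Y a b" shows "\<exists>d\<in>tails. lt Y a d \<and> lt Y d b"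
proof -
  have P: "a \<in> PP" "b \<in> PP" using lt_Field[OF assms] unfolding FY by blast+
  obtain k where k: "k \<in> Field r" "lt X (a k) (b k)" "\<And>m. lt r m k \<Longrightarrow> a m = b m"
    by (rule L.lt_lexpE[OF assms]) blast
  obtain c where c: "lt X (a k) c" "lt X c (b k)" using order_denseE[OF dX k(2)] .
  obtain s where s: "\<And>m. lt r m s \<longleftrightarrow> (m, k) \<in> r" "lt r k s" by (rule successor[OF k(1)]) blast
  have cT: "c \<in> T k" using T_ico[OF PP_T[OF P(1) k(1)] PP_T[OF P(2) k(1)]] c lt_le[OF c(1)] unfolding ico_def by blast
  define e where "e = a(k := c)"
  have e: "e \<in> PP" unfolding e_def using P(1) cT k(1) by (auto simp: PiE_def Pi_def extensional_def)
  define d where "d = down e s"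
  have dP: "d \<in> PP" unfolding d_def by (rule down_PP[OF e s(2)])
  have dk: "d k = c" unfolding d_def using down_less[OF s(2)] by (simp add: e_def)
  have dm: "d m = a m" if m: "lt r m k" for m
    unfolding d_def using down_less[OF lt_trans[OF lr m s(2)]] m by (auto simp: e_def)
  have "d = down d s"
  proof (rule PiE_ext[OF dP down_PP[OF dP s(2)]])
    fix m assume m: "m \<in> Field r"
    show "d m = down d s m"
    proof (cases "lt r m s")
      case True then show ?thesis using down_less[OF True] by metis
    next
      case False then show ?thesis unfolding d_def using down_ge[OF m False] by metis
    qed
  qed
  then have "d \<in> tails" unfolding tails_def using dP s(2) by blast
  moreover have "lt Y a d" by (rule lt_YI[OF P(1) dP _ _ k(1)]) (use dk dm c in auto)
  moreover have "lt Y d b" by (rule lt_YI[OF dP P(2) _ _ k(1)]) (use dk dm c k(3) in auto)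
  ultimately show ?thesis by blast
qed

section \<open>Decomposition of convex sets without end points\<close>

lemma ccof_Y: "ccof Y" "ccof (Y\<inverse>)"
proof -
  show "ccof Y" by (rule L.ccof_lexp[OF HLOTS_ccof[OF HX] countable])
  interpret D: long_tower "X\<inverse>" q p r by (rule dual)
  show "ccof (Y\<inverse>)"
    using D.L.ccof_lexp[OF HLOTS_ccof[OF HLOTS_converse[OF HX]] countable]
    unfolding lexp_converse tower_coord_converse .
qed

text \<open>Points that are eventually \<open>p\<close> cut \<open>C\<close> into half-open blocks,
  cofinally upwards and coinitially downwards. The ascending blocks merge into one,
  \<open>d\<close>. The descending ones remain a sequence: a half-open cell has a least point, and
  \<open>C\<close> has none.\<close>

lemma convex_split:
  assumes C: "lots_convex Y C" "C \<noteq> {}" "\<forall>z\<in>C. \<exists>w\<in>C. lt Y z w" "\<forall>z\<in>C. \<exists>w\<in>C. lt Y w z"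
  shows "\<exists>(L :: nat \<Rightarrow> ('i \<Rightarrow> 'a) set) d. C = (\<Union>n. L n) \<union> d \<and> isK d \<and> (\<forall>n. isK (L n)) \<and>
    (\<forall>m n x y. m < n \<longrightarrow> x \<in> L m \<longrightarrow> y \<in> L n \<longrightarrow> lt Y y x) \<and> (\<forall>n x y. x \<in> L n \<longrightarrow> y \<in> d \<longrightarrow> lt Y x y)"
proof -
  have CF: "C \<subseteq> Field Y" using C(1) unfolding lots_convex_def by blast
  define A where "A = C \<inter> tails"
  have AF: "A \<subseteq> Field Y" using CF unfolding A_def by blast
  have btw: "\<exists>d\<in>A. lt Y a d \<and> lt Y d b" if ab: "a \<in> C" "b \<in> C" "lt Y a b" for a b
    using tails_dense[OF ab(3)] lots_convex_lt[OF C(1) ab(1,2)] unfolding A_def by blast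
  have up: "\<exists>b\<in>A. lt Y a b" if "a \<in> C" for a using C(3)[rule_format, OF that] btw[OF that] by blast
  have dn: "\<exists>b\<in>A. lt Y b a" if "a \<in> C" for a using C(4)[rule_format, OF that] btw[OF _ that] by blast
  have nm: "\<exists>b\<in>A. lt Y a b" if "a \<in> A" for a using up that unfolding A_def by blast
  have nn: "\<exists>b\<in>A. lt (Y\<inverse>) a b" if "a \<in> A" for a using dn that unfolding A_def by simp
  obtain a0 where a0: "a0 \<in> A" using C(2) up by blast
  obtain x :: "nat \<Rightarrow> 'i \<Rightarrow> 'a" where x: "x 0 = a0" "\<And>n. x n \<in> A" "\<And>n. lt Y (x n) (x (Suc n))" "\<And>a. a \<in> A \<Longrightarrow> \<exists>n. lt Y a (x n)"
    by (rule ccof_seq[OF lY ccof_Y(1) AF nm a0]) blast+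
  have AF': "A \<subseteq> Field (Y\<inverse>)" using AF by simp
  obtain y :: "nat \<Rightarrow> 'i \<Rightarrow> 'a" where y: "y 0 = a0" "\<And>n. y n \<in> A" "\<And>n. lt Y (y (Suc n)) (y n)" "\<And>a. a \<in> A \<Longrightarrow> \<exists>n. lt Y (y n) a"
    by (rule ccof_seq[OF lots_converse[OF lY] ccof_Y(2) AF' nn a0]) (unfold lt_converse, blast+)
  have ychain: "lt Y (y n) (y m)" if "m < n" for m n
    using lt_chain[of "Y\<inverse>" y m n] lots_converse[OF lY] y(3) that by simp
  have xchain: "lt Y (x m) (x n)" if "m < n" for m n
    using lt_chain[of Y x m n] lY x(3) that by simp
  have tails: "x n \<in> tails" "y n \<in> tails" "x n \<in> C" "y n \<in> C" for n using x(2) y(2) unfolding A_def by blast+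
  define L where "L n = ico Y (y (Suc n)) (y n)" for n
  define U where "U n = ico Y (x n) (x (Suc n))" for n
  have KL: "isK (L n)" for n unfolding L_def by (rule isK_tails[OF tails(2) tails(2) y(3)])
  have KU: "isK (U n)" for n unfolding U_def by (rule isK_tails[OF tails(1) tails(1) x(3)])
  have refl: "(x n, x n) \<in> Y" "(y n, y n) \<in> Y" for n using lots_refl[OF lY] tails CF by blast+
  have KUU: "isK (\<Union>n. U n)"
  proof (rule isK_UN[OF KU])
    fix m n :: nat and a b assume mn: "m < n" and ab: "a \<in> U m" "b \<in> U n"
    have "(x (Suc m), x n) \<in> Y" using mn xchain[of "Suc m" n] lt_le refl(1) by (cases "Suc m = n") auto
    then show "lt Y a b" using ico_lt[OF lY _ ab[unfolded U_def]] by blast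
  qed
  have Lord: "lt Y b a" if mn: "m < n" and ab: "a \<in> L m" "b \<in> L n" for m n a b
  proof -
    have "(y n, y (Suc m)) \<in> Y" using mn ychain[of "Suc m" n] lt_le refl(2) by (cases "Suc m = n") auto
    then show ?thesis using ico_lt[OF lY _ ab(2,1)[unfolded L_def]] by blast
  qed
  have LU: "lt Y a b" if ab: "a \<in> L n" "b \<in> (\<Union>n. U n)" for n a b
  proof -
    have "lt Y a (y n)" using ab(1) unfolding L_def ico_def by blast
    moreover have "(y n, a0) \<in> Y" using ychain[of 0 n] y(1) lt_le refl(2)[of 0] by (cases "n = 0") auto
    moreover obtain m where "(x m, b) \<in> Y" using ab(2) unfolding U_def ico_def by blast
    moreover have "(a0, x m) \<in> Y" using xchain[of 0 m] x(1) lt_le refl(1)[of 0] by (cases "m = 0") auto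
    ultimately show ?thesis using lt_le_trans[OF lY] by blast
  qed
  have "C = (\<Union>n. L n) \<union> (\<Union>n. U n)"
  proof (intro equalityI subsetI)
    fix z assume z: "z \<in> C"
    then have zF: "z \<in> Field Y" using CF by blast
    obtain b c where bc: "b \<in> A" "lt Y z b" "c \<in> A" "lt Y c z" using up[OF z] dn[OF z] by blast
    obtain n m where nm: "lt Y b (x n)" "lt Y (y m) c" using x(4)[OF bc(1)] y(4)[OF bc(3)] by blast
    have zx: "lt Y z (x n)" and yz: "lt Y (y m) z" using lt_trans[OF lY] bc nm by blast+
    show "z \<in> (\<Union>n. L n) \<union> (\<Union>n. U n)"
    proof (cases "lt Y z a0")
      case True
      define k where "k = (LEAST k. (y k, z) \<in> Y)"
      have k: "(y k, z) \<in> Y" unfolding k_def by (rule LeastI[of _ m]) (rule lt_le[OF yz])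
      have "k \<noteq> 0" using k y(1) lt_not_le[OF lY True] by metis
      then obtain l where l: "k = Suc l" using not0_implies_Suc by blast
      have "(y l, z) \<notin> Y" using not_less_Least[of l "\<lambda>k. (y k, z) \<in> Y"] l unfolding k_def by simp
      then have "lt Y z (y l)" using not_le_lt[OF lY _ zF] tails(4) CF by blast
      then have "z \<in> L l" using k unfolding L_def ico_def l by blast
      then show ?thesis by blast
    next
      case False
      then have a0z: "(x 0, z) \<in> Y" using not_lt_le[OF lY zF] a0 AF x(1) by blast
      define k where "k = (LEAST k. lt Y z (x k))"
      have k: "lt Y z (x k)" unfolding k_def by (rule LeastI[of _ n]) (rule zx)
      have "k \<noteq> 0" using k a0z lt_not_le[OF lY] by metis
      then obtain l where l: "k = Suc l" using not0_implies_Suc by blast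
      have "\<not> lt Y z (x l)" using not_less_Least[of l "\<lambda>k. lt Y z (x k)"] l unfolding k_def by simp
      then have "(x l, z) \<in> Y" using not_lt_le[OF lY zF] tails(3) CF by blast
      then have "z \<in> U l" using k unfolding U_def ico_def l by blast
      then show ?thesis by blast
    qed
  next
    fix z assume z: "z \<in> (\<Union>n. L n) \<union> (\<Union>n. U n)"
    have conv: "z \<in> C" if "(a, z) \<in> Y" "lt Y z b" "a \<in> C" "b \<in> C" for a b
      using lots_convex_lt[OF C(1) that(3,4) _ that(2)] that(1,3) unfolding lt_def by blast
    show "z \<in> C" using z conv tails(3,4) unfolding L_def U_def ico_def by blast
  qed
  then show ?thesis using KUU KL Lord LU by (intro exI[of _ L] exI[of _ "\<Union>n. U n"] conjI allI impI)
qed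

lemma convex_iso:
  assumes C: "lots_convex Y C" "C \<noteq> {}" "\<forall>z\<in>C. \<exists>w\<in>C. lt Y z w" "\<forall>z\<in>C. \<exists>w\<in>C. lt Y w z"
    and C': "lots_convex Y C'" "C' \<noteq> {}" "\<forall>z\<in>C'. \<exists>w\<in>C'. lt Y z w" "\<forall>z\<in>C'. \<exists>w\<in>C'. lt Y w z"
  shows "oiso Y C Y C'"
proof -
  obtain L :: "nat \<Rightarrow> ('i \<Rightarrow> 'a) set" and d where L: "C = (\<Union>n. L n) \<union> d" "isK d" "\<forall>n. isK (L n)"
    "\<forall>m n x y. m < n \<longrightarrow> x \<in> L m \<longrightarrow> y \<in> L n \<longrightarrow> lt Y y x" "\<forall>n x y. x \<in> L n \<longrightarrow> y \<in> d \<longrightarrow> lt Y x y"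
    using convex_split[OF C] by (elim exE conjE)
  obtain L' :: "nat \<Rightarrow> ('i \<Rightarrow> 'a) set" and d' where L': "C' = (\<Union>n. L' n) \<union> d'" "isK d'" "\<forall>n. isK (L' n)"
    "\<forall>m n x y. m < n \<longrightarrow> x \<in> L' m \<longrightarrow> y \<in> L' n \<longrightarrow> lt Y y x" "\<forall>n x y. x \<in> L' n \<longrightarrow> y \<in> d' \<longrightarrow> lt Y x y"
    using convex_split[OF C'] by (elim exE conjE)
  have LL: "oiso Y (L n) Y (L' n)" for n using isK_iso L(3) L'(3) by blast
  \<comment> \<open>The blocks \<open>L n\<close> descend as \<open>n\<close> grows, so they are
    glued in the reversed order.\<close>
  have "oiso (Y\<inverse>) (\<Union>n. L n) (Y\<inverse>) (\<Union>n. L' n)"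
    by (rule oiso_UN[OF lots_converse[OF lY]])
      (unfold lt_converse oiso_converse, (use L(4) L'(4) LL in blast)+)
  then have "oiso Y (\<Union>n. L n) Y (\<Union>n. L' n)" unfolding oiso_converse .
  then show ?thesis unfolding L(1) L'(1)
    by (rule oiso_Un[OF lY _ _ _ isK_iso[OF L(2) L'(2)], rotated 2]) (use L(5) L'(5) in blast)+
qed

theorem HLOTS_Y: "HLOTS Y"
proof -
  have dY: "order_dense Y"
    using order_dense_tower[OF lX wo dX, of p q] unfolding tower_eq_lexp .
  \<comment> \<open>At the least index the coordinate ranges over all of \<open>X\<close>, which has
    no end points; changing it there shows that the tower has none.\<close>
  obtain i0 where i0: "i0 \<in> Field r" "\<And>i. i \<in> Field r \<Longrightarrow> (i0, i) \<in> r" using wo_least[OF wo order_refl ne] by blast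
  have nl: "\<not> lt r k i0" for k using i0(2)[OF lt_Field(1)] lt_not_le[OF lr] by blast
  have T0: "T i0 = Field X" unfolding tower_coord_def using nl by auto
  have upd: "z(i0 := c) \<in> PP" if "z \<in> PP" "c \<in> Field X" for z c
    using that T0 i0(1) by (auto simp: PiE_def Pi_def extensional_def)
  have nomaxY: "\<exists>w. lt Y z w" "\<exists>w. lt Y w z" if z: "z \<in> PP" for z
  proof -
    obtain b c where "lt X (z i0) b" "lt X c (z i0)"
      using HLOTS_no_max[OF HX L.coord[OF z i0(1)]] HLOTS_no_min[OF HX L.coord[OF z i0(1)]] by blast
    moreover have "lt Y z (z(i0 := b))" if "lt X (z i0) b"
      by (rule lt_YI[OF z upd[OF z lt_Field(2)[OF that]] _ _ i0(1)]) (use nl that in auto)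
    moreover have "lt Y (z(i0 := c)) z" if "lt X c (z i0)"
      by (rule lt_YI[OF upd[OF z lt_Field(1)[OF that]] z _ _ i0(1)]) (use nl that in auto)
    ultimately show "\<exists>w. lt Y z w" "\<exists>w. lt Y w z" by blast+
  qed
  define z0 where "z0 = (\<lambda>i\<in>Field r. p)"
  have z0: "z0 \<in> PP" unfolding z0_def using pJ J_T by auto
  have whole: "lots_convex Y (Field Y)" unfolding lots_convex_def lots_interval_def using le_Field(1) by fast
  have ends: "\<exists>w\<in>Field Y. lt Y z w" "\<exists>w\<in>Field Y. lt Y w z" if "z \<in> Field Y" for z
    using nomaxY[of z] that lt_Field[of Y] unfolding FY by blast+
  have "oiso Y (Field Y) Y C" if C: "openin (lots_topology Y) C" "lots_convex Y C" "C \<noteq> {}" for C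
  proof (rule convex_iso[OF whole _ _ _ C(2,3)])
    have CF: "C \<subseteq> Field Y" using C(2) unfolding lots_convex_def by blast
    show "Field Y \<noteq> {}" using z0 FY by blast
    show "\<forall>z\<in>C. \<exists>w\<in>C. lt Y z w" using open_right[OF lY dY C(1)] ends(1) CF by blast
    show "\<forall>z\<in>C. \<exists>w\<in>C. lt Y w z" using open_left[OF lY dY C(1)] ends(2) CF by blast
  qed (use ends in blast)+
  moreover have "\<exists>a\<in>Field Y. \<exists>b\<in>Field Y. \<exists>c\<in>Field Y. a \<noteq> b \<and> a \<noteq> c \<and> b \<noteq> c"
  proof -
    obtain a b where ab: "lt Y a z0" "lt Y z0 b" using nomaxY[OF z0] by blast
    have "lt Y a b" using lt_trans[OF lY ab] .
    then show ?thesis using ab lt_Field[OF ab(1)] lt_Field[OF ab(2)] unfolding lt_def by metis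
  qed
  ultimately show ?thesis unfolding HLOTS_iff using lY by blast
qed

end

text \<open>A tail-like ordinal with a last index embeds into its one-point final segment, hence is
  the ordinal 1, and its tower is a copy of \<open>X\<close>. All others fall under
  \<open>long_tower\<close>.\<close>

theorem HLOTS_tower:
  assumes HX: "HLOTS X" and pq: "lt X p q" and tl: "tail_like \<alpha>" and c: "countable (Field \<alpha>)"
  shows "HLOTS (tower X p q \<alpha>)"
proof (cases "\<exists>m\<in>Field \<alpha>. \<forall>i\<in>Field \<alpha>. (i, m) \<in> \<alpha>")
  case False
  have wo: "Well_order \<alpha>" "Field \<alpha> \<noteq> {}" using tl unfolding tail_like_def by blast+
  have "long_tower X p q \<alpha>"
  proof
    show "\<exists>j. lt \<alpha> i j" if i: "i \<in> Field \<alpha>" for i using False i not_le_lt[OF wo_lots[OF wo(1)] _ i] by blast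
  qed (use HX pq wo c tail_like_tail[OF tl] in blast)+
  then show ?thesis unfolding tower_eq_lexp by (rule long_tower.HLOTS_Y)
next
  case True
  then obtain m where m: "m \<in> Field \<alpha>" "\<And>i. i \<in> Field \<alpha> \<Longrightarrow> (i, m) \<in> \<alpha>" by blast
  have wo: "Well_order \<alpha>" using tl unfolding tail_like_def by blast
  note l = wo_lots[OF wo] and lX = HLOTS_lots[OF HX]
  have Ft: "Field (tail \<alpha> m) \<subseteq> {m}"
    unfolding Field_tail[OF wo] using m(2)[OF le_Field(2)] lots_antisym[OF l] by blast
  obtain e where e: "\<And>i. i \<in> Field \<alpha> \<Longrightarrow> e i \<in> Field (tail \<alpha> m)" "\<And>i j. lt \<alpha> i j \<Longrightarrow> lt (tail \<alpha> m) (e i) (e j)"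
    by (rule ordLeq_strict_mono[OF tail_like_tail[OF tl m(1)]]) blast
  have no: "\<not> lt \<alpha> i j" for i j
  proof
    assume "lt \<alpha> i j"
    then have "lt (tail \<alpha> m) (e i) (e j)" by (rule e(2))
    then show False using lt_Field Ft by (metis lt_irrefl singletonD subsetD)
  qed
  have F: "Field \<alpha> = {m}" using m no unfolding lt_def by blast
  interpret L: lexprod X \<alpha> "tower_coord X p q \<alpha>" by (rule lexprod_tower[OF lX wo])
  have T: "tower_coord X p q \<alpha> i = Field X" for i unfolding tower_coord_def using no by simp
  have P: "(\<lambda>i\<in>Field \<alpha>. x) \<in> PiE (Field \<alpha>) (tower_coord X p q \<alpha>)" if "x \<in> Field X" for x using that T by auto
  show ?thesis unfolding tower_eq_lexp
  proof (rule HLOTS_transfer[OF HX L.lots_lexp, of "\<lambda>x. \<lambda>i\<in>Field \<alpha>. x"])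
    show "(\<lambda>x. \<lambda>i\<in>Field \<alpha>. x) ` Field X = Field L.Y"
    proof (intro equalityI subsetI)
      fix z assume "z \<in> Field L.Y"
      then have z: "z \<in> PiE {m} (\<lambda>_. Field X)" unfolding L.Field_lexp F T .
      then have "z = (\<lambda>i\<in>Field \<alpha>. z m)" unfolding F by (auto simp: PiE_def extensional_def restrict_def)
      then show "z \<in> (\<lambda>x. \<lambda>i\<in>Field \<alpha>. x) ` Field X" using z by blast
    qed (use P L.Field_lexp in blast)
    show "lt L.Y (\<lambda>i\<in>Field \<alpha>. x) (\<lambda>i\<in>Field \<alpha>. y)" if "lt X x y" for x y
      by (rule L.lt_lexpI[OF P[OF lt_Field(1)[OF that]] P[OF lt_Field(2)[OF that]] m(1)]) (use that no m(1) in auto)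
  qed
qed

theorem theorem1p1:
  fixes X :: "'a rel" and p q :: 'a
  assumes "HLOTS X"
    and "(p, q) \<in> X" and "p \<noteq> q"
  shows
    "(\<forall>\<alpha> :: 'i rel. tail_like \<alpha> \<and> countable (Field \<alpha>) \<longrightarrow>
        HLOTS (tower X p q \<alpha>) \<and> CHLOTS (lots_completion (tower X p q \<alpha>)) \<and>
        (CHLOTS X \<longrightarrow> CHLOTS (tower X p q \<alpha>)))
     \<and>
     (CHLOTS X \<longrightarrow>
        (\<forall>(\<alpha> :: 'i rel) (\<beta> :: 'j rel).
           Well_order \<alpha> \<and> Field \<alpha> \<noteq> {} \<and> Well_order \<beta> \<and> Field \<beta> \<noteq> {} \<and> \<beta> <o \<alpha> \<longrightarrow>
           bigger (tower X p q \<alpha>) (tower X p q \<beta>) \<and>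
           \<not> lots_topology (tower X p q \<alpha>) homeomorphic_space lots_topology (tower X p q \<beta>)))
     \<and>
     (IHLOTS X \<and> R_bounded X \<longrightarrow>
        (\<exists>\<theta> :: nat rel. Well_order \<theta> \<and>
           (\<forall>(\<alpha> :: nat rel) (\<beta> :: nat rel).
              tail_like \<alpha> \<and> tail_like \<beta> \<and> \<beta> <o \<alpha> \<and> \<theta> \<le>o \<beta> \<longrightarrow>
              bigger (lots_completion (tower X p q \<alpha>)) (lots_completion (tower X p q \<beta>)))))"
proof (intro conjI allI impI)
  note X = HLOTS_lots[OF assms(1)]
  have pq: "lt X p q" using assms(2,3) by (simp add: lt_def)
  fix \<alpha> :: "'i rel" assume "tail_like \<alpha> \<and> countable (Field \<alpha>)"
  then have \<alpha>: "tail_like \<alpha>" "countable (Field \<alpha>)" and wo: "Well_order \<alpha>" unfolding tail_like_def by blast+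
  show H: "HLOTS (tower X p q \<alpha>)" by (rule HLOTS_tower[OF assms(1) pq \<alpha>])
  show "CHLOTS (lots_completion (tower X p q \<alpha>))" by (rule CHLOTS_completion[OF H])
  assume "CHLOTS X"
  then have "lots_complete (tower X p q \<alpha>)"
    using lots_complete_tower[OF X _ assms(2) wo] unfolding CHLOTS_def by blast
  then show "CHLOTS (tower X p q \<alpha>)" using H unfolding CHLOTS_def by blast
next
  have pq: "lt X p q" using assms(2,3) by (simp add: lt_def)
  fix \<alpha> :: "'i rel" and \<beta> :: "'j rel"
  assume C: "CHLOTS X" and "Well_order \<alpha> \<and> Field \<alpha> \<noteq> {} \<and> Well_order \<beta> \<and> Field \<beta> \<noteq> {} \<and> \<beta> <o \<alpha>"
  then have ba: "\<beta> <o \<alpha>" by blast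
  show "bigger (tower X p q \<alpha>) (tower X p q \<beta>)"
    "\<not> lots_topology (tower X p q \<alpha>) homeomorphic_space lots_topology (tower X p q \<beta>)"
    using tower_bigger[OF C pq ba] by blast+
next
  have pq: "lt X p q" using assms(2,3) by (simp add: lt_def)
  assume "IHLOTS X \<and> R_bounded X"
  then show "\<exists>\<theta> :: nat rel. Well_order \<theta> \<and>
           (\<forall>(\<alpha> :: nat rel) (\<beta> :: nat rel).
              tail_like \<alpha> \<and> tail_like \<beta> \<and> \<beta> <o \<alpha> \<and> \<theta> \<le>o \<beta> \<longrightarrow>
              bigger (lots_completion (tower X p q \<alpha>)) (lots_completion (tower X p q \<beta>)))"
    using completion_tower_bigger[OF assms(1) pq] by blast
qed

end
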